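(* Let $K\ge 1$ and $K_0\ge 0$ be constants and let $f=u+iv$ ($u,v$ real-valued) be a harmonic $(K,K_0)$-quasiregular mapping in $\mathbb D$. ($\mathscr C_1$) Let $p\in(0,1]$. If $M_p(r,\nabla u)=O\left(\frac{1}{1-r}\right)$, then $$M_p(r,f)=O\left(\left(\log\frac1{1-r}\right)^{1/p}\right).$$ In particular, if $p\in[1/2,1)$, this estimate is sharp, i.e. for all $p\in[1/2,1)$, $K\ge1$, $K_0\ge0$ there is a harmonic $(K,K_0)$-quasiregular mapping $f=u+iv$ in $\mathbb D$ with $M_p(r,\nabla u)=O\left(\frac1{1-r}\right)$ and $M_p(r,f)\asymp\left(\log\frac1{1-r}\right)^{1/p}$ as $r\to1^-$. ($\mathscr C_2$) Let $p\in(1,2)$. If $\eta$ is a weight and $M_p(r,\nabla u)=O(\eta(r))$, then $M_p(r,f)=O(\Psi(r))$, where $$\Psi(r)=\left(\int_0^r(1-\rho^2)^{p-1}(\eta(\rho))^p\,d\rho+\frac{2^{p-1}}{p}(\eta(r))^p(1-r)^p\right)^{1/p}.$$ Conversely, if $M_p(r,f)=O(\Psi(r))$ holds for a doubling weight $\Psi$, then $M_p(r,\nabla u)=O\left(\frac{\Psi(r)}{1-r}\right)$. ($\mathscr C_3$) Let $p\in[2,\infty)$. If $\eta$ is a weight and $M_p(r,\nabla u)=O(\eta(r))$, then $M_p(r,f)=O(\Phi(r))$, where $$\Phi(r)=\left(\int_0^r(1-\rho)(\eta(\rho))^2\,d\rho\right)^{1/2}.$$ Conversely, if $M_p(r,f)=O(\Phi(r))$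 holds for a doubling weight $\Phi$, then $M_p(r,\nabla u)=O\left(\frac{\Phi(r)}{1-r}\right)$.
   Context: $\mathbb D=\{z\in\mathbb C:|z|<1\}$. A harmonic mapping in $\mathbb D$ is a complex-valued $C^2$ function $f=u+iv$ with $\Delta u=\Delta v=0$. Put $f_z=\frac12(f_x-if_y)$, $f_{\overline z}=\frac12(f_x+if_y)$, $\Lambda_f=|f_z|+|f_{\overline z}|$, and $J_f=|f_z|^2-|f_{\overline z}|^2$ (the Jacobian). A mapping $f$ is $(K,K_0)$-quasiregular ($K\ge1$, $K_0\ge0$ constants) if it is absolutely continuous on lines with locally $L^2$ partial derivatives, $J_f\ge0$ a.e., and $\Lambda_f^2\le KJ_f+K_0$ a.e. A harmonic $(K,K_0)$-quasiregular mapping is one that is both harmonic and $(K,K_0)$-quasiregular. For $p\in(0,\infty)$, $r\in[0,1)$: $M_p(r,f)=\left(\frac1{2\pi}\int_0^{2\pi}|f(re^{i\theta})|^p\,d\theta\right)^{1/p}$, and $M_p(r,\nabla u)$ is the same mean of $|\nabla u|=(u_x^2+u_y^2)^{1/2}$. For nonnegative functions $\chi_1,\chi_2$ on $[0,1)$, $\chi_1(r)=O(\chi_2(r))$ means: there exist $C>0$ and $r_0\in(0,1)$ with $\chi_1(r)\le C\chi_2(r)$ for all $r\in(r_0,1)$. $\chi_1\asymp\chi_2$ as $r\to1^-$ means $\chi_1=O(\chi_2)$ and $\chi_2=O(\chi_1)$. A weight is a continuous, non-decreasing, unbounded function $\eta:[0,1)\to(0,\infty)$. A weight $\eta$ is doubling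 if there is a constant $C>1$ with $\eta(1-s/2)<C\eta(1-s)$ for all $s\in(0,1]$. *)

theory Defs
  imports "HOL-Analysis.Analysis" "HOL-Library.Landau_Symbols"
begin

abbreviation unit_disc :: "complex set" where
  "unit_disc \<equiv> ball 0 1"


section \<open>Partial derivatives and harmonic mappings\<close>

definition partial_x :: "(complex \<Rightarrow> 'a::real_normed_vector) \<Rightarrow> complex \<Rightarrow> 'a" where
  "partial_x f z = vector_derivative (\<lambda>t::real. f (z + of_real t)) (at 0)"

definition partial_y :: "(complex \<Rightarrow> 'a::real_normed_vector) \<Rightarrow> complex \<Rightarrow> 'a" where
  "partial_y f z = vector_derivative (\<lambda>t::real. f (z + \<i> * of_real t)) (at 0)"

definition has_partials_at :: "(complex \<Rightarrow> 'a::real_normed_vector) \<Rightarrow> complex \<Rightarrow> bool" where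
  "has_partials_at f z \<longleftrightarrow>
     (\<lambda>t::real. f (z + of_real t)) differentiable (at 0) \<and>
     (\<lambda>t::real. f (z + \<i> * of_real t)) differentiable (at 0)"

text \<open>The class \<open>C\<^sup>k\<close> on an open set: all partial derivatives of order at most \<open>k\<close> (order
  \<open>0\<close> being the function itself) exist and are continuous.\<close>

fun Ck_on :: "nat \<Rightarrow> complex set \<Rightarrow> (complex \<Rightarrow> 'a::real_normed_vector) \<Rightarrow> bool" where
  "Ck_on 0 S f \<longleftrightarrow> continuous_on S f"
| "Ck_on (Suc k) S f \<longleftrightarrow>
     continuous_on S f \<and> (\<forall>z\<in>S. has_partials_at f z) \<and>
     Ck_on k S (partial_x f) \<and> Ck_on k S (partial_y f)"

definition laplacian :: "(complex \<Rightarrow> 'a::real_normed_vector) \<Rightarrow> complex \<Rightarrow> 'a" where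
  "laplacian u z = partial_x (partial_x u) z + partial_y (partial_y u) z"

definition harmonic_on :: "complex set \<Rightarrow> (complex \<Rightarrow> complex) \<Rightarrow> bool" where
  "harmonic_on S f \<longleftrightarrow> Ck_on 2 S f \<and>
     (\<forall>z\<in>S. laplacian (\<lambda>w. Re (f w)) z = 0 \<and> laplacian (\<lambda>w. Im (f w)) z = 0)"

text \<open>The gradient of a real function on the plane as a vector of the plane; its norm is
  \<open>sqrt (u\<^sub>x\<^sup>2 + u\<^sub>y\<^sup>2)\<close>.\<close>

definition gradient :: "(complex \<Rightarrow> real) \<Rightarrow> complex \<Rightarrow> complex" where
  "gradient u z = Complex (partial_x u z) (partial_y u z)"


section \<open>Quasiregular mappings\<close>

definition d_z :: "(complex \<Rightarrow> complex) \<Rightarrow> complex \<Rightarrow> complex" where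
  "d_z f z = (partial_x f z - \<i> * partial_y f z) / 2"

definition d_zbar :: "(complex \<Rightarrow> complex) \<Rightarrow> complex \<Rightarrow> complex" where
  "d_zbar f z = (partial_x f z + \<i> * partial_y f z) / 2"

definition Lambda :: "(complex \<Rightarrow> complex) \<Rightarrow> complex \<Rightarrow> real" where
  "Lambda f z = cmod (d_z f z) + cmod (d_zbar f z)"

definition Jacobian :: "(complex \<Rightarrow> complex) \<Rightarrow> complex \<Rightarrow> real" where
  "Jacobian f z = (cmod (d_z f z))\<^sup>2 - (cmod (d_zbar f z))\<^sup>2"

text \<open>Absolute continuity of a function of one real variable on an interval \<open>I\<close>. (The library
  constant \<open>absolutely_continuous\<close> is the unrelated notion for measures.)\<close>

definition abs_continuous_on :: "real set \<Rightarrow> (real \<Rightarrow> 'a::real_normed_vector) \<Rightarrow> bool" where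
  "abs_continuous_on I g \<longleftrightarrow>
     (\<forall>\<epsilon>>0. \<exists>\<delta>>0. \<forall>(n::nat) a b.
        (\<forall>i<n. a i \<in> I \<and> b i \<in> I \<and> a i \<le> b i) \<and>
        disjoint_family_on (\<lambda>i. {a i<..<b i}) {..<n} \<and>
        (\<Sum>i<n. b i - a i) < \<delta> \<longrightarrow>
        (\<Sum>i<n. norm (g (b i) - g (a i))) < \<epsilon>)"

text \<open>Absolute continuity on lines: \<open>f\<close> is continuous, and on every closed rectangle in \<open>S\<close> with
  sides parallel to the axes it is absolutely continuous on almost every horizontal and almost
  every vertical segment of the rectangle. In the type of complex numbers, \<open>cbox w z\<close> is the
  rectangle with lower left corner \<open>w\<close> and upper right corner \<open>z\<close>.\<close>

definition ACL_on :: "complex set \<Rightarrow> (complex \<Rightarrow> 'a::real_normed_vector) \<Rightarrow> bool" where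
  "ACL_on S f \<longleftrightarrow> continuous_on S f \<and>
     (\<forall>w z. cbox w z \<subseteq> S \<longrightarrow>
        (AE y\<in>{Im w..Im z} in lebesgue.
           abs_continuous_on {Re w..Re z} (\<lambda>x. f (Complex x y))) \<and>
        (AE x\<in>{Re w..Re z} in lebesgue.
           abs_continuous_on {Im w..Im z} (\<lambda>y. f (Complex x y))))"

definition locally_L2_on :: "complex set \<Rightarrow> (complex \<Rightarrow> complex) \<Rightarrow> bool" where
  "locally_L2_on S g \<longleftrightarrow>
     (\<forall>C. compact C \<and> C \<subseteq> S \<longrightarrow>
        set_borel_measurable lebesgue C g \<and>
        set_integrable lebesgue C (\<lambda>z. (cmod (g z))\<^sup>2))"

definition quasiregular_on :: "real \<Rightarrow> real \<Rightarrow> complex set \<Rightarrow> (complex \<Rightarrow> complex) \<Rightarrow> bool" where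
  "quasiregular_on K K0 S f \<longleftrightarrow>
     ACL_on S f \<and> locally_L2_on S (partial_x f) \<and> locally_L2_on S (partial_y f) \<and>
     (AE z\<in>S in lebesgue. Jacobian f z \<ge> 0) \<and>
     (AE z\<in>S in lebesgue. (Lambda f z)\<^sup>2 \<le> K * Jacobian f z + K0)"

definition harmonic_quasiregular_on ::
    "real \<Rightarrow> real \<Rightarrow> complex set \<Rightarrow> (complex \<Rightarrow> complex) \<Rightarrow> bool" where
  "harmonic_quasiregular_on K K0 S f \<longleftrightarrow> harmonic_on S f \<and> quasiregular_on K K0 S f"


section \<open>Integral means, growth and weights\<close>

definition integral_mean :: "real \<Rightarrow> real \<Rightarrow> (complex \<Rightarrow> complex) \<Rightarrow> real" where
  "integral_mean p r g =
     (1 / (2 * pi) * integral {0..2 * pi} (\<lambda>\<theta>. cmod (g (of_real r * exp (\<i> * of_real \<theta>))) powr p))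
       powr (1 / p)"

text \<open>For nonnegative functions on \<open>[0,1)\<close>, the Landau symbol at \<open>1\<close> from the left is the
  familiar eventual bound near \<open>1\<close>; two-sided comparability is \<open>\<Theta>[at_left 1]\<close>.\<close>

lemma bigo_at_left_1_iff:
  fixes \<chi>1 \<chi>2 :: "real \<Rightarrow> real"
  assumes "\<And>r. 0 \<le> r \<Longrightarrow> r < 1 \<Longrightarrow> 0 \<le> \<chi>1 r" "\<And>r. 0 \<le> r \<Longrightarrow> r < 1 \<Longrightarrow> 0 \<le> \<chi>2 r"
  shows "\<chi>1 \<in> O[at_left 1](\<chi>2) \<longleftrightarrow>
           (\<exists>C>0. \<exists>r0. 0 < r0 \<and> r0 < 1 \<and> (\<forall>r. r0 < r \<and> r < 1 \<longrightarrow> \<chi>1 r \<le> C * \<chi>2 r))"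
proof
  assume "\<chi>1 \<in> O[at_left 1](\<chi>2)"
  then obtain C where C: "C > 0" "eventually (\<lambda>r. norm (\<chi>1 r) \<le> C * norm (\<chi>2 r)) (at_left 1)"
    unfolding bigo_def by blast
  then obtain b where b: "b < 1" "\<And>r. b < r \<Longrightarrow> r < 1 \<Longrightarrow> norm (\<chi>1 r) \<le> C * norm (\<chi>2 r)"
    using eventually_at_left[of 0 "1::real"] by auto
  have "\<chi>1 r \<le> C * \<chi>2 r" if "max b (1/2) < r" "r < 1" for r
    using b(2)[of r] that assms(1,2)[of r] by auto
  then show "\<exists>C>0. \<exists>r0. 0 < r0 \<and> r0 < 1 \<and> (\<forall>r. r0 < r \<and> r < 1 \<longrightarrow> \<chi>1 r \<le> C * \<chi>2 r)"
    using C(1) b(1) by (intro exI[of _ C] conjI exI[of _ "max b (1/2)"]) auto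
next
  assume "\<exists>C>0. \<exists>r0. 0 < r0 \<and> r0 < 1 \<and> (\<forall>r. r0 < r \<and> r < 1 \<longrightarrow> \<chi>1 r \<le> C * \<chi>2 r)"
  then obtain C r0 where C: "0 < r0" "r0 < 1" "\<And>r. r0 < r \<Longrightarrow> r < 1 \<Longrightarrow> \<chi>1 r \<le> C * \<chi>2 r"
    by blast
  have "norm (\<chi>1 r) \<le> C * norm (\<chi>2 r)" if "r0 < r" "r < 1" for r
    using C(3)[OF that] that C(1) assms(1,2)[of r] by auto
  then have "eventually (\<lambda>r. norm (\<chi>1 r) \<le> C * norm (\<chi>2 r)) (at_left 1)"
    using eventually_at_left[of 0 "1::real"] C(2) by auto
  then show "\<chi>1 \<in> O[at_left 1](\<chi>2)"
    by (rule bigoI)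
qed

text \<open>Weights are functions on \<open>[0,1)\<close>; their values elsewhere are irrelevant.\<close>

definition weight :: "(real \<Rightarrow> real) \<Rightarrow> bool" where
  "weight \<eta> \<longleftrightarrow>
     continuous_on {0..<1} \<eta> \<and> mono_on {0..<1} \<eta> \<and>
     (\<forall>r\<in>{0..<1}. \<eta> r > 0) \<and> (\<forall>B. \<exists>r\<in>{0..<1}. \<eta> r > B)"

definition doubling_weight :: "(real \<Rightarrow> real) \<Rightarrow> bool" where
  "doubling_weight \<eta> \<longleftrightarrow>
     weight \<eta> \<and> (\<exists>C>1. \<forall>s\<in>{0<..1}. \<eta> (1 - s / 2) < C * \<eta> (1 - s))"

definition Psi_of :: "real \<Rightarrow> (real \<Rightarrow> real) \<Rightarrow> real \<Rightarrow> real" where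
  "Psi_of p \<eta> r =
     (integral {0..r} (\<lambda>\<rho>. (1 - \<rho>\<^sup>2) powr (p - 1) * \<eta> \<rho> powr p)
        + 2 powr (p - 1) / p * \<eta> r powr p * (1 - r) powr p) powr (1 / p)"

definition Phi_of :: "(real \<Rightarrow> real) \<Rightarrow> real \<Rightarrow> real" where
  "Phi_of \<eta> r = sqrt (integral {0..r} (\<lambda>\<rho>. (1 - \<rho>) * (\<eta> \<rho>)\<^sup>2))"

end

theory Submission
  imports Defs "HOL-Complex_Analysis.Complex_Analysis"
begin

text \<open>
  A real harmonic function on the disc is the real part of a holomorphic one
  (\<open>harmonic_eq_Re_holomorphic\<close>), so a harmonic mapping is
  \<open>f = Re F + \<i> * Re G\<close> with \<open>F\<close> and \<open>G\<close>
  holomorphic, and \<open>|F'|\<close> and \<open>|G'|\<close> are the norms of the gradients of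
  \<open>u\<close> and \<open>v\<close>. For a quasiregular mapping
  \<open>|G'| \<le> K * |F'| + sqrt K0\<close>
  (\<open>quasiregular_gradient_bound\<close>). Everything is thereby reduced to a single
  holomorphic function \<open>F\<close>, whose growth has to be estimated from the means of
  \<open>F'\<close>.

  For \<open>p \<le> 1\<close> the \<open>p\<close>-th powers of means are subadditive. Between
  two radii whose distances to the unit circle have a fixed ratio, \<open>F\<close> changes by at
  most the length of the radial segment times the supremum of \<open>|F'|\<close> on it, and a
  weak mean value inequality for \<open>|F'|^p\<close> (\<open>powr_submean_value\<close>)
  estimates the mean of this supremum. If the means of \<open>F'\<close> are of order
  \<open>1 / (1 - r)\<close>, every such step costs a constant, and the number of steps is
  logarithmic (\<open>pmean_log_growth\<close>).

  For \<open>p > 1\<close> first differences are too wasteful: cancellation has to be used. Put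
  \<open>q = min p 2\<close>. The \<open>q\<close>-th power of the norm of \<open>L^p\<close>
  has a supporting functional at each point and deviates from it by at most a multiple of the
  \<open>q\<close>-th power of the increment (\<open>Lp_norm_smooth\<close>). Averaging this over
  the points \<open>w\<close> of a small circle about 1, with increment
  \<open>F (z * w) - F z\<close>, kills the linear term by the mean value property. Hence
  the function \<open>\<phi> s\<close>, the \<open>q\<close>-th power of the mean at radius
  \<open>exp s\<close>, is bounded by its averages over circles, and these exceed it at most by a
  multiple of \<open>\<delta>^q\<close> times the \<open>q\<close>-th power of the means of
  \<open>F'\<close> (\<open>pmean_two_sided\<close>). The first fact makes \<open>\<phi>\<close>
  convex (\<open>convex_on_if_log_shift_submean\<close>), the second one limits the increase of
  its slope over steps of size \<open>\<delta>\<close> (\<open>subgradient_increment\<close>).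
  Summation over a mesh that becomes geometrically finer towards the target radius
  (\<open>convex_mean_growth\<close>) gives \<open>\<phi> (ln r) \<le> D + C * integral {0..r}
  (\<lambda>\<rho>. (1 - \<rho>) powr (q - 1) * \<eta> \<rho> powr q)\<close>. For
  \<open>q = p < 2\<close> the integral is at most \<open>\<Psi>^p\<close>, and for
  \<open>q = 2\<close> it equals \<open>\<Phi>^2\<close>.

  The converse estimates follow from a Cauchy formula for \<open>F'\<close> in terms of
  \<open>Re F\<close> on circles of radius \<open>(1 - r) / 2\<close>
  (\<open>pmean_deriv_le\<close>) and the doubling condition. Sharpness for \<open>p < 1\<close>
  is shown by the holomorphic function \<open>(1 - z)^(-1/p)\<close>
  (\<open>one_minus_powr_example\<close>).
\<close>

section \<open>Averages over circles\<close>

text \<open>The unit circle is parametrised over the unit interval, so that averages over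
  circles are integrals over \<open>{0..1}\<close> without the factor
  \<open>1 / (2 * pi)\<close>.\<close>

definition circ :: "real \<Rightarrow> complex" where
  "circ t = cis (2 * pi * t)"

lemma norm_circ [simp]: "cmod (circ t) = 1"
  by (simp add: circ_def)

lemma circ_add: "circ (s + t) = circ s * circ t"
  by (simp add: circ_def cis_mult ring_distribs)

lemma circ_1 [simp]: "circ 1 = 1"
  by (simp add: circ_def)

lemma circ_nonzero [simp]: "circ t \<noteq> 0"
  by (simp add: circ_def)

lemma circ_eq_exp: "circ t = exp (2 * of_real pi * \<i> * of_real t)"
  by (simp add: circ_def cis_conv_exp mult_ac)

lemma continuous_on_circ [continuous_intros]:
  "continuous_on S f \<Longrightarrow> continuous_on S (\<lambda>x. circ (f x))"
  unfolding circ_eq_exp by (intro continuous_intros)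

lemma polar_circ: obtains a where "0 \<le> a" "a \<le> 1" "w = of_real (cmod w) * circ a"
proof -
  define a where "a = Arg2pi w / (2 * pi)"
  have "w = of_real (cmod w) * circ a"
    using Arg2pi_eq[of w] by (simp add: circ_eq_exp a_def mult_ac)
  moreover have "0 \<le> a" "a \<le> 1"
    using Arg2pi_ge_0[of w] Arg2pi_lt_2pi[of w] by (auto simp: a_def field_simps)
  ultimately show thesis using that by blast
qed

lemma integral_periodic_shift:
  fixes h :: "real \<Rightarrow> 'a::euclidean_space"
  assumes cont: "continuous_on UNIV h" and per: "\<And>t. h (t + 1) = h t" and a: "0 \<le> a" "a \<le> 1"
  shows "integral {0..1} (\<lambda>t. h (t + a)) = integral {0..1} h"
proof -
  have int: "h integrable_on {x..y}" for x y
    by (intro integrable_continuous_interval continuous_on_subset[OF cont]) auto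
  have shift: "integral {x..y} (\<lambda>t. h (t + c)) = integral {x + c..y + c} h" for x y c
    using integral_shift[of x c y h] continuous_on_subset[OF cont] by (auto simp: o_def)
  have "integral {0..1} (\<lambda>t. h (t + a)) = integral {a..1 + a} h"
    using shift[of 0 1 a] by simp
  also have "\<dots> = integral {a..1} h + integral {1..1 + a} h"
    using a by (intro Henstock_Kurzweil_Integration.integral_combine[symmetric] int) auto
  also have "integral {1..1 + a} h = integral {0..a} h"
    using shift[of 0 a 1] per by (simp add: add.commute)
  also have "integral {a..1} h + integral {0..a} h = integral {0..1} h"
    using a Henstock_Kurzweil_Integration.integral_combine[of 0 a 1 h] int by (simp add: add.commute)
  finally show ?thesis .
qed

lemma integral_swap_Icc:
  fixes h :: "real \<Rightarrow> real \<Rightarrow> 'a::banach"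
  assumes "continuous_on ({a..b} \<times> {c..d}) (\<lambda>x. h (fst x) (snd x))"
  shows "integral {a..b} (\<lambda>s. integral {c..d} (\<lambda>t. h s t)) = integral {c..d} (\<lambda>t. integral {a..b} (\<lambda>s. h s t))"
  using integral_swap_continuous[of a c b d h] assms
  by (simp add: cbox_Pair_eq case_prod_unfold)

lemma continuous_on_integral_Icc:
  fixes h :: "'b::metric_space \<Rightarrow> real \<Rightarrow> 'a::banach"
  assumes "continuous_on (S \<times> {c..d}) (\<lambda>x. h (fst x) (snd x))"
  shows "continuous_on S (\<lambda>s. integral {c..d} (h s))"
  using integral_continuous_on_param[of S c d h] assms
  by (simp add: case_prod_unfold)

lemma Cauchy_integral_circ:
  assumes hol: "f holomorphic_on ball z R" and r: "r < R" and w: "cmod (w - z) < r"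
  shows "((\<lambda>t. f (z + of_real r * circ t) * (of_real r * circ t) / (z + of_real r * circ t - w))
           has_integral f w) {0..1}"
proof -
  have "r > 0" using w norm_ge_zero[of "w - z"] by linarith
  have "f holomorphic_on cball z r"
    using r by (intro holomorphic_on_subset[OF hol]) auto
  from Cauchy_integral_circlepath_simple[OF this w]
  have int: "((\<lambda>t. f (circlepath z r t) / (circlepath z r t - w) *
      vector_derivative (circlepath z r) (at t)) has_integral 2 * of_real pi * \<i> * f w) {0..1}"
    unfolding has_contour_integral .
  have "f (circlepath z r t) / (circlepath z r t - w) * vector_derivative (circlepath z r) (at t) =
        2 * of_real pi * \<i> * (f (z + of_real r * circ t) * (of_real r * circ t) / (z + of_real r * circ t - w))"
    for t
    by (subst vector_derivative_circlepath) (auto simp: circ_eq_exp circlepath)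
  from has_integral_mult_right[OF int[unfolded this], of "1 / (2 * of_real pi * \<i>)"] show ?thesis
    by (simp add: mult.assoc)
qed

lemma mean_value_circ:
  assumes hol: "f holomorphic_on ball z R" and r: "0 \<le> r" "r < R"
  shows "((\<lambda>t. f (z + of_real r * circ t)) has_integral f z) {0..1}"
proof (cases "r = 0")
  case True
  then show ?thesis using has_integral_const_real[of "f z" 0 1] by simp
next
  case False
  then show ?thesis using Cauchy_integral_circ[OF hol, of r z] r by simp
qed

lemma continuous_on_norm_powr:
  fixes f :: "'a::topological_space \<Rightarrow> 'b::real_normed_vector"
  assumes "continuous_on S f" "p > 0"
  shows "continuous_on S (\<lambda>x. norm (f x) powr p)"
  using assms by (intro continuous_on_powr' continuous_intros) auto

text \<open>The graph of \<open>x powr p\<close> lies above its tangent lines.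
  Inequalities of this shape can be integrated term by term, and several estimates for
  means below arise in this way.\<close>

lemma powr_tangent:
  fixes x y p :: real
  assumes "p \<ge> 1" "x \<ge> 0" "y \<ge> 0"
  shows "x powr p + p * x powr (p - 1) * (y - x) \<le> y powr p"
proof (cases "x = 0 \<or> y = 0")
  case True
  have "x powr (p - 1) * x = x powr p" if "x > 0"
    using that by (simp add: powr_diff)
  moreover have "x powr p \<le> p * x powr p"
    using mult_right_mono[of 1 p "x powr p"] assms by simp
  ultimately show ?thesis using True assms by (cases "x = 0") (auto simp: mult.assoc)
next
  case False
  have "x powr (p - 1) * y \<le> (1 - 1/p) * x powr p + 1/p * y powr p"
    using Youngs_inequality_0[of "1 - 1/p" "1/p" "x powr p" "y powr p"] assms False
    by (simp add: powr_powr right_diff_distrib)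
  then have "p * (x powr (p - 1) * y) \<le> p * ((1 - 1/p) * x powr p + 1/p * y powr p)"
    using assms by (intro mult_left_mono) auto
  moreover have "x powr p = x powr (p - 1) * x" using False assms by (simp add: powr_diff)
  ultimately show ?thesis using assms by (simp add: algebra_simps)
qed

lemma integral_powr_Jensen:
  fixes h :: "real \<Rightarrow> real"
  assumes p: "p \<ge> 1" and cont: "continuous_on {0..1} h" and nn: "\<And>t. t \<in> {0..1} \<Longrightarrow> 0 \<le> h t"
  shows "integral {0..1} h powr p \<le> integral {0..1} (\<lambda>t. h t powr p)"
proof -
  define m where "m = integral {0..1} h"
  have m: "m \<ge> 0" unfolding m_def using nn by (intro Henstock_Kurzweil_Integration.integral_nonneg integrable_continuous_interval cont) auto
  have c: "continuous_on {0..1} (\<lambda>t. h t powr p)"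
    using nn p by (intro continuous_on_powr' cont continuous_intros) auto
  have "integral {0..1} (\<lambda>t. m powr p + p * m powr (p - 1) * (h t - m)) \<le> integral {0..1} (\<lambda>t. h t powr p)"
    using powr_tangent[OF p m] nn by (intro integral_le integrable_continuous_interval c continuous_intros cont) auto
  also have "integral {0..1} (\<lambda>t. m powr p + p * m powr (p - 1) * (h t - m)) = m powr p"
  proof -
    have "((\<lambda>t. m powr p + p * m powr (p - 1) * (h t - m)) has_integral (m powr p + p * m powr (p - 1) * (m - m))) {0..1}"
      using has_integral_const_real[of m 0 1] has_integral_const_real[of "m powr p" 0 1]
        integrable_integral[OF integrable_continuous_interval[OF cont]]
      by (intro has_integral_add has_integral_mult_right has_integral_diff) (auto simp: m_def)
    then show ?thesis by (simp add: integral_unique)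
  qed
  finally show ?thesis unfolding m_def .
qed

text \<open>The \<open>p\<close>-th power of the integral mean of order \<open>p\<close>
  over the circle through \<open>w\<close> about the origin. The argument is a complex
  number because such means are averaged later over points \<open>w\<close> of circles
  that are not centred at the origin.\<close>

definition pmean :: "real \<Rightarrow> (complex \<Rightarrow> complex) \<Rightarrow> complex \<Rightarrow> real" where
  "pmean p G w = integral {0..1} (\<lambda>t. cmod (G (w * circ t)) powr p)"

lemma continuous_on_disc_compose:
  assumes "continuous_on (ball 0 1) G" "continuous_on S h" "\<And>x. x \<in> S \<Longrightarrow> cmod (h x) < 1"
  shows "continuous_on S (\<lambda>x. G (h x))"
  using assms by (intro continuous_on_compose2[OF assms(1)]) auto

lemma pmean_integrand_continuous:
  assumes "continuous_on (ball 0 1) G" "p > 0" "cmod w < 1"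
  shows "continuous_on S (\<lambda>t. cmod (G (w * circ t)) powr p)"
  using assms by (intro continuous_on_norm_powr continuous_on_disc_compose[OF assms(1)] continuous_intros)
    (auto simp: norm_mult)

lemma pmean_nonneg: "pmean p G w \<ge> 0"
  unfolding pmean_def
  by (cases "(\<lambda>t. cmod (G (w * circ t)) powr p) integrable_on {0..1}")
     (auto intro!: Henstock_Kurzweil_Integration.integral_nonneg simp: not_integrable_integral)

lemma pmean_norm:
  assumes "continuous_on (ball 0 1) G" "p > 0" "cmod w < 1"
  shows "pmean p G w = pmean p G (of_real (cmod w))"
proof -
  obtain a where a: "0 \<le> a" "a \<le> 1" "w = of_real (cmod w) * circ a" by (rule polar_circ)
  let ?h = "\<lambda>t. cmod (G (of_real (cmod w) * circ t)) powr p"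
  have "integral {0..1} (\<lambda>t. ?h (t + a)) = integral {0..1} ?h"
    using a by (intro integral_periodic_shift pmean_integrand_continuous assms) (auto simp: circ_add assms)
  moreover have "?h (t + a) = cmod (G (w * circ t)) powr p" for t
    by (subst (2) a(3)) (simp add: circ_add mult_ac)
  ultimately show ?thesis unfolding pmean_def by simp
qed

lemma continuous_on_pmean:
  assumes "continuous_on (ball 0 1) G" "p > 0" "continuous_on S h" "\<And>x. x \<in> S \<Longrightarrow> cmod (h x) < 1"
  shows "continuous_on (S::'a::metric_space set) (\<lambda>x. pmean p G (h x))"
  unfolding pmean_def
proof (rule continuous_on_integral_Icc)
  show "continuous_on (S \<times> {0..1}) (\<lambda>x. cmod (G (h (fst x) * circ (snd x))) powr p)"
    using assms by (intro continuous_on_norm_powr continuous_on_disc_compose[OF assms(1)] continuous_intros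
        continuous_on_compose2[OF assms(3)]) (auto simp: norm_mult)
qed

text \<open>This is how estimates at the single points of a circle become estimates for
  means: if a value at \<open>circ \<theta>\<close> is controlled by an integral of
  \<open>|G|^p\<close> along the rotated curve \<open>h x * circ \<theta>\<close>,
  then averaging over \<open>\<theta>\<close> and exchanging the integrals leaves only
  means of \<open>G\<close> along \<open>h\<close>.\<close>

lemma integral_pmean_swap:
  fixes h :: "real \<Rightarrow> complex"
  assumes "continuous_on (ball 0 1) G" "p > 0" "continuous_on {a..b} h" "\<And>x. x \<in> {a..b} \<Longrightarrow> cmod (h x) < 1"
  shows "integral {0..1} (\<lambda>\<theta>. integral {a..b} (\<lambda>x. cmod (G (h x * circ \<theta>)) powr p)) =
         integral {a..b} (\<lambda>x. pmean p G (h x))"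
  unfolding pmean_def
proof (rule integral_swap_Icc[where h = "\<lambda>\<theta> x. cmod (G (h x * circ \<theta>)) powr p"])
  show "continuous_on ({0..1} \<times> {a..b}) (\<lambda>x. cmod (G (h (snd x) * circ (fst x))) powr p)"
    using assms by (intro continuous_on_norm_powr continuous_on_disc_compose[OF assms(1)] continuous_intros
        continuous_on_compose2[OF assms(3)]) (auto simp: norm_mult)
qed

lemma integral_mean_eq_pmean:
  "integral_mean p r g = pmean p g (of_real r) powr (1 / p)"
proof -
  have "integral {0..1} (\<lambda>t. cmod (g (of_real r * circ t)) powr p) =
        1 / (2 * pi) * integral {0..2 * pi} (\<lambda>\<theta>. cmod (g (of_real r * exp (\<i> * of_real \<theta>))) powr p)"
    (is "integral {0..1} ?a = _ * integral _ ?b")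
  proof -
    have "(\<lambda>t. t / (2 * pi)) ` {0..2 * pi} = {0..1}"
      using image_divide_atLeastAtMost[of "2*pi" 0 "2*pi"] by simp
    have "integral {0..1} (\<lambda>t. ?b (2 * pi * t)) = 1 / (2 * pi) * integral {0..2 * pi} ?b"
    proof (cases "?b integrable_on {0..2 * pi}")
      case True
      then show ?thesis
        using has_integral_affinity[of ?b "integral {0..2*pi} ?b" 0 "2*pi" "2*pi" 0]
        by (auto simp: has_integral_integral intro!: integral_unique)
    next
      case False
      have "\<not> (\<lambda>t. ?b (2 * pi * t)) integrable_on {0..1}"
      proof
        assume "(\<lambda>t. ?b (2 * pi * t)) integrable_on {0..1}"
        then have "((\<lambda>t. ?b (2 * pi * t)) has_integral integral {0..1} (\<lambda>t. ?b (2 * pi * t))) (cbox 0 1)"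
          by (simp add: has_integral_integral)
        from has_integral_affinity[OF this, of "1 / (2 * pi)" 0] False
        show False by (auto simp: integrable_on_def)
      qed
      then show ?thesis using False by (simp add: not_integrable_integral)
    qed
    then show ?thesis by (simp add: circ_eq_exp mult_ac)
  qed
  then show ?thesis unfolding integral_mean_def pmean_def by simp
qed

section \<open>Means of order at most one\<close>

lemma powr_le_split:
  fixes x y p :: real
  assumes "0 \<le> x" "x \<le> y" "0 < p" "p \<le> 1"
  shows "x \<le> y powr (1 - p) * x powr p"
proof (cases "x = 0")
  case False
  then have "x = x powr (1 - p) * x powr p"
    using assms by (simp flip: powr_add)
  also have "\<dots> \<le> y powr (1 - p) * x powr p"
    using assms by (intro mult_right_mono powr_mono2) auto
  finally show ?thesis .
qed (use assms in auto)

lemma powr_add_subadditive: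
  fixes x y p :: real
  assumes "0 \<le> x" "0 \<le> y" "0 < p" "p \<le> 1"
  shows "(x + y) powr p \<le> x powr p + y powr p"
proof (cases "x + y = 0")
  case False
  define S where "S = (x + y) powr (1 - p)"
  have "x \<le> S * x powr p" "y \<le> S * y powr p"
    unfolding S_def using assms by (intro powr_le_split; simp)+
  moreover have "x + y = S * (x + y) powr p"
    using False assms by (simp add: S_def flip: powr_add)
  ultimately have "S * (x + y) powr p \<le> S * (x powr p + y powr p)"
    by (simp add: distrib_left)
  moreover have "S > 0" using False assms by (auto simp: S_def)
  ultimately show ?thesis by simp
qed (use assms in auto)

lemma Cauchy_circ_bound:
  assumes hol: "f holomorphic_on ball z R" and r: "r < R" and w: "cmod (w - z) < r"
  shows "cmod (f w) \<le> r / (r - cmod (w - z)) * integral {0..1} (\<lambda>t. cmod (f (z + of_real r * circ t)))"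
proof -
  have r0: "r > 0" using w norm_ge_zero[of "w - z"] by linarith
  have cont: "continuous_on {0..1} (\<lambda>t. f (z + of_real r * circ t))"
    using r r0 by (intro continuous_on_compose2[OF holomorphic_on_imp_continuous_on[OF hol]] continuous_intros)
      (auto simp: dist_norm norm_mult)
  have "cmod (integral {0..1} (\<lambda>t. f (z + of_real r * circ t) * (of_real r * circ t) / (z + of_real r * circ t - w)))
        \<le> integral {0..1} (\<lambda>t. r / (r - cmod (w - z)) * cmod (f (z + of_real r * circ t)))"
  proof (rule integral_norm_bound_integral)
    show "(\<lambda>t. f (z + of_real r * circ t) * (of_real r * circ t) / (z + of_real r * circ t - w)) integrable_on {0..1}"
      using Cauchy_integral_circ[OF assms] by blast
    show "(\<lambda>t. r / (r - cmod (w - z)) * cmod (f (z + of_real r * circ t))) integrable_on {0..1}"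
      by (intro integrable_continuous_interval continuous_intros cont)
    fix t :: real
    have "r - cmod (w - z) \<le> cmod (z + of_real r * circ t - w)"
      using norm_triangle_ineq2[of "of_real r * circ t" "w - z"] r0 by (simp add: norm_mult algebra_simps)
    then have "r / cmod (z + of_real r * circ t - w) \<le> r / (r - cmod (w - z))"
      using w r0 by (intro divide_left_mono mult_pos_pos) auto
    from mult_right_mono[OF this norm_ge_zero[of "f (z + of_real r * circ t)"]]
    show "cmod (f (z + of_real r * circ t) * (of_real r * circ t) / (z + of_real r * circ t - w))
        \<le> r / (r - cmod (w - z)) * cmod (f (z + of_real r * circ t))"
      using r0 by (simp add: norm_mult norm_divide mult.commute)
  qed
  also have "integral {0..1} (\<lambda>t. f (z + of_real r * circ t) * (of_real r * circ t) / (z + of_real r * circ t - w)) = f w"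
    by (rule integral_unique[OF Cauchy_integral_circ[OF assms]])
  finally show ?thesis by simp
qed

text \<open>For \<open>p = 1\<close> this is a consequence of Cauchy's formula. For
  smaller \<open>p\<close> it follows, with a worse constant, from an extremal point:
  choose \<open>z0\<close> where \<open>(R - |z - c|)^(2/p) * |G z|\<close> is
  largest. On circles about \<open>c\<close> that are slightly larger than the one through
  \<open>z0\<close>, maximality bounds \<open>|G|\<close> by a multiple of
  \<open>|G z0|\<close>, so there \<open>|G| = |G|^(1-p) * |G|^p\<close> is at most a
  multiple of \<open>|G z0|^(1-p) * |G|^p\<close>. Inserting this into Cauchy's
  estimate at \<open>z0\<close> and dividing by \<open>|G z0|^(1-p)\<close> gives the
  claim at \<open>z0\<close>, and the choice of \<open>z0\<close> transports it to all
  points of the smaller disc. Working with concentric circles only avoids integration over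
  plane sets.\<close>

lemma powr_submean_value:
  fixes p R S :: real
  assumes p: "0 < p" "p \<le> 1" and R: "0 < R" "R < S"
    and hol: "G holomorphic_on ball c S" and z: "cmod (z - c) \<le> R / 2"
  shows "cmod (G z) powr p \<le> 64 * 2 powr (2 / p * (1 - p)) / R *
    integral {0..R} (\<lambda>s. integral {0..1} (\<lambda>t. cmod (G (c + of_real s * circ t)) powr p))"
proof -
  define I where "I s = integral {0..1} (\<lambda>t. cmod (G (c + of_real s * circ t)) powr p)" for s :: real
  define k where "k = 2 powr (2 / p * (1 - p))"
  note contG = holomorphic_on_imp_continuous_on[OF hol]
  have contI: "continuous_on {0..R} I"
    unfolding I_def
  proof (rule continuous_on_integral_Icc)
    show "continuous_on ({0..R} \<times> {0..1}) (\<lambda>x. cmod (G (c + of_real (fst x) * circ (snd x))) powr p)"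
      using p R by (intro continuous_on_norm_powr continuous_on_compose2[OF contG] continuous_intros)
        (auto simp: dist_norm norm_mult)
  qed
  have Iint: "I integrable_on {a..b}" if "0 \<le> a" "b \<le> R" for a b
    using that by (intro integrable_continuous_interval continuous_on_subset[OF contI]) auto
  have contc: "continuous_on {0..1} (\<lambda>t. G (c + of_real s * circ t))" if "0 \<le> s" "s \<le> R" for s
    using R that by (intro continuous_on_compose2[OF contG] continuous_intros) (auto simp: dist_norm norm_mult)
  have I0: "0 \<le> I s" if "0 \<le> s" "s \<le> R" for s
    unfolding I_def using that p
    by (intro Henstock_Kurzweil_Integration.integral_nonneg integrable_continuous_interval continuous_on_norm_powr contc) auto
  have II0: "0 \<le> integral {0..R} I"
    using I0 by (intro Henstock_Kurzweil_Integration.integral_nonneg Iint) auto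
  \<comment> \<open>The exponent \<open>2 / p\<close> makes the powers of
    \<open>d\<close> below cancel after integration over an interval of length
    \<open>d / 4\<close>.\<close>
  define m where "m w = (R - cmod (w - c)) powr (2 / p) * cmod (G w)" for w
  have "continuous_on (cball c R) m"
    unfolding m_def using p R
    by (intro continuous_intros continuous_on_powr' continuous_on_subset[OF contG]) (auto simp: dist_norm norm_minus_commute)
  from continuous_attains_sup[OF compact_cball _ this] R
  obtain z0 where z0: "z0 \<in> cball c R" and max: "\<And>w. w \<in> cball c R \<Longrightarrow> m w \<le> m z0" by fastforce
  define d where "d = R - cmod (z0 - c)"
  define g where "g = cmod (G z0)"
  have d0: "d \<ge> 0" using z0 by (auto simp: d_def dist_norm norm_minus_commute)
  have m_powr: "m w powr p = (R - cmod (w - c))\<^sup>2 * cmod (G w) powr p" if "cmod (w - c) < R" for w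
    using that p by (simp add: m_def powr_mult powr_powr flip: powr_numeral)
  have key: "m z0 powr p \<le> 16 * R * k * integral {0..R} I"
  proof (cases "d = 0 \<or> g = 0")
    case True
    then have "m z0 = 0" by (auto simp: m_def d_def g_def)
    then show ?thesis using R II0 p by (simp add: k_def)
  next
    case False
    then have dg: "d > 0" "g > 0" using d0 by (auto simp: g_def)
    have dR: "d \<le> R" and cn: "cmod (z0 - c) = R - d" by (simp_all add: d_def)
    \<comment> \<open>These radii keep distance at least \<open>d / 4\<close> from
      \<open>z0\<close> and at least \<open>d / 2\<close> from the outer circle.\<close>
    have bound: "g powr p \<le> 4 * R / d * k * I s" if s: "s \<in> {R - 3 * d / 4..R - d / 2}" for s
    proof -
      have sR: "0 < s" "s < R" "cmod (z0 - c) < s" "s - cmod (z0 - c) \<ge> d / 4" "R - s \<ge> d / 2"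
        using s dg dR R cn unfolding atLeastAtMost_iff by linarith+
      have circle: "cmod (G (c + of_real s * circ t)) \<le> 2 powr (2 / p) * g" for t
      proof -
        have "m (c + of_real s * circ t) \<le> m z0"
          using sR by (intro max) (auto simp: dist_norm norm_mult)
        then have "(R - s) powr (2 / p) * cmod (G (c + of_real s * circ t)) \<le> d powr (2 / p) * g"
          using sR by (simp add: m_def d_def g_def norm_mult)
        moreover have "(d / 2) powr (2 / p) * cmod (G (c + of_real s * circ t)) \<le>
            (R - s) powr (2 / p) * cmod (G (c + of_real s * circ t))"
          using sR dg p by (intro mult_right_mono powr_mono2) auto
        ultimately have "(d / 2) powr (2 / p) * cmod (G (c + of_real s * circ t)) \<le> (d / 2) powr (2 / p) * (2 powr (2 / p) * g)"
          using dg by (simp add: powr_divide)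
        then show ?thesis using dg by simp
      qed
      have "g \<le> s / (s - cmod (z0 - c)) * integral {0..1} (\<lambda>t. cmod (G (c + of_real s * circ t)))"
        unfolding g_def using sR R by (intro Cauchy_circ_bound[OF hol]) auto
      also have "\<dots> \<le> (4 * R / d) * integral {0..1} (\<lambda>t. cmod (G (c + of_real s * circ t)))"
      proof (intro mult_right_mono)
        have "s / (s - cmod (z0 - c)) \<le> R / (d / 4)"
          using sR dg by (intro frac_le) auto
        then show "s / (s - cmod (z0 - c)) \<le> 4 * R / d" by (simp add: mult.commute)
        show "0 \<le> integral {0..1} (\<lambda>t. cmod (G (c + of_real s * circ t)))"
          using sR by (intro Henstock_Kurzweil_Integration.integral_nonneg integrable_continuous_interval continuous_intros contc) auto
      qed
      also have "integral {0..1} (\<lambda>t. cmod (G (c + of_real s * circ t))) \<le>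
          integral {0..1} (\<lambda>t. (2 powr (2 / p) * g) powr (1 - p) * cmod (G (c + of_real s * circ t)) powr p)"
        using sR p circle
        by (intro integral_le integrable_continuous_interval continuous_intros contc continuous_on_norm_powr powr_le_split) auto
      also have "\<dots> = k * g powr (1 - p) * I s"
        using dg by (simp add: I_def k_def powr_mult powr_powr)
      finally have "g \<le> 4 * R / d * (k * g powr (1 - p) * I s)"
        using R dg by (simp add: mult_left_mono divide_right_mono)
      moreover have "g = g powr (1 - p) * g powr p" using dg by (simp flip: powr_add)
      ultimately have "g powr (1 - p) * g powr p \<le> g powr (1 - p) * (4 * R / d * k * I s)"
        by (simp add: mult_ac)
      then show ?thesis
        by (rule mult_left_le_imp_le) (use dg in simp)
    qed
    have "d / 4 * g powr p = integral {R - 3 * d / 4..R - d / 2} (\<lambda>s. g powr p)"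
      using dg by (simp add: field_simps)
    also have "\<dots> \<le> integral {R - 3 * d / 4..R - d / 2} (\<lambda>s. 4 * R / d * k * I s)"
      using dg dR bound by (intro integral_le integrable_on_mult_right Iint) auto
    also have "\<dots> = 4 * R / d * k * integral {R - 3 * d / 4..R - d / 2} I" by simp
    also have "\<dots> \<le> 4 * R / d * k * integral {0..R} I"
      using dg dR R I0 by (intro mult_left_mono integral_subset_le Iint) (auto simp: k_def)
    finally have "d\<^sup>2 * g powr p \<le> 16 * R * k * integral {0..R} I"
      using dg by (simp add: field_simps power2_eq_square)
    then show ?thesis using m_powr[of z0] dg by (simp add: d_def g_def)
  qed
  have zR: "cmod (z - c) < R" using z R by simp
  have "(R / 2)\<^sup>2 * cmod (G z) powr p \<le> (R - cmod (z - c))\<^sup>2 * cmod (G z) powr p"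
    using z R by (intro mult_right_mono power_mono) auto
  also have "\<dots> = m z powr p" using m_powr[OF zR] by simp
  also have "\<dots> \<le> m z0 powr p"
    using zR p by (intro powr_mono2 max) (auto simp: m_def dist_norm norm_minus_commute)
  also note key
  finally show ?thesis using R unfolding I_def k_def by (simp add: field_simps power2_eq_square)
qed

text \<open>Every disc that touches the unit circle from inside at 1 stays in the unit
  disc under rotation; local estimates at a point of modulus \<open>r\<close> may
  therefore be made at \<open>r\<close> itself.\<close>

lemma holomorphic_on_rotate:
  assumes "F holomorphic_on ball 0 1" "0 \<le> r"
  shows "(\<lambda>w. F (w * circ \<theta>)) holomorphic_on ball (of_real r) (1 - r)"
proof (rule holomorphic_on_compose_gen[OF _ assms(1), unfolded o_def])
  show "(\<lambda>w. w * circ \<theta>) ` ball (of_real r) (1 - r) \<subseteq> ball 0 1"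
  proof (clarsimp simp: norm_mult dist_norm)
    fix w assume "cmod (of_real r - w) < 1 - r"
    then show "cmod w < 1" using norm_triangle_ineq2[of w "of_real r"] assms(2) by (simp add: norm_minus_commute)
  qed
qed (intro holomorphic_intros)

text \<open>If \<open>1 - r\<close> and \<open>1 - s\<close> are comparable, the
  increment of \<open>F\<close> along a radius from modulus \<open>s\<close> to modulus
  \<open>r\<close> is at most its length times the supremum of \<open>|F'|\<close>. The
  local estimate \<open>powr_submean_value\<close> bounds the \<open>p\<close>-th power of
  this supremum by an average, hence the mean of the increment by means of
  \<open>F'\<close>. The length contributes a power of \<open>1 - s\<close> that is
  exactly cancelled by the growth of these means.\<close>

lemma pmean_increment_le:
  fixes p N r s :: real
  assumes p: "0 < p" "p \<le> 1" and hol: "F holomorphic_on ball 0 1"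
    and bound: "\<And>w. cmod w < 1 \<Longrightarrow> pmean p (deriv F) w \<le> (N / (1 - cmod w)) powr p"
    and N: "N \<ge> 0" and rs: "0 \<le> s" "s \<le> r" "r < 1" "3 / 4 * (1 - s) \<le> 1 - r"
  shows "pmean p F (of_real r) \<le> pmean p F (of_real s) + 64 * 2 powr (2 / p * (1 - p)) * N powr p"
proof -
  \<comment> \<open>The segment from \<open>s\<close> to \<open>r\<close> lies in the disc
    of radius \<open>R / 2\<close> about \<open>s\<close>, and the disc of radius
    \<open>R\<close> keeps distance \<open>R\<close> from the unit circle.\<close>
  define R where "R = (1 - s) / 2"
  define k where "k = 64 * 2 powr (2 / p * (1 - p))"
  have R: "0 < R" "R < 1 - s" "s + R < 1" "r - s \<le> R / 2" "1 - (s + R) = R" using rs by (auto simp: R_def field_simps)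
  define h where "h s' t = of_real s + of_real s' * circ t" for s' t
  have h1: "cmod (h s' t) \<le> s + R" if "s' \<in> {0..R}" for s' t
    unfolding h_def using norm_triangle_ineq[of "of_real s" "of_real s' * circ t"] that rs by (simp add: norm_mult)
  have h1': "cmod (h s' t) < 1" if "s' \<in> {0..R}" for s' t
    using h1[OF that, of t] R by simp
  have conth: "continuous_on A (\<lambda>x. h (a x) (b x))" if "continuous_on A a" "continuous_on A b" for A a b
    unfolding h_def by (intro continuous_intros that)
  define J where "J \<theta> s' = integral {0..1} (\<lambda>t. cmod (deriv F (h s' t * circ \<theta>)) powr p)" for \<theta> s'
  have hol': "deriv F holomorphic_on ball 0 1" by (intro holomorphic_deriv hol) auto
  note contF = holomorphic_on_imp_continuous_on[OF hol]
  note contF' = holomorphic_on_imp_continuous_on[OF hol']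
  have contJ: "continuous_on ({0..1} \<times> {0..R}) (\<lambda>x. J (fst x) (snd x))"
    unfolding J_def
  proof (rule continuous_on_integral_Icc)
    show "continuous_on (({0..1} \<times> {0..R}) \<times> {0..1})
      (\<lambda>x. cmod (deriv F (h (snd (fst x)) (snd x) * circ (fst (fst x)))) powr p)"
      using p h1' by (intro continuous_on_norm_powr continuous_on_disc_compose[OF contF'] continuous_intros conth)
        (auto simp: norm_mult)
  qed
  define Q where "Q \<theta> = integral {0..R} (J \<theta>)" for \<theta>
  have contQ: "continuous_on {0..1} Q"
    unfolding Q_def by (rule continuous_on_integral_Icc[OF contJ])
  have diff: "cmod (F (of_real r * circ \<theta>) - F (of_real s * circ \<theta>)) powr p \<le> (R / 2) powr p * (k / R * Q \<theta>)" for \<theta>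
  proof -
    define G where "G w = deriv F (w * circ \<theta>)" for w
    have holG: "G holomorphic_on ball (of_real s) (1 - s)"
      unfolding G_def using rs by (intro holomorphic_on_rotate hol')
    define B where "B = (k / R * Q \<theta>) powr (1 / p)"
    have "cmod (G (of_real \<rho>)) \<le> B" if \<rho>: "s \<le> \<rho>" "\<rho> \<le> r" for \<rho>
    proof -
      have "cmod (G (of_real \<rho>)) powr p \<le> k / R * Q \<theta>"
        using powr_submean_value[OF p, of R "1 - s" G "of_real s" "of_real \<rho>"] R holG \<rho>
        by (simp add: k_def Q_def[abs_def] J_def[abs_def] G_def h_def flip: of_real_diff)
      then have "(cmod (G (of_real \<rho>)) powr p) powr (1 / p) \<le> B"
        unfolding B_def using p by (intro powr_mono2) auto
      then show ?thesis using p by (simp add: powr_powr)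
    qed
    then have GB: "cmod (deriv F (of_real \<rho> * circ \<theta>)) \<le> B" if "\<rho> \<in> {s..r}" for \<rho>
      using that by (simp add: G_def)
    have "norm (F (of_real r * circ \<theta>) - F (of_real s * circ \<theta>)) \<le> B * norm (r - s)"
    proof (rule differentiable_bound[of "{s..r}" "\<lambda>\<rho>. F (of_real \<rho> * circ \<theta>)" "\<lambda>\<rho> h. of_real h * circ \<theta> * deriv F (of_real \<rho> * circ \<theta>)"])
      fix \<rho> assume \<rho>: "\<rho> \<in> {s..r}"
      have "(F has_field_derivative deriv F (of_real \<rho> * circ \<theta>)) (at (of_real \<rho> * circ \<theta>))"
        using \<rho> rs by (intro holomorphic_derivI[OF hol]) (auto simp: norm_mult)
      then have "((\<lambda>\<rho>. F (of_real \<rho> * circ \<theta>)) has_derivative (\<lambda>h. deriv F (of_real \<rho> * circ \<theta>) * (of_real h * circ \<theta>))) (at \<rho> within {s..r})"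
        unfolding has_field_derivative_def
        by (intro has_derivative_compose[where g = F and f = "\<lambda>\<rho>. of_real \<rho> * circ \<theta>"]) (auto intro!: derivative_eq_intros)
      then show "((\<lambda>\<rho>. F (of_real \<rho> * circ \<theta>)) has_derivative (\<lambda>h. of_real h * circ \<theta> * deriv F (of_real \<rho> * circ \<theta>))) (at \<rho> within {s..r})"
        by (simp add: mult_ac)
      show "onorm (\<lambda>h. of_real h * circ \<theta> * deriv F (of_real \<rho> * circ \<theta>)) \<le> B"
        using GB[OF \<rho>] by (intro onorm_le) (simp add: norm_mult mult.commute[of B] mult_left_mono)
    qed (use rs in auto)
    also have "\<dots> \<le> B * (R / 2)"
      using R rs by (intro mult_left_mono) (auto simp: B_def)
    finally have "norm (F (of_real r * circ \<theta>) - F (of_real s * circ \<theta>)) powr p \<le> (B * (R / 2)) powr p"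
      using p by (intro powr_mono2) auto
    also have "\<dots> = (R / 2) powr p * (k / R * Q \<theta>)"
    proof -
      have "J \<theta> s' \<ge> 0" if "s' \<in> {0..R}" for s'
        unfolding J_def using p h1'[OF that]
        by (intro Henstock_Kurzweil_Integration.integral_nonneg integrable_continuous_interval
          continuous_on_norm_powr continuous_on_disc_compose[OF contF'] continuous_intros conth) (auto simp: norm_mult)
      moreover have "continuous_on {0..R} (J \<theta>)"
        unfolding J_def
      proof (rule continuous_on_integral_Icc)
        show "continuous_on ({0..R} \<times> {0..1}) (\<lambda>x. cmod (deriv F (h (fst x) (snd x) * circ \<theta>)) powr p)"
          using p h1' by (intro continuous_on_norm_powr continuous_on_disc_compose[OF contF'] continuous_intros conth)
            (auto simp: norm_mult)
      qed
      ultimately have "Q \<theta> \<ge> 0" unfolding Q_def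
        by (intro Henstock_Kurzweil_Integration.integral_nonneg integrable_continuous_interval) auto
      then have "0 \<le> k / R * Q \<theta>" using R by (simp add: k_def)
      moreover have "1 / p * p = 1" using p by simp
      ultimately have "B powr p = k / R * Q \<theta>"
        using powr_one unfolding B_def powr_powr by presburger
      moreover have "(B * (R / 2)) powr p = B powr p * (R / 2) powr p"
        by (rule powr_mult)
      ultimately show ?thesis by (simp add: mult.commute)
    qed
    finally show ?thesis .
  qed
  have contr: "continuous_on {0..1} (\<lambda>\<theta>. cmod (F (of_real x * circ \<theta>)) powr p)" if "0 \<le> x" "x < 1" for x
    using that p by (intro pmean_integrand_continuous contF) auto
  have "integral {0..1} Q = integral {0..R} (\<lambda>s'. integral {0..1} (\<lambda>\<theta>. J \<theta> s'))"
    unfolding Q_def by (rule integral_swap_Icc[OF contJ])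
  also have "\<dots> \<le> integral {0..R} (\<lambda>s'::real. (N / R) powr p)"
  proof (intro integral_le integrable_continuous_interval)
    show "continuous_on {0..R} (\<lambda>s'. integral {0..1} (\<lambda>\<theta>. J \<theta> s'))"
    proof (rule continuous_on_integral_Icc)
      show "continuous_on ({0..R} \<times> {0..1}) (\<lambda>x. J (snd x) (fst x))"
        using continuous_on_compose2[OF contJ continuous_on_swap, of "{0..R} \<times> {0..1}"] by (simp add: product_swap)
    qed
    fix s' assume s': "s' \<in> {0..R}"
    have "integral {0..1} (\<lambda>\<theta>. J \<theta> s') = integral {0..1} (\<lambda>t. pmean p (deriv F) (h s' t))"
      unfolding J_def using h1'[OF s'] p by (intro integral_pmean_swap contF' conth continuous_intros) auto
    also have "\<dots> \<le> integral {0..1} (\<lambda>t::real. (N / R) powr p)"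
    proof (rule integral_le)
      show "(\<lambda>t. pmean p (deriv F) (h s' t)) integrable_on {0..1}"
        using h1'[OF s'] p
        by (intro integrable_continuous_interval continuous_on_pmean[OF contF'] conth continuous_intros) auto
      fix t :: real
      have "pmean p (deriv F) (h s' t) \<le> (N / (1 - cmod (h s' t))) powr p"
        using h1'[OF s'] by (rule bound)
      also have "\<dots> \<le> (N / R) powr p"
        using h1[OF s', of t] h1'[OF s', of t] N R p
        by (intro powr_mono2 divide_left_mono) auto
      finally show "pmean p (deriv F) (h s' t) \<le> (N / R) powr p" .
    qed auto
    finally show "integral {0..1} (\<lambda>\<theta>. J \<theta> s') \<le> (N / R) powr p" by simp
  qed auto
  finally have intQ: "integral {0..1} Q \<le> R * (N / R) powr p" using R by simp
  have "pmean p F (of_real r) \<le> integral {0..1} (\<lambda>\<theta>. cmod (F (of_real s * circ \<theta>)) powr p + (R / 2) powr p * (k / R * Q \<theta>))"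
    unfolding pmean_def
  proof (intro integral_le integrable_continuous_interval continuous_on_add continuous_on_mult continuous_on_const contr contQ)
    fix \<theta>
    have "cmod (F (of_real r * circ \<theta>)) powr p \<le>
      (cmod (F (of_real s * circ \<theta>)) + cmod (F (of_real r * circ \<theta>) - F (of_real s * circ \<theta>))) powr p"
      using p norm_triangle_sub[of "F (of_real r * circ \<theta>)"] by (intro powr_mono2) auto
    also have "\<dots> \<le> cmod (F (of_real s * circ \<theta>)) powr p + cmod (F (of_real r * circ \<theta>) - F (of_real s * circ \<theta>)) powr p"
      using p by (intro powr_add_subadditive) auto
    finally show "cmod (F (of_real r * circ \<theta>)) powr p \<le> cmod (F (of_real s * circ \<theta>)) powr p + (R / 2) powr p * (k / R * Q \<theta>)"
      using diff[of \<theta>] by linarith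
  qed (use p rs in auto)
  also have "\<dots> = pmean p F (of_real s) + (R / 2) powr p * (k / R * integral {0..1} Q)"
    unfolding pmean_def using p rs R
    by (subst Henstock_Kurzweil_Integration.integral_add)
      (auto intro!: integrable_continuous_interval continuous_on_divide continuous_on_mult continuous_on_const contr contQ)
  also have "(R / 2) powr p * (k / R * integral {0..1} Q) \<le> (R / 2) powr p * (k / R * (R * (N / R) powr p))"
    using R intQ by (intro mult_left_mono) (auto simp: k_def)
  also have "\<dots> = k * (N / 2) powr p"
    using R N by (simp add: powr_divide field_simps)
  also have "\<dots> \<le> k * N powr p"
    using N p by (intro mult_left_mono powr_mono2) (auto simp: k_def)
  finally show ?thesis by (simp add: k_def)
qed

text \<open>Each time the distance to the unit circle shrinks by the factor 3/4, the mean
  grows by at most a constant; the radius \<open>r\<close> is reached after about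
  \<open>ln (1 / (1 - r))\<close> such steps.\<close>

lemma pmean_log_growth:
  fixes p N :: real
  assumes p: "0 < p" "p \<le> 1" and hol: "F holomorphic_on ball 0 1"
    and bound: "\<And>w. cmod w < 1 \<Longrightarrow> pmean p (deriv F) w \<le> (N / (1 - cmod w)) powr p"
    and N: "N \<ge> 0"
  shows "\<exists>C. \<forall>r\<in>{1/2..<1}. pmean p F (of_real r) \<le> C * ln (1 / (1 - r))"
proof -
  define c where "c = 64 * 2 powr (2 / p * (1 - p)) * N powr p"
  have c0: "c \<ge> 0" using N by (simp add: c_def)
  have step: "pmean p F (of_real r) \<le> pmean p F 0 + n * c"
    if "0 \<le> r" "r < 1" "(3/4) ^ n \<le> 1 - r" for n and r :: real
    using that
  proof (induction n arbitrary: r)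
    case 0
    then show ?case by simp
  next
    case (Suc n)
    \<comment> \<open>The maximum takes care of radii for which the step backwards would
      pass the origin.\<close>
    define s where "s = max 0 (1 - 4 / 3 * (1 - r))"
    have s: "0 \<le> s" "s \<le> r" "s < 1" "3 / 4 * (1 - s) \<le> 1 - r" "(3/4) ^ n \<le> 1 - s"
      using Suc.prems power_le_one[of "3/4::real" n] by (auto simp: s_def max_def field_simps)
    have "pmean p F (of_real r) \<le> pmean p F (of_real s) + c"
      unfolding c_def using s Suc.prems by (intro pmean_increment_le p hol bound N)
    also have "pmean p F (of_real s) \<le> pmean p F 0 + n * c"
      using s by (intro Suc.IH) auto
    finally show ?case by (simp add: algebra_simps)
  qed
  define l where "l = ln (4/3 :: real)"
  have l: "l > 0" by (simp add: l_def)
  show ?thesis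
  proof (intro exI ballI)
    fix r :: real assume r: "r \<in> {1/2..<1}"
    define x where "x = ln (1 / (1 - r))"
    define n where "n = nat \<lceil>x / l\<rceil>"
    have x: "x \<ge> ln 2" unfolding x_def using r by (subst ln_le_cancel_iff) (auto simp: field_simps)
    then have x0: "x > 0" using ln_gt_zero[of 2] by linarith
    have n: "x / l \<le> n" "n \<le> x / l + 1"
      unfolding n_def using x0 l by (auto simp: of_nat_nat intro: order_trans[OF _ le_of_int_ceiling])
    have "exp (-(n * l)) \<le> exp (- x)" using n l by (simp add: field_simps)
    also have "exp (-(n * l)) = (3/4) ^ n"
      by (simp add: l_def exp_minus exp_of_nat_mult power_divide field_simps)
    also have "exp (- x) = 1 - r" using r by (simp add: x_def ln_div)
    finally have "pmean p F (of_real r) \<le> pmean p F 0 + n * c"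
      using r by (intro step) auto
    also have "\<dots> \<le> pmean p F 0 + (x / l + 1) * c"
      using n c0 by (intro add_left_mono mult_right_mono) auto
    also have "\<dots> = c / l * x + (pmean p F 0 + c) * 1" by (simp add: algebra_simps)
    also have "\<dots> \<le> c / l * x + (pmean p F 0 + c) * (x / ln 2)"
      using x c0 pmean_nonneg[of p F 0] by (intro add_left_mono mult_left_mono) auto
    finally show "pmean p F (of_real r) \<le> (c / l + (pmean p F 0 + c) / ln 2) * ln (1 / (1 - r))"
      by (simp add: x_def algebra_simps add_divide_distrib)
  qed
qed

section \<open>Uniform smoothness of the norm of L^p\<close>

text \<open>Hoelder's inequality, obtained by integrating Young's inequality for the
  normalised functions.\<close>

lemma integral_Hoelder_powr:
  fixes f g :: "real \<Rightarrow> real"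
  assumes cont: "continuous_on {0..1} f" "continuous_on {0..1} g"
    and nn: "\<And>t. 0 \<le> f t" "\<And>t. 0 \<le> g t" and \<alpha>: "0 < \<alpha>" "0 < \<beta>" "\<alpha> + \<beta> = 1"
  shows "integral {0..1} (\<lambda>t. f t powr \<alpha> * g t powr \<beta>) \<le> integral {0..1} f powr \<alpha> * integral {0..1} g powr \<beta>"
proof -
  define A where "A = integral {0..1} f"
  define B where "B = integral {0..1} g"
  have A: "A \<ge> 0" and B: "B \<ge> 0" unfolding A_def B_def using nn
    by (auto intro!: Henstock_Kurzweil_Integration.integral_nonneg integrable_continuous_interval cont)
  show ?thesis
  proof (cases "A = 0 \<or> B = 0")
    case True
    then have "f t = 0 \<or> g t = 0" if "t \<in> {0..1}" for t
      using integral_eq_0_iff[of 0 1 f] integral_eq_0_iff[of 0 1 g] cont nn that by (auto simp: A_def B_def)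
    then have "integral {0..1} (\<lambda>t. f t powr \<alpha> * g t powr \<beta>) = integral {0..1} (\<lambda>t::real. 0::real)"
      using \<alpha> by (intro integral_cong) fastforce
    then show ?thesis by simp
  next
    case False
    then have AB: "A > 0" "B > 0" using A B by auto
    have "integral {0..1} (\<lambda>t. f t powr \<alpha> * g t powr \<beta>) \<le>
        integral {0..1} (\<lambda>t. A powr \<alpha> * B powr \<beta> * (\<alpha> / A * f t + \<beta> / B * g t))"
    proof (intro integral_le integrable_continuous_interval continuous_on_mult continuous_on_add continuous_on_const
        continuous_on_powr' cont)
      fix t
      have "f t / A \<ge> 0" "g t / B \<ge> 0" using nn AB by auto
      then have "(f t / A) powr \<alpha> * (g t / B) powr \<beta> \<le> \<alpha> * (f t / A) + \<beta> * (g t / B)"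
        using Youngs_inequality_0[of \<alpha> \<beta> "f t / A" "g t / B"] \<alpha> AB nn[of t]
        by (cases "f t = 0 \<or> g t = 0") auto
      then have "A powr \<alpha> * B powr \<beta> * ((f t / A) powr \<alpha> * (g t / B) powr \<beta>) \<le>
          A powr \<alpha> * B powr \<beta> * (\<alpha> * (f t / A) + \<beta> * (g t / B))"
        by (intro mult_left_mono) auto
      then show "f t powr \<alpha> * g t powr \<beta> \<le> A powr \<alpha> * B powr \<beta> * (\<alpha> / A * f t + \<beta> / B * g t)"
        using AB nn by (simp add: powr_divide mult.commute)
    qed (use nn \<alpha> AB in auto)
    also have "\<dots> = A powr \<alpha> * B powr \<beta> * (\<alpha> / A * A + \<beta> / B * B)"
      unfolding A_def B_def
      by (intro integral_unique has_integral_mult_right has_integral_add integrable_integral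
        integrable_continuous_interval cont)
    also have "\<dots> = A powr \<alpha> * B powr \<beta>" using AB \<alpha> by simp
    finally show ?thesis by (simp add: A_def B_def)
  qed
qed

text \<open>Up to the factor \<open>p\<close>, this is the gradient of
  \<open>|z|^p\<close>: the derivative in direction \<open>b\<close> is
  \<open>p * Re (duality_map p z * b)\<close>. It is continuous at the origin only
  for \<open>p > 1\<close>, which is why smaller \<open>p\<close> are treated
  differently.\<close>

definition duality_map :: "real \<Rightarrow> complex \<Rightarrow> complex" where
  "duality_map p z = of_real (cmod z powr (p - 2)) * cnj z"

lemma norm_duality_map: "cmod (duality_map p z) = cmod z powr (p - 1)"
proof (cases "z = 0")
  case False
  then have "cmod z powr (p - 2) * cmod z = cmod z powr (p - 2) * cmod z powr 1" by simp
  also have "\<dots> = cmod z powr (p - 1)" unfolding powr_add[symmetric] by simp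
  finally show ?thesis by (simp add: duality_map_def norm_mult)
qed (simp add: duality_map_def)

lemma duality_map_self: "duality_map p z * z = of_real (cmod z powr p)"
proof (cases "z = 0")
  case False
  have "duality_map p z * z = of_real (cmod z powr (p - 2) * (cmod z)\<^sup>2)"
    by (simp add: duality_map_def complex_norm_square mult_ac del: of_real_power)
  also have "(cmod z)\<^sup>2 = cmod z powr 2" using False by simp
  also have "cmod z powr (p - 2) * cmod z powr 2 = cmod z powr p"
    unfolding powr_add[symmetric] by simp
  finally show ?thesis .
qed (simp add: duality_map_def)

lemma Re_duality_map: "Re (duality_map p a * b) = cmod a powr (p - 2) * Re (cnj a * b)"
  by (simp add: duality_map_def algebra_simps)

lemma continuous_duality_map:
  assumes "p > 1" shows "continuous_on S (duality_map p)"
proof -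
  have "isCont (duality_map p) z" for z
  proof (cases "z = 0")
    case False
    then show ?thesis unfolding duality_map_def by (intro continuous_intros) auto
  next
    case True
    have "((\<lambda>z. cmod z powr (p - 1)) \<longlongrightarrow> cmod 0 powr (p - 1)) (at (0::complex))"
      using assms by (intro tendsto_powr' tendsto_intros) auto
    then have "(duality_map p \<longlongrightarrow> 0) (at 0)"
      using assms by (intro tendsto_norm_zero_cancel[of "duality_map p"]) (simp add: norm_duality_map)
    then show ?thesis using True by (simp add: isCont_def duality_map_def)
  qed
  then show ?thesis by (simp add: continuous_at_imp_continuous_on)
qed

lemma Re_duality_map_le: "Re (duality_map p a * b) \<le> cmod a powr (p - 1) * cmod (a + b) - cmod a powr p"
proof -
  have "duality_map p a * b = duality_map p a * (a + b) - of_real (cmod a powr p)"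
    by (simp add: duality_map_self distrib_left)
  then have "Re (duality_map p a * b) = Re (duality_map p a * (a + b)) - cmod a powr p" by simp
  also have "Re (duality_map p a * (a + b)) \<le> cmod (duality_map p a * (a + b))" by (rule complex_Re_le_cmod)
  finally show ?thesis by (simp add: norm_mult norm_duality_map)
qed

lemma Re_duality_map_ge: "Re (duality_map p a * b) \<ge> - (cmod a powr (p - 1) * cmod b)"
  using abs_Re_le_cmod[of "duality_map p a * b"] by (simp add: norm_mult norm_duality_map)

lemma norm_powr_tangent:
  assumes "p \<ge> 1"
  shows "cmod a powr p + p * Re (duality_map p a * b) \<le> cmod (a + b) powr p"
proof -
  have "p * Re (duality_map p a * b) \<le> p * (cmod a powr (p - 1) * cmod (a + b) - cmod a powr p)"
    using assms Re_duality_map_le by (intro mult_left_mono) auto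
  moreover have "cmod a powr (p - 1) * cmod a = cmod a powr p"
    by (cases "a = 0") (simp_all add: powr_diff)
  ultimately show ?thesis using powr_tangent[OF assms, of "cmod a" "cmod (a + b)"]
    by (simp add: algebra_simps)
qed

lemma norm_powr_add_le: "p \<ge> 0 \<Longrightarrow> cmod (a + b) powr p \<le> 2 powr p * (cmod a powr p + cmod b powr p)"
proof -
  assume p: "p \<ge> 0"
  have "cmod (a + b) powr p \<le> (2 * max (cmod a) (cmod b)) powr p"
    using norm_triangle_ineq[of a b] p by (intro powr_mono2) auto
  also have "\<dots> = 2 powr p * (max (cmod a) (cmod b)) powr p" by (rule powr_mult)
  also have "max (cmod a) (cmod b) powr p \<le> cmod a powr p + cmod b powr p" by (auto simp: max_def)
  finally show ?thesis by simp
qed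

text \<open>The expansion of \<open>|a + b|^p\<close> at \<open>a\<close> is the
  expansion of \<open>(1 + y)^(p/2)\<close> at \<open>y = 0\<close>, where
  \<open>1 + y\<close> is the ratio of \<open>|a + b|^2\<close> and
  \<open>|a|^2\<close>.\<close>

lemma norm_add_powr_ratio:
  assumes a: "a \<noteq> 0"
  obtains y where "0 \<le> 1 + y" "\<bar>y\<bar> \<le> (2 * (cmod a * cmod b) + (cmod b)\<^sup>2) / (cmod a)\<^sup>2"
    "cmod (a + b) powr p = cmod a powr p * (1 + y) powr (p / 2)"
    "cmod a powr p * (p / 2 * y) = p * Re (duality_map p a * b) + p / 2 * (cmod a powr (p - 2) * (cmod b)\<^sup>2)"
proof
  define r where "r = Re (cnj a * b)"
  define x where "x = 2 * r + (cmod b)\<^sup>2"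
  let ?y = "x / (cmod a)\<^sup>2"
  have "(cmod (a + b))\<^sup>2 = (cmod a)\<^sup>2 + x"
    unfolding cmod_power2 x_def r_def by (simp add: power2_eq_square algebra_simps)
  then have eq: "(cmod (a + b))\<^sup>2 = (cmod a)\<^sup>2 * (1 + ?y)" using a by (simp add: distrib_left)
  then show "0 \<le> 1 + ?y"
    using a by (metis zero_le_mult_iff zero_le_power2 zero_less_power2 norm_eq_zero linorder_not_less)
  have "\<bar>r\<bar> \<le> cmod a * cmod b"
    using abs_Re_le_cmod[of "cnj a * b"] by (simp add: r_def norm_mult)
  moreover have "(cmod b)\<^sup>2 \<ge> 0" by simp
  ultimately have "\<bar>x\<bar> \<le> 2 * (cmod a * cmod b) + (cmod b)\<^sup>2" unfolding x_def by linarith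
  then show "\<bar>?y\<bar> \<le> (2 * (cmod a * cmod b) + (cmod b)\<^sup>2) / (cmod a)\<^sup>2"
    by (simp add: abs_divide divide_right_mono)
  have powr2: "cmod c powr p = ((cmod c)\<^sup>2) powr (p / 2)" for c
    by (cases "c = 0") (auto simp: powr_powr simp flip: powr_numeral)
  show "cmod (a + b) powr p = cmod a powr p * (1 + ?y) powr (p / 2)"
    unfolding powr2 eq by (rule powr_mult)
  have "cmod a powr p / (cmod a)\<^sup>2 = cmod a powr (p - 2)" using a by (simp add: powr_diff)
  then have "cmod a powr p * ?y = cmod a powr (p - 2) * x"
    by (metis times_divide_eq_left times_divide_eq_right)
  then have "p / 2 * (cmod a powr p * ?y) = p / 2 * (cmod a powr (p - 2) * x)" by (rule arg_cong)
  also have "\<dots> = p * (cmod a powr (p - 2) * r) + p / 2 * (cmod a powr (p - 2) * (cmod b)\<^sup>2)"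
    by (simp add: x_def algebra_simps)
  finally show "cmod a powr p * (p / 2 * ?y) = p * Re (duality_map p a * b) + p / 2 * (cmod a powr (p - 2) * (cmod b)\<^sup>2)"
    unfolding Re_duality_map r_def[symmetric] by (simp only: mult.left_commute)
qed

text \<open>When \<open>b\<close> is the larger summand no expansion is needed, since
  every term is bounded by a multiple of \<open>|b|^p\<close>.\<close>

lemma norm_powr_dominated:
  assumes p: "p \<ge> 1" and le: "cmod a \<le> cmod b"
  shows "cmod (a + b) powr p \<le> 2 powr p * cmod b powr p"
    and "p * Re (duality_map p a * b) \<ge> - (p * cmod b powr p)"
proof -
  have "cmod (a + b) powr p \<le> (2 * cmod b) powr p"
    using norm_triangle_ineq[of a b] le p by (intro powr_mono2) auto
  also have "\<dots> = 2 powr p * cmod b powr p" by (rule powr_mult)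
  finally show "cmod (a + b) powr p \<le> 2 powr p * cmod b powr p" .
  have "cmod a powr (p - 1) * cmod b \<le> cmod b powr (p - 1) * cmod b"
    using le p by (intro mult_right_mono powr_mono2) auto
  also have "\<dots> = cmod b powr p" by (cases "b = 0") (simp_all add: powr_diff)
  finally have "Re (duality_map p a * b) \<ge> - (cmod b powr p)" using Re_duality_map_ge[of a p b] by linarith
  from mult_left_mono[OF this, of p] p show "p * Re (duality_map p a * b) \<ge> - (p * cmod b powr p)" by simp
qed

text \<open>For exponents up to 2 the function \<open>x^(p/2)\<close> is concave, so its
  first order expansion is an upper bound; the quadratic part of \<open>y\<close>
  contributes \<open>|a|^(p-2) * |b|^2\<close>, which is at most \<open>|b|^p\<close>
  when \<open>|b| \<le> |a|\<close>.\<close>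

lemma norm_powr_smooth_le_2:
  assumes p: "1 < p" "p \<le> 2"
  shows "cmod (a + b) powr p \<le> cmod a powr p + p * Re (duality_map p a * b) + 6 * cmod b powr p"
proof (cases "cmod b \<le> cmod a \<and> a \<noteq> 0")
  case True
  then have "a \<noteq> 0" by simp
  from norm_add_powr_ratio[OF this, of b p] obtain y where y: "0 \<le> 1 + y"
    "cmod (a + b) powr p = cmod a powr p * (1 + y) powr (p / 2)"
    "cmod a powr p * (p / 2 * y) = p * Re (duality_map p a * b) + p / 2 * (cmod a powr (p - 2) * (cmod b)\<^sup>2)"
    by metis
  define x where "x = (1 + y) powr (p / 2)"
  have "x powr (2 / p) = 1 + y" using p y(1) by (simp add: x_def powr_powr)
  then have "x \<le> 1 + p / 2 * y"
    using powr_tangent[of "2 / p" 1 x] p by (simp add: x_def field_simps)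
  then have "cmod a powr p * x \<le> cmod a powr p * (1 + p / 2 * y)" by (intro mult_left_mono) auto
  moreover have "cmod a powr (p - 2) * (cmod b)\<^sup>2 \<le> cmod b powr p"
  proof (cases "b = 0")
    case False
    have "cmod a powr (p - 2) \<le> cmod b powr (p - 2)"
      using True False p by (intro powr_mono2') auto
    then have "cmod a powr (p - 2) * (cmod b)\<^sup>2 \<le> cmod b powr (p - 2) * (cmod b)\<^sup>2"
      by (intro mult_right_mono) auto
    also have "\<dots> = cmod b powr p" using False by (simp add: powr_diff)
    finally show ?thesis .
  qed auto
  moreover have "p / 2 * (cmod a powr (p - 2) * (cmod b)\<^sup>2) \<le> 6 * (cmod a powr (p - 2) * (cmod b)\<^sup>2)"
    using p by (intro mult_right_mono) auto
  ultimately show ?thesis using y(2,3) by (simp add: x_def algebra_simps)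
next
  case False
  then have le: "cmod a \<le> cmod b" by auto
  have "2 powr p \<le> (4::real)" using powr_mono[of p 2 "2::real"] p by simp
  then have "2 powr p * cmod b powr p \<le> 4 * cmod b powr p" "p * cmod b powr p \<le> 2 * cmod b powr p"
    using p by (intro mult_right_mono; simp)+
  moreover have "cmod a powr p \<ge> 0" by simp
  ultimately show ?thesis using norm_powr_dominated[OF less_imp_le[OF p(1)] le] by linarith
qed

text \<open>For \<open>s < 2\<close> the second derivative of \<open>x^s\<close> is
  unbounded near 0, so Taylor's formula is of no use. Convexity gives
  \<open>x^s - 1 \<le> s * x^(s-1) * (x - 1)\<close>, and it remains to compare
  \<open>x^(s-1) - 1\<close> with \<open>x - 1\<close>, where the cases
  \<open>s - 1 \<le> 1\<close> and \<open>s - 1 > 1\<close> differ.\<close>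

lemma powr_quadratic_bound:
  fixes s x :: real
  assumes s: "s > 1" and x: "0 \<le> x" "x \<le> 4"
  shows "x powr s \<le> 1 + s * (x - 1) + s * (1 + s * 4 powr s) * (x - 1)\<^sup>2"
proof -
  define t where "t = s - 1"
  define L where "L = 1 + s * 4 powr s"
  have L1: "L \<ge> 1" using s by (simp add: L_def)
  have "(x powr t - 1) * (x - 1) \<le> L * (x - 1)\<^sup>2"
  proof (cases "x \<ge> 1")
    case True
    have "x powr t - 1 \<le> L * (x - 1)"
    proof (cases "t \<le> 1")
      case True
      then have "x powr t \<le> x powr 1" using \<open>x \<ge> 1\<close> by (intro powr_mono) auto
      moreover have "1 * (x - 1) \<le> L * (x - 1)" using L1 \<open>x \<ge> 1\<close> by (intro mult_right_mono) auto
      ultimately show ?thesis using \<open>x \<ge> 1\<close> by simp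
    next
      case False
      then have "x powr t - 1 \<le> t * x powr (t - 1) * (x - 1)"
        using powr_tangent[of t x 1] x by (simp add: algebra_simps)
      also have "\<dots> \<le> L * (x - 1)"
      proof (intro mult_right_mono)
        have "x powr (t - 1) \<le> 4 powr (t - 1)" using x False by (intro powr_mono2) auto
        also have "\<dots> \<le> 4 powr s" by (intro powr_mono) (auto simp: t_def)
        finally have "t * x powr (t - 1) \<le> s * 4 powr s"
          using False by (intro mult_mono) (auto simp: t_def)
        then show "t * x powr (t - 1) \<le> L" by (simp add: L_def)
      qed (use \<open>x \<ge> 1\<close> in auto)
      finally show ?thesis .
    qed
    from mult_right_mono[OF this, of "x - 1"] True show ?thesis by (simp add: power2_eq_square mult_ac)
  next
    case x1: False
    have "1 - x powr t \<le> L * (1 - x)"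
    proof (cases "t \<le> 1")
      case True
      have "x powr 1 \<le> x powr t" using x x1 True by (intro powr_mono') auto
      moreover have "1 * (1 - x) \<le> L * (1 - x)" using L1 x1 by (intro mult_right_mono) auto
      ultimately show ?thesis using x by simp
    next
      case False
      then have "1 - x powr t \<le> t * (1 - x)"
        using powr_tangent[of t 1 x] x by (simp add: algebra_simps)
      also have "\<dots> \<le> L * (1 - x)"
      proof (intro mult_right_mono)
        have "s * 1 \<le> s * 4 powr s" using s by (intro mult_left_mono ge_one_powr_ge_zero) auto
        then show "t \<le> L" by (simp add: L_def t_def)
      qed (use x1 in auto)
      finally show ?thesis .
    qed
    from mult_right_mono[OF this, of "1 - x"] x1 show ?thesis by (simp add: power2_eq_square algebra_simps)
  qed
  then have "s * ((x powr t - 1) * (x - 1)) \<le> s * (L * (x - 1)\<^sup>2)"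
    using s by (intro mult_left_mono) auto
  moreover have "x powr s + s * x powr t * (1 - x) \<le> 1"
    using powr_tangent[of s x 1] s x by (simp add: t_def)
  ultimately show ?thesis by (simp add: L_def algebra_simps)
qed

lemma norm_powr_smooth_ge_2:
  fixes p :: real
  assumes p: "2 < p"
  shows "\<exists>C\<ge>0. \<forall>a b. cmod (a + b) powr p \<le>
    cmod a powr p + p * Re (duality_map p a * b) + C * (cmod a powr (p - 2) * (cmod b)\<^sup>2 + cmod b powr p)"
proof -
  define K where "K = p / 2 * (1 + p / 2 * 4 powr (p / 2))"
  define C where "C = p / 2 + 9 * K + 2 powr p + p"
  have K0: "K \<ge> 0" using p by (simp add: K_def)
  show ?thesis
  proof (intro exI conjI allI)
    show "C \<ge> 0" using p K0 by (simp add: C_def)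
    fix a b :: complex
    define T where "T = cmod a powr (p - 2) * (cmod b)\<^sup>2"
    have T0: "T \<ge> 0" by (simp add: T_def)
    show "cmod (a + b) powr p \<le> cmod a powr p + p * Re (duality_map p a * b) +
        C * (cmod a powr (p - 2) * (cmod b)\<^sup>2 + cmod b powr p)"
    proof (cases "cmod b \<le> cmod a \<and> a \<noteq> 0")
      case True
      then have "a \<noteq> 0" by simp
      from norm_add_powr_ratio[OF this, of b p] obtain y where y: "0 \<le> 1 + y"
        "\<bar>y\<bar> \<le> (2 * (cmod a * cmod b) + (cmod b)\<^sup>2) / (cmod a)\<^sup>2"
        "cmod (a + b) powr p = cmod a powr p * (1 + y) powr (p / 2)"
        "cmod a powr p * (p / 2 * y) = p * Re (duality_map p a * b) + p / 2 * T"
        unfolding T_def by metis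
      note y(2)
      also have "(2 * (cmod a * cmod b) + (cmod b)\<^sup>2) / (cmod a)\<^sup>2 \<le> 3 * (cmod a * cmod b) / (cmod a)\<^sup>2"
        using True by (intro divide_right_mono) (auto simp: power2_eq_square mult_right_mono)
      also have "\<dots> = 3 * (cmod b / cmod a)" using True by (simp add: power2_eq_square)
      finally have absy: "\<bar>y\<bar> \<le> 3 * (cmod b / cmod a)" .
      also have "\<dots> \<le> 3 * 1" using True by (intro mult_left_mono) auto
      finally have y3: "1 + y \<le> 4" by simp
      have "y\<^sup>2 \<le> (3 * (cmod b / cmod a))\<^sup>2" using power_mono[OF absy abs_ge_zero, of 2] by simp
      then have y2: "y\<^sup>2 \<le> 9 * ((cmod b)\<^sup>2 / (cmod a)\<^sup>2)" by (simp add: power_divide power_mult_distrib)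
      have "(1 + y) powr (p / 2) \<le> 1 + p / 2 * y + K * y\<^sup>2"
        using powr_quadratic_bound[of "p / 2" "1 + y"] p y(1) y3 by (simp add: K_def)
      also have "\<dots> \<le> 1 + p / 2 * y + K * (9 * ((cmod b)\<^sup>2 / (cmod a)\<^sup>2))"
        using y2 K0 by (intro add_left_mono mult_left_mono) auto
      finally have "cmod a powr p * (1 + y) powr (p / 2) \<le> cmod a powr p * (1 + p / 2 * y + K * (9 * ((cmod b)\<^sup>2 / (cmod a)\<^sup>2)))"
        by (intro mult_left_mono) auto
      moreover have ap: "cmod a powr p / (cmod a)\<^sup>2 = cmod a powr (p - 2)" using True by (simp add: powr_diff)
      moreover have "cmod a powr p * (K * (9 * ((cmod b)\<^sup>2 / (cmod a)\<^sup>2))) = 9 * K * T"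
        unfolding T_def using ap by (simp flip: ap)
      moreover have "(p / 2 + 9 * K) * T \<le> C * (T + cmod b powr p)"
        using T0 p K0 by (intro mult_mono) (auto simp: C_def)
      ultimately show ?thesis using y(3,4) unfolding T_def[symmetric] by (simp add: algebra_simps)
    next
      case False
      have "cmod a \<le> cmod b" using False by auto
      from norm_powr_dominated[OF _ this, of p] p
      have "cmod (a + b) powr p \<le> 2 powr p * cmod b powr p" "p * Re (duality_map p a * b) \<ge> - (p * cmod b powr p)"
        by simp_all
      moreover have "(2 powr p + p) * cmod b powr p \<le> C * (T + cmod b powr p)"
        using T0 p K0 by (intro mult_mono) (auto simp: C_def)
      moreover have "cmod a powr p \<ge> 0" by simp
      ultimately show ?thesis unfolding T_def[symmetric] by (simp only: distrib_right)
    qed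
  qed
qed

text \<open>The \<open>p\<close>-th power of the norm of \<open>a\<close> in
  \<open>L^p\<close> of the unit interval.\<close>

definition Lp_int :: "real \<Rightarrow> (real \<Rightarrow> complex) \<Rightarrow> real" where
  "Lp_int p a = integral {0..1} (\<lambda>t. cmod (a t) powr p)"

lemma Lp_int_nonneg: "Lp_int p a \<ge> 0"
  unfolding Lp_int_def
  by (cases "(\<lambda>t. cmod (a t) powr p) integrable_on {0..1}")
     (auto intro!: Henstock_Kurzweil_Integration.integral_nonneg simp: not_integrable_integral)

lemma integral_duality_map_le:
  assumes p: "p > 1" and a: "continuous_on {0..1} a" and b: "continuous_on {0..1} b"
  shows "integral {0..1} (\<lambda>t. cmod (a t) powr (p - 1) * cmod (b t)) \<le>
    Lp_int p a powr ((p - 1) / p) * Lp_int p b powr (1 / p)"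
proof -
  have "integral {0..1} (\<lambda>t. (cmod (a t) powr p) powr ((p - 1) / p) * (cmod (b t) powr p) powr (1 / p)) \<le>
    Lp_int p a powr ((p - 1) / p) * Lp_int p b powr (1 / p)"
    unfolding Lp_int_def using p
    by (intro integral_Hoelder_powr continuous_on_norm_powr a b) (auto simp: field_simps)
  then show ?thesis using p by (simp add: powr_powr)
qed

text \<open>The function \<open>k\<close> is a supporting functional at \<open>a\<close>
  of the \<open>q\<close>-th power of the norm of \<open>L^p\<close>, and this power
  deviates from its support by at most a multiple of the \<open>q\<close>-th power of the
  norm of the increment.\<close>

definition Lp_expansion :: "real \<Rightarrow> real \<Rightarrow> real \<Rightarrow> (real \<Rightarrow> complex) \<Rightarrow> (real \<Rightarrow> complex) \<Rightarrow> bool" where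
  "Lp_expansion p q C a k \<longleftrightarrow> continuous_on {0..1} k \<and>
    (\<forall>b. continuous_on {0..1} b \<longrightarrow>
      (let A = Lp_int p a powr (q / p) + integral {0..1} (\<lambda>t. Re (k t * b t));
           Y = Lp_int p (\<lambda>t. a t + b t) powr (q / p)
       in A \<le> Y \<and> Y \<le> A + C * Lp_int p b powr (q / p)))"

text \<open>The space \<open>L^p\<close> is uniformly smooth of power type
  \<open>min p 2\<close>. For \<open>p \<le> 2\<close> the pointwise expansions of
  \<open>|.|^p\<close> can be integrated as they are. For \<open>p > 2\<close> the
  \<open>p\<close>-th power of the norm is expanded first; Hoelder's inequality turns the
  mixed error term \<open>|a|^(p-2) * |b|^2\<close> into norms, and concavity of
  \<open>x^(2/p)\<close> converts the result into a statement on squares of norms.\<close>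

lemma Lp_norm_smooth:
  fixes p :: real
  assumes p: "p > 1"
  shows "\<exists>C\<ge>0. \<forall>a. continuous_on {0..1} a \<longrightarrow> (\<exists>k. Lp_expansion p (min p 2) C a k)"
proof (cases "p \<le> 2")
  case True
  then have q: "min p 2 / p = 1" using p by simp
  show ?thesis
  proof (intro exI[of _ "6::real"] conjI allI impI)
    fix a :: "real \<Rightarrow> complex" assume a: "continuous_on {0..1} a"
    define k where "k t = of_real p * duality_map p (a t)" for t
    have k: "continuous_on {0..1} k"
      unfolding k_def by (intro continuous_intros continuous_on_compose2[OF continuous_duality_map[OF p] a]) auto
    have "Lp_int p a + integral {0..1} (\<lambda>t. Re (k t * b t)) \<le> Lp_int p (\<lambda>t. a t + b t) \<and>
      Lp_int p (\<lambda>t. a t + b t) \<le> Lp_int p a + integral {0..1} (\<lambda>t. Re (k t * b t)) + 6 * Lp_int p b"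
      if b: "continuous_on {0..1} b" for b
    proof -
      have cb: "continuous_on {0..1} (\<lambda>t. Re (k t * b t))" by (intro continuous_intros k b)
      have ca: "continuous_on {0..1} (\<lambda>t. cmod (a t) powr p)" "continuous_on {0..1} (\<lambda>t. cmod (b t) powr p)"
        "continuous_on {0..1} (\<lambda>t. cmod (a t + b t) powr p)"
        using p by (intro continuous_on_norm_powr a b continuous_on_add; simp)+
      note int = cb[THEN integrable_continuous_interval] ca[THEN integrable_continuous_interval]
      have re: "Re (k t * b t) = p * Re (duality_map p (a t) * b t)" for t
        by (simp add: k_def mult.assoc right_diff_distrib)
      have "integral {0..1} (\<lambda>t. cmod (a t) powr p + Re (k t * b t)) \<le> integral {0..1} (\<lambda>t. cmod (a t + b t) powr p)"
        using norm_powr_tangent[of p] p by (intro integral_le Henstock_Kurzweil_Integration.integrable_add int) (auto simp only: re)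
      moreover have "integral {0..1} (\<lambda>t. cmod (a t + b t) powr p) \<le>
          integral {0..1} (\<lambda>t. (cmod (a t) powr p + Re (k t * b t)) + 6 * cmod (b t) powr p)"
        using norm_powr_smooth_le_2[OF p True]
        by (intro integral_le Henstock_Kurzweil_Integration.integrable_add integrable_on_mult_right int) (auto simp only: re)
      moreover have "integral {0..1} (\<lambda>t. (cmod (a t) powr p + Re (k t * b t)) + 6 * cmod (b t) powr p)
          = (Lp_int p a + integral {0..1} (\<lambda>t. Re (k t * b t))) + 6 * Lp_int p b"
        unfolding Lp_int_def
        by (intro integral_unique has_integral_add has_integral_mult_right integrable_integral int)
      moreover have "integral {0..1} (\<lambda>t. cmod (a t) powr p + Re (k t * b t)) = Lp_int p a + integral {0..1} (\<lambda>t. Re (k t * b t))"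
        unfolding Lp_int_def by (rule Henstock_Kurzweil_Integration.integral_add[OF int(2,1)])
      ultimately show ?thesis by (simp add: Lp_int_def)
    qed
    then show "\<exists>k. Lp_expansion p (min p 2) 6 a k"
      using k Lp_int_nonneg[of p] unfolding Lp_expansion_def q Let_def by (intro exI[of _ k]) simp
  qed simp
next
  case False
  then have p2: "p > 2" and q: "min p 2 = 2" by auto
  obtain C1 where C1: "C1 \<ge> 0" "\<And>a b. cmod (a + b) powr p \<le>
    cmod a powr p + p * Re (duality_map p a * b) + C1 * (cmod a powr (p - 2) * (cmod b)\<^sup>2 + cmod b powr p)"
    using norm_powr_smooth_ge_2[OF p2] by blast
  define C2 where "C2 = (2 powr p * 2) powr (2 / p) + 2"
  define C where "C = 4 * C1 / p + C2"
  have C: "C \<ge> 0" "C2 \<le> C" "4 * C1 / p \<le> C" using C1 p2 by (auto simp: C_def C2_def)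
  show ?thesis unfolding q
  proof (intro exI[of _ C] conjI allI impI)
    fix a :: "real \<Rightarrow> complex" assume a: "continuous_on {0..1} a"
    define A where "A = Lp_int p a"
    have A0: "A \<ge> 0" unfolding A_def by (rule Lp_int_nonneg)
    define c where "c = 2 * A powr ((2 - p) / p)"
    define k where "k t = of_real c * duality_map p (a t)" for t
    have cont_d: "continuous_on {0..1} (\<lambda>t. duality_map p (a t))"
      by (intro continuous_on_compose2[OF continuous_duality_map[OF p] a]) auto
    then have k: "continuous_on {0..1} k"
      unfolding k_def by (intro continuous_intros)
    have "A powr (2 / p) + integral {0..1} (\<lambda>t. Re (k t * b t)) \<le> Lp_int p (\<lambda>t. a t + b t) powr (2 / p) \<and>
      Lp_int p (\<lambda>t. a t + b t) powr (2 / p) \<le>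
        A powr (2 / p) + integral {0..1} (\<lambda>t. Re (k t * b t)) + C * Lp_int p b powr (2 / p)"
      if b: "continuous_on {0..1} b" for b
    proof -
      define B where "B = Lp_int p b"
      define Y where "Y = Lp_int p (\<lambda>t. a t + b t)"
      define lin where "lin = integral {0..1} (\<lambda>t. Re (duality_map p (a t) * b t))"
      have B0: "B \<ge> 0" and Y0: "Y \<ge> 0" unfolding B_def Y_def by (rule Lp_int_nonneg)+
      have kl: "integral {0..1} (\<lambda>t. Re (k t * b t)) = c * lin"
      proof -
        have "Re (k t * b t) = c * Re (duality_map p (a t) * b t)" for t
          by (simp add: k_def mult.assoc right_diff_distrib)
        then show ?thesis unfolding lin_def by (simp only: integral_mult_right)
      qed
      have ab: "continuous_on {0..1} (\<lambda>t. a t + b t)" by (intro continuous_intros a b)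
      have cl: "continuous_on {0..1} (\<lambda>t. Re (duality_map p (a t) * b t))" by (intro continuous_intros cont_d b)
      have ca: "continuous_on {0..1} (\<lambda>t. cmod (a t) powr p)" "continuous_on {0..1} (\<lambda>t. cmod (b t) powr p)"
        "continuous_on {0..1} (\<lambda>t. cmod (a t + b t) powr p)"
        "continuous_on {0..1} (\<lambda>t. cmod (a t) powr (p - 1))" "continuous_on {0..1} (\<lambda>t. cmod (a t) powr (p - 2))"
        using p2 by (intro continuous_on_norm_powr a b continuous_on_add; simp)+
      have c1: "continuous_on {0..1} (\<lambda>t. cmod (a t) powr (p - 1) * cmod (a t + b t))"
        by (intro continuous_on_mult ca continuous_on_norm ab)
      have c1': "continuous_on {0..1} (\<lambda>t. cmod (a t) powr (p - 1) * cmod (b t))"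
        by (intro continuous_on_mult ca continuous_on_norm b)
      have c2: "continuous_on {0..1} (\<lambda>t. cmod (a t) powr (p - 2) * (cmod (b t))\<^sup>2)"
        by (intro continuous_on_mult ca continuous_on_power continuous_on_norm b)
      note int = cl[THEN integrable_continuous_interval] ca(1-3)[THEN integrable_continuous_interval]
        c1[THEN integrable_continuous_interval] c1'[THEN integrable_continuous_interval] c2[THEN integrable_continuous_interval]
      have l_le: "lin \<le> A powr ((p - 1) / p) * Y powr (1 / p) - A"
      proof -
        have "lin \<le> integral {0..1} (\<lambda>t. cmod (a t) powr (p - 1) * cmod (a t + b t) - cmod (a t) powr p)"
          unfolding lin_def by (intro integral_le int integrable_diff Re_duality_map_le)
        also have "\<dots> = integral {0..1} (\<lambda>t. cmod (a t) powr (p - 1) * cmod (a t + b t)) - A"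
          unfolding A_def Lp_int_def by (intro Henstock_Kurzweil_Integration.integral_diff int)
        finally show ?thesis using integral_duality_map_le[OF p a ab] by (simp add: A_def Y_def)
      qed
      have l_ge: "lin \<ge> - (A powr ((p - 1) / p) * B powr (1 / p))"
      proof -
        have "integral {0..1} (\<lambda>t. - (cmod (a t) powr (p - 1) * cmod (b t))) \<le> lin"
          unfolding lin_def by (intro integral_le int integrable_neg Re_duality_map_ge)
        then show ?thesis using integral_duality_map_le[OF p a b] by (simp add: A_def B_def)
      qed
      have AA: "A powr ((2 - p) / p) * A powr ((p - 1) / p) = A powr (1 / p)"
        "A powr ((2 - p) / p) * A = A powr (2 / p)" if "A > 0"
      proof -
        show "A powr ((2 - p) / p) * A powr ((p - 1) / p) = A powr (1 / p)"
          unfolding powr_add[symmetric] by (simp add: add_divide_distrib[symmetric])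
        have "A powr ((2 - p) / p) * A powr 1 = A powr (2 / p)"
          unfolding powr_add[symmetric] using p by (simp add: field_simps)
        then show "A powr ((2 - p) / p) * A = A powr (2 / p)" using that by simp
      qed
      have sq: "x powr (2 / p) = (x powr (1 / p))\<^sup>2" if "x \<ge> 0" for x :: real
        using that by (cases "x = 0") (auto simp: powr_powr simp flip: powr_numeral)
      have lower: "A powr (2 / p) + c * lin \<le> Y powr (2 / p)"
      proof (cases "A = 0")
        case True
        then show ?thesis using p by (simp add: c_def)
      next
        case False
        then have A: "A > 0" using A0 by simp
        have "c * lin \<le> c * (A powr ((p - 1) / p) * Y powr (1 / p) - A)"
          using l_le by (intro mult_left_mono) (auto simp: c_def)
        also have "\<dots> = 2 * (A powr (1 / p) * Y powr (1 / p)) - 2 * A powr (2 / p)"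
          by (simp add: c_def right_diff_distrib flip: AA[OF A])
        finally have "A powr (2 / p) + c * lin \<le> 2 * (A powr (1 / p) * Y powr (1 / p)) - A powr (2 / p)" by simp
        also have "\<dots> \<le> Y powr (2 / p)"
          unfolding sq[OF A0] sq[OF Y0] using zero_le_power2[of "A powr (1 / p) - Y powr (1 / p)"]
          by (simp add: power2_eq_square algebra_simps)
        finally show ?thesis .
      qed
      have upper: "Y powr (2 / p) \<le> A powr (2 / p) + c * lin + C * B powr (2 / p)"
      proof (cases "B \<le> A \<and> A > 0")
        case True
        then have A: "A > 0" and BA: "B \<le> A" by auto
        define D where "D = A powr ((p - 2) / p)"
        have D: "D > 0" using A by (simp add: D_def)
        have c_D: "c * D = 2"
          unfolding c_def D_def mult.assoc powr_add[symmetric] using A p by (simp add: add_divide_distrib[symmetric])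
        have i2: "integral {0..1} (\<lambda>t. cmod (a t) powr (p - 2) * (cmod (b t))\<^sup>2) \<le> D * B powr (2 / p)"
        proof -
          have "integral {0..1} (\<lambda>t. (cmod (a t) powr p) powr ((p - 2) / p) * (cmod (b t) powr p) powr (2 / p)) \<le>
              Lp_int p a powr ((p - 2) / p) * Lp_int p b powr (2 / p)"
            unfolding Lp_int_def using p2
            by (intro integral_Hoelder_powr ca) (auto simp: field_simps)
          then show ?thesis using p2 by (simp add: powr_powr A_def B_def D_def)
        qed
        have "Y \<le> integral {0..1} (\<lambda>t. (cmod (a t) powr p + p * Re (duality_map p (a t) * b t)) +
            C1 * (cmod (a t) powr (p - 2) * (cmod (b t))\<^sup>2 + cmod (b t) powr p))"
          unfolding Y_def Lp_int_def
          by (intro integral_le Henstock_Kurzweil_Integration.integrable_add integrable_on_mult_right int C1(2))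
        also have "\<dots> = (A + p * lin) + C1 * (integral {0..1} (\<lambda>t. cmod (a t) powr (p - 2) * (cmod (b t))\<^sup>2) + B)"
          unfolding A_def B_def Lp_int_def lin_def
          by (intro integral_unique has_integral_add has_integral_mult_right integrable_integral int)
        also have "\<dots> \<le> (A + p * lin) + C1 * (D * B powr (2 / p) + D * B powr (2 / p))"
        proof (intro add_left_mono mult_left_mono add_mono i2)
          have "B = B powr ((p - 2) / p) * B powr (2 / p)"
            using B0 p by (simp flip: powr_add add_divide_distrib)
          also have "\<dots> \<le> D * B powr (2 / p)"
            unfolding D_def using BA B0 p2 by (intro mult_right_mono powr_mono2) auto
          finally show "B \<le> D * B powr (2 / p)" .
        qed (use C1 in auto)
        finally have Y: "Y - A \<le> p * lin + 2 * C1 * D * B powr (2 / p)" by simp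
        have "(A powr (2 / p)) powr (p / 2) + p / 2 * (A powr (2 / p)) powr (p / 2 - 1) * (Y powr (2 / p) - A powr (2 / p))
            \<le> (Y powr (2 / p)) powr (p / 2)"
          using p2 by (intro powr_tangent) auto
        moreover have "(A powr (2 / p)) powr (p / 2 - 1) = D"
        proof -
          have "2 / p * (p / 2 - 1) = (p - 2) / p" using p by (simp add: field_simps)
          then show ?thesis unfolding D_def powr_powr by (rule arg_cong)
        qed
        ultimately have "p / 2 * D * (Y powr (2 / p) - A powr (2 / p)) \<le> Y - A"
          using A0 Y0 p by (simp add: powr_powr)
        with Y have "p / 2 * D * (Y powr (2 / p) - A powr (2 / p)) \<le> p * lin + 2 * C1 * D * B powr (2 / p)" by linarith
        also have "\<dots> = p / 2 * D * (c * lin + 4 * C1 / p * B powr (2 / p))"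
        proof -
          have "p / 2 * D * (c * lin + 4 * C1 / p * B powr (2 / p)) = p / 2 * (c * D) * lin + 2 * C1 * D * B powr (2 / p)"
            using p by (simp add: field_simps)
          then show ?thesis by (simp add: c_D)
        qed
        finally have "Y powr (2 / p) - A powr (2 / p) \<le> c * lin + 4 * C1 / p * B powr (2 / p)"
          by (rule mult_left_le_imp_le) (use D p in auto)
        also have "\<dots> \<le> c * lin + C * B powr (2 / p)"
          using C by (intro add_left_mono mult_right_mono) auto
        finally show ?thesis by simp
      next
        case False
        then have AB: "A \<le> B" using A0 B0 by auto
        have "Y \<le> integral {0..1} (\<lambda>t. 2 powr p * (cmod (a t) powr p + cmod (b t) powr p))"
          unfolding Y_def Lp_int_def using p
          by (intro integral_le Henstock_Kurzweil_Integration.integrable_add integrable_on_mult_right int norm_powr_add_le) auto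
        also have "\<dots> = 2 powr p * (A + B)"
          unfolding A_def B_def Lp_int_def
          by (intro integral_unique has_integral_add has_integral_mult_right integrable_integral int)
        also have "\<dots> \<le> 2 powr p * (2 * B)" using AB by (intro mult_left_mono) auto
        finally have "Y powr (2 / p) \<le> (2 powr p * 2 * B) powr (2 / p)"
          using Y0 p by (intro powr_mono2) auto
        also have "\<dots> = (2 powr p * 2) powr (2 / p) * B powr (2 / p)" by (rule powr_mult)
        finally have 1: "Y powr (2 / p) \<le> (2 powr p * 2) powr (2 / p) * B powr (2 / p)" .
        have "c * lin \<ge> - (2 * B powr (2 / p))"
        proof (cases "A = 0")
          case True
          then show ?thesis using p by (simp add: c_def)
        next
          case False
          then have A: "A > 0" using A0 by simp
          have "c * lin \<ge> c * (- (A powr ((p - 1) / p) * B powr (1 / p)))"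
            using l_ge by (intro mult_left_mono) (auto simp: c_def)
          also have "c * (- (A powr ((p - 1) / p) * B powr (1 / p))) = - (2 * (A powr (1 / p) * B powr (1 / p)))"
            by (simp add: c_def flip: AA[OF A])
          finally have "c * lin \<ge> - (2 * (A powr (1 / p) * B powr (1 / p)))" .
          moreover have "A powr (1 / p) * B powr (1 / p) \<le> B powr (1 / p) * B powr (1 / p)"
            using AB A0 p by (intro mult_right_mono powr_mono2) auto
          ultimately show ?thesis using sq[OF B0] by (simp add: power2_eq_square)
        qed
        moreover have "C2 * B powr (2 / p) \<le> C * B powr (2 / p)" using C by (intro mult_right_mono) auto
        moreover have "A powr (2 / p) \<ge> 0" by simp
        ultimately show ?thesis using 1 unfolding C2_def distrib_right by linarith
      qed
      show ?thesis using lower upper unfolding kl Y_def B_def by blast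
    qed
    then show "\<exists>k. Lp_expansion p 2 C a k"
      using k unfolding A_def Lp_expansion_def Let_def by blast
  qed (use C in auto)
qed

section \<open>Averaging means over small circles\<close>

lemma pmean_eq_Lp_int: "pmean p F w = Lp_int p (\<lambda>t. F (w * circ t))"
  by (simp add: pmean_def Lp_int_def)

lemma norm_one_plus_circ_le: "0 \<le> \<delta> \<Longrightarrow> cmod (1 + of_real \<delta> * circ t) \<le> 1 + \<delta>"
  using norm_triangle_ineq[of 1 "of_real \<delta> * circ t"] by (simp add: norm_mult)

text \<open>For \<open>|w - 1| = \<delta>\<close> the difference
  \<open>F (z * w) - F z\<close> is an integral of \<open>F'\<close> over a segment
  of length at most \<open>\<delta>\<close>, and the points of this segment move on
  circles when \<open>z\<close> does.\<close>

lemma Lp_int_difference_le: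
  assumes p: "p \<ge> 1" and hol: "F holomorphic_on ball 0 1"
    and \<delta>: "0 \<le> \<delta>" and r: "0 \<le> r" "r * (1 + \<delta>) < 1" and N: "N \<ge> 0"
    and bound: "\<And>w. cmod w \<le> r * (1 + \<delta>) \<Longrightarrow> pmean p (deriv F) w \<le> N powr p"
  shows "Lp_int p (\<lambda>\<theta>. F (of_real r * (1 + of_real \<delta> * circ t) * circ \<theta>) - F (of_real r * circ \<theta>)) \<le> (\<delta> * N) powr p"
proof -
  define h where "h \<tau> = of_real r * (1 + of_real (\<tau> * \<delta>) * circ t)" for \<tau> :: real
  have hol': "deriv F holomorphic_on ball 0 1" by (intro holomorphic_deriv hol) auto
  note contF = holomorphic_on_imp_continuous_on[OF hol]
  note contF' = holomorphic_on_imp_continuous_on[OF hol']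
  have h: "cmod (h \<tau>) \<le> r * (1 + \<delta>)" if "\<tau> \<in> {0..1}" for \<tau>
  proof -
    have "cmod (h \<tau>) \<le> r * (1 + \<tau> * \<delta>)"
      unfolding h_def norm_mult using r \<delta> that norm_one_plus_circ_le[of "\<tau> * \<delta>" t] by (intro mult_mono) auto
    also have "\<dots> \<le> r * (1 + \<delta>)" using that \<delta> r mult_right_mono[of \<tau> 1 \<delta>] by (intro mult_left_mono) auto
    finally show ?thesis .
  qed
  then have h1: "cmod (h \<tau>) < 1" if "\<tau> \<in> {0..1}" for \<tau>
    using r that by (meson le_less_trans)
  have conth: "continuous_on A h" for A unfolding h_def by (intro continuous_intros)
  define S where "S \<theta> = integral {0..1} (\<lambda>\<tau>. cmod (deriv F (h \<tau> * circ \<theta>)) powr p)" for \<theta>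
  have r1: "r < 1" using r \<delta> mult_left_mono[of 1 "1 + \<delta>" r] by auto
  have pt: "cmod (F (h 1 * circ \<theta>) - F (h 0 * circ \<theta>)) powr p \<le> \<delta> powr p * S \<theta>" for \<theta>
  proof -
    have cd: "continuous_on {0..1} (\<lambda>\<tau>. deriv F (h \<tau> * circ \<theta>))"
      using h1 by (intro continuous_on_disc_compose[OF contF'] continuous_intros conth) (auto simp: norm_mult)
    have "((\<lambda>\<tau>. of_real r * of_real \<delta> * circ t * circ \<theta> * deriv F (h \<tau> * circ \<theta>)) has_integral
        F (h 1 * circ \<theta>) - F (h 0 * circ \<theta>)) {0..1}"
    proof (rule fundamental_theorem_of_calculus)
      fix \<tau> :: real assume \<tau>: "\<tau> \<in> {0..1}"
      have 1: "(F has_field_derivative deriv F (h \<tau> * circ \<theta>)) (at (h \<tau> * circ \<theta>))"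
        using h1[OF \<tau>] by (intro holomorphic_derivI[OF hol]) (auto simp: norm_mult)
      have 2: "((\<lambda>\<tau>. h \<tau> * circ \<theta>) has_vector_derivative (of_real r * of_real \<delta> * circ t * circ \<theta>)) (at \<tau> within {0..1})"
        unfolding h_def by (auto intro!: derivative_eq_intros simp: algebra_simps)
      show "((\<lambda>\<tau>. F (h \<tau> * circ \<theta>)) has_vector_derivative
          of_real r * of_real \<delta> * circ t * circ \<theta> * deriv F (h \<tau> * circ \<theta>)) (at \<tau> within {0..1})"
        using field_vector_diff_chain_within[OF 2, of F] has_field_derivative_at_within[OF 1] by (simp add: o_def)
    qed simp
    then have "F (h 1 * circ \<theta>) - F (h 0 * circ \<theta>) = integral {0..1} (\<lambda>\<tau>. of_real r * of_real \<delta> * circ t * circ \<theta> * deriv F (h \<tau> * circ \<theta>))"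
      by (rule integral_unique[symmetric])
    also have "cmod \<dots> \<le> integral {0..1} (\<lambda>\<tau>. \<delta> * cmod (deriv F (h \<tau> * circ \<theta>)))"
    proof (rule integral_norm_bound_integral)
      fix \<tau> :: real
      show "cmod (of_real r * of_real \<delta> * circ t * circ \<theta> * deriv F (h \<tau> * circ \<theta>)) \<le> \<delta> * cmod (deriv F (h \<tau> * circ \<theta>))"
        using r r1 \<delta> mult_right_mono[of r 1 \<delta>] by (auto simp: norm_mult intro!: mult_right_mono)
    qed (intro integrable_continuous_interval continuous_on_mult continuous_on_const cd continuous_on_norm)+
    finally have "cmod (F (h 1 * circ \<theta>) - F (h 0 * circ \<theta>)) \<le> \<delta> * integral {0..1} (\<lambda>\<tau>. cmod (deriv F (h \<tau> * circ \<theta>)))"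
      by simp
    then have "cmod (F (h 1 * circ \<theta>) - F (h 0 * circ \<theta>)) powr p \<le> (\<delta> * integral {0..1} (\<lambda>\<tau>. cmod (deriv F (h \<tau> * circ \<theta>)))) powr p"
      using p by (intro powr_mono2) auto
    also have "\<dots> = \<delta> powr p * integral {0..1} (\<lambda>\<tau>. cmod (deriv F (h \<tau> * circ \<theta>))) powr p"
      by (rule powr_mult)
    also have "\<dots> \<le> \<delta> powr p * S \<theta>"
      unfolding S_def using p by (intro mult_left_mono integral_powr_Jensen continuous_on_norm cd) auto
    finally show ?thesis .
  qed
  have contS: "continuous_on {0..1} S"
    unfolding S_def
  proof (rule continuous_on_integral_Icc)
    show "continuous_on ({0..1} \<times> {0..1}) (\<lambda>x. cmod (deriv F (h (snd x) * circ (fst x))) powr p)"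
      using p h1 by (intro continuous_on_norm_powr continuous_on_disc_compose[OF contF'] continuous_intros
          continuous_on_compose2[OF conth[of UNIV]]) (auto simp: norm_mult)
  qed
  have contd: "continuous_on {0..1} (\<lambda>\<theta>. cmod (F (h 1 * circ \<theta>) - F (h 0 * circ \<theta>)) powr p)"
    using p h1[of 0] h1[of 1]
    by (intro continuous_on_norm_powr continuous_on_diff continuous_on_disc_compose[OF contF] continuous_intros) (auto simp: norm_mult)
  have "Lp_int p (\<lambda>\<theta>. F (h 1 * circ \<theta>) - F (h 0 * circ \<theta>)) \<le> integral {0..1} (\<lambda>\<theta>. \<delta> powr p * S \<theta>)"
    unfolding Lp_int_def by (intro integral_le integrable_continuous_interval contd continuous_on_mult continuous_on_const contS pt)
  also have "\<dots> = \<delta> powr p * integral {0..1} S" by simp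
  also have "integral {0..1} S = integral {0..1} (\<lambda>\<tau>. pmean p (deriv F) (h \<tau>))"
    unfolding S_def using p h1 by (intro integral_pmean_swap contF' conth) auto
  also have "\<dots> \<le> integral {0..1} (\<lambda>\<tau>::real. N powr p)"
  proof (rule integral_le)
    show "(\<lambda>\<tau>. pmean p (deriv F) (h \<tau>)) integrable_on {0..1}"
      using h1 p by (intro integrable_continuous_interval continuous_on_pmean[OF contF'] conth) auto
  qed (use bound h in auto)
  finally show ?thesis by (simp add: h_def mult_left_mono powr_mult)
qed

text \<open>Let \<open>a\<close> be the restriction of \<open>F\<close> to the circle of
  radius \<open>r\<close> and \<open>a + b t\<close> the restriction to the circle
  through \<open>r * (1 + \<delta> * circ t)\<close>, transported to the first one
  by multiplication. By the mean value property the average of \<open>b t\<close> over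
  \<open>t\<close> vanishes, hence so does the average of the linear term in the expansion
  of the norm. The average of the means is therefore at least the mean at
  \<open>r\<close>, and exceeds it only by the smoothness error, which is of order
  \<open>\<delta>^q\<close>.\<close>

lemma pmean_two_sided:
  fixes p :: real
  assumes p: "p > 1"
  defines "q \<equiv> min p 2"
  shows "\<exists>C\<ge>0. \<forall>F (r::real) (\<delta>::real). F holomorphic_on ball 0 1 \<and> 0 \<le> \<delta> \<and> 0 \<le> r \<and> r * (1 + \<delta>) < 1 \<longrightarrow>
    pmean p F (of_real r) powr (q / p) \<le> integral {0..1} (\<lambda>t. pmean p F (of_real r * (1 + of_real \<delta> * circ t)) powr (q / p)) \<and>
    (\<forall>N\<ge>0. (\<forall>w. cmod w \<le> r * (1 + \<delta>) \<longrightarrow> pmean p (deriv F) w \<le> N powr p) \<longrightarrow>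
      integral {0..1} (\<lambda>t. pmean p F (of_real r * (1 + of_real \<delta> * circ t)) powr (q / p)) \<le>
      pmean p F (of_real r) powr (q / p) + C * (\<delta> * N) powr q)"
proof -
  obtain C where C: "C \<ge> 0" "\<And>a. continuous_on {0..1} a \<Longrightarrow> \<exists>k. Lp_expansion p q C a k"
    using Lp_norm_smooth[OF p] unfolding q_def by blast
  have q: "q > 1" "q / p > 0" using p by (auto simp: q_def)
  show ?thesis
  proof (intro exI[of _ C] conjI allI impI)
    show "C \<ge> 0" by (rule C)
  next
    fix F and r \<delta> :: real assume "F holomorphic_on ball 0 1 \<and> 0 \<le> \<delta> \<and> 0 \<le> r \<and> r * (1 + \<delta>) < 1"
    then have hol: "F holomorphic_on ball 0 1" and \<delta>: "0 \<le> \<delta>" and r: "0 \<le> r" "r * (1 + \<delta>) < 1" by auto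
    note contF = holomorphic_on_imp_continuous_on[OF hol]
    have r1: "r < 1" using r \<delta> mult_left_mono[of 1 "1 + \<delta>" r] by auto
    define w where "w t = of_real r * (1 + of_real \<delta> * circ t)" for t
    have w1: "cmod (w t) < 1" for t
    proof -
      have "cmod (w t) \<le> r * (1 + \<delta>)"
        unfolding w_def norm_mult using r \<delta> norm_one_plus_circ_le[of \<delta> t] by (intro mult_mono) auto
      then show ?thesis using r by linarith
    qed
    have contw: "continuous_on A w" for A unfolding w_def by (intro continuous_intros)
    define a where "a \<theta> = F (of_real r * circ \<theta>)" for \<theta>
    define b where "b t \<theta> = F (w t * circ \<theta>) - a \<theta>" for t \<theta>
    have a: "continuous_on {0..1} a"
      unfolding a_def using r r1 by (intro continuous_on_disc_compose[OF contF] continuous_intros) (auto simp: norm_mult)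
    have ap: "Lp_int p a = pmean p F (of_real r)" by (simp add: a_def[abs_def] pmean_eq_Lp_int)
    obtain k where k: "continuous_on {0..1} k"
      "\<And>b. continuous_on {0..1} b \<Longrightarrow>
        Lp_int p a powr (q / p) + integral {0..1} (\<lambda>t. Re (k t * b t)) \<le> Lp_int p (\<lambda>t. a t + b t) powr (q / p)"
      "\<And>b. continuous_on {0..1} b \<Longrightarrow>
        Lp_int p (\<lambda>t. a t + b t) powr (q / p) \<le>
        Lp_int p a powr (q / p) + integral {0..1} (\<lambda>t. Re (k t * b t)) + C * Lp_int p b powr (q / p)"
      using C(2)[OF a] unfolding Lp_expansion_def Let_def by blast
    have b: "continuous_on {0..1} (b t)" for t
      unfolding b_def using w1[of t]
      by (intro continuous_on_diff a continuous_on_disc_compose[OF contF] continuous_intros) (auto simp: norm_mult)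
    have bp: "Lp_int p (\<lambda>\<theta>. a \<theta> + b t \<theta>) = pmean p F (w t)" for t
      by (simp add: b_def pmean_eq_Lp_int)
    define L where "L t = integral {0..1} (\<lambda>\<theta>. Re (k \<theta> * b t \<theta>))" for t
    have cont2: "continuous_on ({0..1} \<times> {0..1}) (\<lambda>x. Re (k (snd x) * b (fst x) (snd x)))"
      unfolding b_def using w1
      by (intro continuous_on_Re continuous_on_mult continuous_on_compose2[OF k(1)] continuous_on_diff
          continuous_on_compose2[OF a] continuous_on_disc_compose[OF contF] continuous_on_circ
          continuous_on_compose2[OF contw[of UNIV]] continuous_on_snd continuous_on_fst continuous_on_id)
        (auto simp: norm_mult)
    have contL: "continuous_on {0..1} L"
      unfolding L_def by (rule continuous_on_integral_Icc[OF cont2])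
    have L0: "integral {0..1} L = 0"
    proof -
      have "integral {0..1} L = integral {0..1} (\<lambda>\<theta>. integral {0..1} (\<lambda>t. Re (k \<theta> * b t \<theta>)))"
        unfolding L_def by (rule integral_swap_Icc[OF cont2])
      also have "\<dots> = integral {0..1} (\<lambda>\<theta>::real. 0::real)"
      proof (rule integral_cong)
        fix \<theta> :: real
        define z where "z = of_real r * circ \<theta>"
        \<comment> \<open>Any radius larger than \<open>\<delta>\<close> with
          \<open>r * (1 + \<delta>') \<le> 1\<close> would do; this one also covers
          \<open>r = 0\<close>.\<close>
        define \<delta>' where "\<delta>' = \<delta> + (1 - r * (1 + \<delta>))"
        have "(\<lambda>u. F (z * u)) holomorphic_on ball 1 \<delta>'"
        proof (rule holomorphic_on_compose_gen[OF _ hol, unfolded o_def])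
          show "(\<lambda>u. z * u) ` ball 1 \<delta>' \<subseteq> ball 0 1"
          proof (clarsimp simp: z_def norm_mult dist_norm)
            fix u assume "cmod (1 - u) < \<delta>'"
            then have u: "cmod u < 1 + \<delta>'" using norm_triangle_ineq2[of u 1] by (simp add: norm_minus_commute)
            show "\<bar>r\<bar> * cmod u < 1"
            proof (cases "r = 0")
              case False
              then have "r * cmod u < r * (1 + \<delta>')" using u r by (intro mult_strict_left_mono) auto
              also have "r * (1 + \<delta>') = r * (1 + \<delta>) + r * (1 - r * (1 + \<delta>))" by (simp add: \<delta>'_def algebra_simps)
              also have "\<dots> \<le> r * (1 + \<delta>) + 1 * (1 - r * (1 + \<delta>))" using r r1 by (intro add_left_mono mult_right_mono) auto
              finally show ?thesis using r by simp
            qed simp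
          qed
        qed (intro holomorphic_intros)
        from mean_value_circ[OF this, of \<delta>] \<delta> r
        have mv: "((\<lambda>t. F (w t * circ \<theta>)) has_integral F z) {0..1}"
          by (simp add: \<delta>'_def z_def w_def mult_ac)
        have "((\<lambda>t. k \<theta> * (F (w t * circ \<theta>) - F z)) has_integral k \<theta> * (F z - F z)) {0..1}"
          using has_integral_const_real[of "F z" 0 1] by (intro has_integral_mult_right has_integral_diff mv) auto
        then have "((\<lambda>t. Re (k \<theta> * b t \<theta>)) has_integral Re (k \<theta> * (F z - F z))) {0..1}"
          unfolding b_def a_def z_def by (rule has_integral_Re)
        then show "integral {0..1} (\<lambda>t. Re (k \<theta> * b t \<theta>)) = 0" by (simp add: integral_unique)
      qed
      finally show ?thesis by simp
    qed
    define P where "P t = pmean p F (w t) powr (q / p)" for t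
    have contP: "continuous_on {0..1} P"
      unfolding P_def using q p w1 pmean_nonneg
      by (intro continuous_on_powr' continuous_on_pmean[OF contF] contw continuous_intros) auto
    define A where "A = pmean p F (of_real r) powr (q / p)"
    have intA: "integral {0..1} (\<lambda>t. A + L t + c) = A + c" for c
    proof -
      have "((\<lambda>t. A + L t + c) has_integral (A + 0 + c)) {0..1}"
        using has_integral_const_real[of A 0 1] has_integral_const_real[of c 0 1]
          integrable_integral[OF integrable_continuous_interval[OF contL]] L0
        by (intro has_integral_add) auto
      then show ?thesis by (simp add: integral_unique)
    qed
    have "A + L t + 0 \<le> P t" for t
      using k(2)[OF b] unfolding ap bp by (simp add: A_def L_def P_def)
    then have "integral {0..1} (\<lambda>t. A + L t + 0) \<le> integral {0..1} P"
      by (intro integral_le integrable_continuous_interval contP continuous_on_add continuous_on_const contL) auto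
    then show "pmean p F (of_real r) powr (q / p) \<le> integral {0..1} (\<lambda>t. pmean p F (of_real r * (1 + of_real \<delta> * circ t)) powr (q / p))"
      unfolding intA unfolding P_def A_def w_def by simp
    fix N :: real assume N: "N \<ge> 0" and bound: "\<forall>w. cmod w \<le> r * (1 + \<delta>) \<longrightarrow> pmean p (deriv F) w \<le> N powr p"
    have "P t \<le> A + L t + C * (\<delta> * N) powr q" for t
    proof -
      have "Lp_int p (b t) \<le> (\<delta> * N) powr p"
        unfolding b_def w_def a_def using p by (intro Lp_int_difference_le hol \<delta> r N bound[rule_format]) auto
      then have "Lp_int p (b t) powr (q / p) \<le> ((\<delta> * N) powr p) powr (q / p)"
        using q Lp_int_nonneg by (intro powr_mono2) auto
      also have "\<dots> = (\<delta> * N) powr q" using p by (simp add: powr_powr)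
      finally have "C * Lp_int p (b t) powr (q / p) \<le> C * (\<delta> * N) powr q"
        using C by (intro mult_left_mono) auto
      then show ?thesis using k(3)[OF b[of t]] unfolding ap bp by (simp add: A_def L_def P_def)
    qed
    then have "integral {0..1} P \<le> integral {0..1} (\<lambda>t. A + L t + C * (\<delta> * N) powr q)"
      by (intro integral_le integrable_continuous_interval contP continuous_on_add continuous_on_const contL) auto
    then show "integral {0..1} (\<lambda>t. pmean p F (of_real r * (1 + of_real \<delta> * circ t)) powr (q / p)) \<le>
      pmean p F (of_real r) powr (q / p) + C * (\<delta> * N) powr q"
      unfolding intA unfolding P_def A_def w_def by simp
  qed
qed

section \<open>Convexity and growth of means of order greater than one\<close>

text \<open>In the variable \<open>s = ln r\<close>, passing from \<open>r\<close> to
  the modulus of \<open>r * (1 + \<delta> * circ t)\<close> is the translation by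
  this amount. As \<open>ln |z|\<close> is harmonic in the disc of radius 1 about 1, the
  translations average to 0.\<close>

definition log_shift :: "real \<Rightarrow> real \<Rightarrow> real" where
  "log_shift \<delta> t = ln (cmod (1 + of_real \<delta> * circ t))"

lemma norm_one_plus_circ_ge: "0 \<le> \<delta> \<Longrightarrow> 1 - \<delta> \<le> cmod (1 + of_real \<delta> * circ t)"
  using norm_triangle_ineq2[of 1 "- (of_real \<delta> * circ t)"] by (simp add: norm_mult)

lemma one_plus_circ_nonzero:
  assumes "0 < \<delta>" "\<delta> < 1" shows "1 + of_real \<delta> * circ t \<noteq> 0"
proof
  assume "1 + of_real \<delta> * circ t = 0"
  then show False using norm_one_plus_circ_ge[of \<delta> t] assms by simp
qed

lemma exp_log_shift:
  assumes "0 < \<delta>" "\<delta> < 1"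
  shows "exp (log_shift \<delta> t) = cmod (1 + of_real \<delta> * circ t)"
  using one_plus_circ_nonzero[OF assms] by (simp add: log_shift_def)

lemma continuous_on_log_shift:
  assumes "0 < \<delta>" "\<delta> < 1" shows "continuous_on A (log_shift \<delta>)"
  using one_plus_circ_nonzero[OF assms] unfolding log_shift_def by (intro continuous_intros) auto

lemma log_shift_le:
  assumes "0 < \<delta>" "\<delta> < 1" shows "log_shift \<delta> t \<le> \<delta>"
proof -
  have "log_shift \<delta> t \<le> ln (1 + \<delta>)"
    unfolding log_shift_def using norm_one_plus_circ_ge[of \<delta> t] norm_one_plus_circ_le[of \<delta> t] assms
    by (subst ln_le_cancel_iff) auto
  also have "\<dots> \<le> \<delta>" using assms by (intro ln_add_one_self_le_self) auto
  finally show ?thesis .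
qed

lemma log_shift_ge:
  assumes "0 < \<delta>" "\<delta> \<le> 1 / 2" shows "- (2 * \<delta>) \<le> log_shift \<delta> t"
proof -
  have "2 * \<delta>\<^sup>2 \<le> \<delta>" using assms mult_right_mono[of \<delta> "1/2" \<delta>] by (simp add: power2_eq_square)
  then have "- (2 * \<delta>) \<le> - \<delta> - 2 * \<delta>\<^sup>2" by simp
  also have "\<dots> \<le> ln (1 - \<delta>)" using assms by (intro ln_one_minus_pos_lower_bound) auto
  also have "\<dots> \<le> log_shift \<delta> t"
    unfolding log_shift_def using norm_one_plus_circ_ge[of \<delta> t] assms by (subst ln_le_cancel_iff) auto
  finally show ?thesis .
qed

lemma log_shift_ge_pos:
  assumes "0 < \<delta>" "\<delta> < 1" "0 \<le> t" "t \<le> 1 / 6" shows "\<delta> / 4 \<le> log_shift \<delta> t"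
proof -
  have "cos (pi / 3) \<le> cos (2 * pi * t)"
    using assms by (intro cos_monotone_0_pi_le) (auto simp: field_simps)
  then have "1 / 2 \<le> cos (2 * pi * t)" by (simp add: cos_60)
  then have "\<delta> * (1 / 2) \<le> \<delta> * cos (2 * pi * t)" using assms by (intro mult_left_mono) auto
  also have "1 + \<delta> * cos (2 * pi * t) = Re (1 + of_real \<delta> * circ t)" by (simp add: circ_def)
  then have "\<delta> * cos (2 * pi * t) \<le> cmod (1 + of_real \<delta> * circ t) - 1"
    using complex_Re_le_cmod[of "1 + of_real \<delta> * circ t"] by linarith
  finally have le: "1 + \<delta> / 2 \<le> cmod (1 + of_real \<delta> * circ t)" by simp
  have "\<delta> / 2 - (\<delta> / 2)\<^sup>2 \<le> ln (1 + \<delta> / 2)"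
    using assms by (intro ln_one_plus_pos_lower_bound) auto
  moreover have "(\<delta> / 2)\<^sup>2 \<le> \<delta> / 4" using assms mult_right_mono[of \<delta> 1 \<delta>] by (simp add: power2_eq_square)
  moreover have "ln (1 + \<delta> / 2) \<le> log_shift \<delta> t"
    unfolding log_shift_def using le assms by (subst ln_le_cancel_iff) auto
  ultimately show ?thesis by linarith
qed

lemma has_integral_log_shift:
  assumes "0 < \<delta>" "\<delta> < 1" shows "(log_shift \<delta> has_integral 0) {0..1}"
proof -
  have hol: "Ln holomorphic_on ball 1 1"
  proof (rule holomorphic_on_Ln)
    have "z \<notin> \<real>\<^sub>\<le>\<^sub>0" if "z \<in> ball 1 1" for z :: complex
      using that complex_Re_le_cmod[of "1 - z"] by (simp add: complex_nonpos_Reals_iff dist_norm)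
    then show "ball 1 1 \<inter> \<real>\<^sub>\<le>\<^sub>0 = ({} :: complex set)" by blast
  qed
  have "((\<lambda>t. Re (Ln (1 + of_real \<delta> * circ t))) has_integral Re (Ln 1)) {0..1}"
    using assms by (intro has_integral_Re mean_value_circ[OF hol]) auto
  moreover have "Re (Ln (1 + of_real \<delta> * circ t)) = log_shift \<delta> t" for t
    using norm_one_plus_circ_ge[of \<delta> t] assms by (subst Re_Ln) (auto simp: log_shift_def)
  ultimately show ?thesis by simp
qed

lemma integral_ge_on_initial_segment:
  fixes f :: "real \<Rightarrow> real"
  assumes "continuous_on {0..1} f" "\<And>t. t \<in> {0..1} \<Longrightarrow> 0 \<le> f t" "\<And>t. 0 \<le> t \<Longrightarrow> t \<le> 1/6 \<Longrightarrow> c \<le> f t"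
  shows "c / 6 \<le> integral {0..1} f"
proof -
  have "integral {0..1/6::real} (\<lambda>t. c) \<le> integral {0..1/6} f"
    using assms by (intro integral_le integrable_continuous_interval continuous_on_subset[OF assms(1)]) auto
  also have "\<dots> \<le> integral {0..1} f"
    using assms by (intro integral_subset_le integrable_continuous_interval continuous_on_subset[OF assms(1)]) auto
  finally show ?thesis by simp
qed

text \<open>Hardy's convexity theorem by way of a maximum principle. If
  \<open>\<phi>\<close> exceeded one of its chords, then it would still do so after adding
  a small multiple of the parabola \<open>(s - a) * (s - b)\<close>, which vanishes
  at the endpoints. The difference to the chord would attain a positive maximum at an
  interior point \<open>c\<close>. Since the shifts have mean 0 and positive second
  moment, averaging over a small circle would add a positive amount to the value at
  \<open>c\<close>, although no value in the average exceeds it.\<close>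

lemma convex_on_if_log_shift_submean:
  assumes cont: "continuous_on {..<0} \<phi>"
    and sub: "\<And>s \<delta>. 0 < \<delta> \<Longrightarrow> \<delta> < 1 \<Longrightarrow> s + \<delta> < 0 \<Longrightarrow> \<phi> s \<le> integral {0..1} (\<lambda>t. \<phi> (s + log_shift \<delta> t))"
  shows "convex_on {..<0} \<phi>"
proof (rule convex_on_linorderI)
  fix t a b :: real assume t: "0 < t" "t < 1" and ab: "a \<in> {..<0}" "b \<in> {..<0}" "a < b"
  define m where "m = (\<phi> b - \<phi> a) / (b - a)"
  have below: "\<phi> s - (\<phi> a + m * (s - a)) + \<kappa> * ((s - a) * (s - b)) \<le> 0"
    if \<kappa>: "\<kappa> > 0" and s: "s \<in> {a..b}" for \<kappa> s
  proof -
    define \<psi> where "\<psi> s = \<phi> s - (\<phi> a + m * (s - a)) + \<kappa> * ((s - a) * (s - b))" for s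
    have contab: "continuous_on {a..b} \<phi>" using ab by (intro continuous_on_subset[OF cont]) auto
    then have "continuous_on {a..b} \<psi>" unfolding \<psi>_def by (intro continuous_intros)
    from continuous_attains_sup[OF compact_Icc _ this] ab
    obtain c where c: "c \<in> {a..b}" and max: "\<And>x. x \<in> {a..b} \<Longrightarrow> \<psi> x \<le> \<psi> c" by fastforce
    have "\<psi> c \<le> 0"
    proof (rule ccontr)
      assume pos: "\<not> \<psi> c \<le> 0"
      have "\<psi> a = 0" "\<psi> b = 0" using ab by (auto simp: \<psi>_def m_def)
      then have c_in: "a < c" "c < b" using pos c by (auto simp: less_le)
      \<comment> \<open>The shift lies between \<open>- 2 * \<delta>\<close> and
        \<open>\<delta>\<close>, so the averages stay inside of the interval.\<close>
      define \<delta> where "\<delta> = min (1 / 2) (min ((c - a) / 2) (b - c))"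
      have \<delta>: "0 < \<delta>" "\<delta> < 1" "\<delta> \<le> 1 / 2" "2 * \<delta> \<le> c - a" "\<delta> \<le> b - c" using c_in unfolding \<delta>_def by (auto simp: min_def)
      let ?X = "log_shift \<delta>"
      have X: "c + ?X t \<in> {a..b}" for t
        using log_shift_le[OF \<delta>(1,2), of t] log_shift_ge[OF \<delta>(1,3), of t] \<delta> by auto
      have contX: "continuous_on {0..1} ?X" by (rule continuous_on_log_shift[OF \<delta>(1,2)])
      have cont1: "continuous_on {0..1} (\<lambda>t. \<phi> (c + ?X t))"
        using X by (intro continuous_on_compose2[OF contab] continuous_intros contX) auto
      define J where "J = integral {0..1} (\<lambda>t. (?X t)\<^sup>2)"
      have "(\<delta> / 4)\<^sup>2 / 6 \<le> J"
        unfolding J_def using log_shift_ge_pos[OF \<delta>(1,2)] \<delta>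
        by (intro integral_ge_on_initial_segment continuous_intros contX power_mono) auto
      then have J: "J > 0" using \<delta> by (smt (verit) divide_pos_pos zero_less_power)
      have intJ: "((\<lambda>t. (?X t)\<^sup>2) has_integral J) {0..1}"
        unfolding J_def by (intro integrable_integral integrable_continuous_interval continuous_intros contX)
      have const: "((\<lambda>t. x) has_integral x) {0..1::real}" for x :: real
        using has_integral_const_real[of x 0 1] by simp
      have "((\<lambda>t. \<phi> (c + ?X t) + (\<kappa> * ((c - a) * (c - b)) - (\<phi> a + m * (c - a))) +
          ((\<kappa> * (2 * c - a - b) - m) * ?X t) + \<kappa> * (?X t)\<^sup>2) has_integral
          integral {0..1} (\<lambda>t. \<phi> (c + ?X t)) + (\<kappa> * ((c - a) * (c - b)) - (\<phi> a + m * (c - a))) +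
          ((\<kappa> * (2 * c - a - b) - m) * 0) + \<kappa> * J) {0..1}"
        by (intro has_integral_add has_integral_mult_right has_integral_log_shift[OF \<delta>(1,2)] intJ const
            integrable_integral integrable_continuous_interval cont1)
      moreover have "\<phi> (c + ?X t) + (\<kappa> * ((c - a) * (c - b)) - (\<phi> a + m * (c - a))) +
          ((\<kappa> * (2 * c - a - b) - m) * ?X t) + \<kappa> * (?X t)\<^sup>2 = \<psi> (c + ?X t)" for t
        by (simp add: \<psi>_def power2_eq_square algebra_simps)
      ultimately have "((\<lambda>t. \<psi> (c + ?X t)) has_integral
          integral {0..1} (\<lambda>t. \<phi> (c + ?X t)) + (\<kappa> * ((c - a) * (c - b)) - (\<phi> a + m * (c - a))) + \<kappa> * J) {0..1}"
        by simp
      from has_integral_le[OF this const[of "\<psi> c"]] max X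
      have "integral {0..1} (\<lambda>t. \<phi> (c + ?X t)) + (\<kappa> * ((c - a) * (c - b)) - (\<phi> a + m * (c - a))) + \<kappa> * J \<le> \<psi> c"
        by blast
      moreover have "\<phi> c \<le> integral {0..1} (\<lambda>t. \<phi> (c + ?X t))"
        using \<delta> ab by (intro sub) auto
      moreover have "\<kappa> * J > 0" using \<kappa> J by simp
      ultimately show False unfolding \<psi>_def by linarith
    qed
    then show ?thesis using max[OF s] by (simp add: \<psi>_def)
  qed
  define s where "s = (1 - t) * a + t * b"
  have s: "s \<in> {a..b}"
  proof -
    have "s = a + t * (b - a)" "s = b - (1 - t) * (b - a)" by (auto simp: s_def algebra_simps)
    moreover have "0 \<le> t * (b - a)" "0 \<le> (1 - t) * (b - a)" using t ab by auto
    ultimately show ?thesis by auto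
  qed
  have "\<phi> s - (\<phi> a + m * (s - a)) \<le> 0"
  proof -
    have "((\<lambda>\<kappa>. \<phi> s - (\<phi> a + m * (s - a)) + \<kappa> * ((s - a) * (s - b))) \<longlongrightarrow>
        \<phi> s - (\<phi> a + m * (s - a)) + 0 * ((s - a) * (s - b))) (at_right 0)"
      by (intro tendsto_intros)
    moreover have "\<forall>\<^sub>F \<kappa> in at_right 0. \<phi> s - (\<phi> a + m * (s - a)) + \<kappa> * ((s - a) * (s - b)) \<le> 0"
      unfolding eventually_at_right_field using below s by (intro exI[of _ 1]) auto
    ultimately have "\<phi> s - (\<phi> a + m * (s - a)) + 0 * ((s - a) * (s - b)) \<le> 0"
      by (rule tendsto_upperbound) simp
    then show ?thesis by simp
  qed
  moreover have "m * (s - a) = t * (\<phi> b - \<phi> a)"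
  proof -
    have "s - a = t * (b - a)" by (simp add: s_def algebra_simps)
    then show ?thesis using ab by (simp add: m_def)
  qed
  ultimately have "\<phi> s \<le> (1 - t) * \<phi> a + t * \<phi> b" by (simp add: algebra_simps)
  then show "\<phi> ((1 - t) *\<^sub>R a + t *\<^sub>R b) \<le> (1 - t) * \<phi> a + t * \<phi> b" by (simp add: s_def)
qed simp

text \<open>A convex function lies above its support lines at \<open>s\<close> and at
  \<open>s + \<delta> / 8\<close>. The average of these bounds exceeds
  \<open>\<phi> s\<close> by the increase of slope times the mean of the part of the
  shift beyond \<open>\<delta> / 8\<close>; the shift is at least
  \<open>\<delta> / 4\<close> on a sixth of the circle. So an upper bound for circle
  averages limits the increase of slope.\<close>

lemma subgradient_increment:
  assumes cont: "continuous_on {..<0} \<phi>" and \<delta>: "0 < \<delta>" "\<delta> < 1" "s + \<delta> < 0"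
    and m: "\<And>y. y < 0 \<Longrightarrow> \<phi> s + m * (y - s) \<le> \<phi> y"
    and m': "\<And>y. y < 0 \<Longrightarrow> \<phi> (s + \<delta> / 8) + m' * (y - (s + \<delta> / 8)) \<le> \<phi> y"
    and E: "integral {0..1} (\<lambda>t. \<phi> (s + log_shift \<delta> t)) \<le> \<phi> s + E"
  shows "m \<le> m'" "(m' - m) * \<delta> \<le> 48 * E"
proof -
  have neg: "s < 0" "s + \<delta> / 8 < 0" using \<delta> by auto
  have "m * (\<delta> / 8) \<le> m' * (\<delta> / 8)" using m[OF neg(2)] m'[OF neg(1)] by simp
  then show mm: "m \<le> m'" using \<delta> by simp
  let ?X = "log_shift \<delta>"
  have X: "s + ?X t < 0" for t using log_shift_le[OF \<delta>(1,2), of t] \<delta> by linarith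
  have contX: "continuous_on {0..1} ?X" by (rule continuous_on_log_shift[OF \<delta>(1,2)])
  have cont1: "continuous_on {0..1} (\<lambda>t. \<phi> (s + ?X t))"
    using X by (intro continuous_on_compose2[OF cont] continuous_intros contX) auto
  define J where "J = integral {0..1} (\<lambda>t. max 0 (?X t - \<delta> / 8))"
  have contJ: "continuous_on {0..1} (\<lambda>t. max 0 (?X t - \<delta> / 8))" by (intro continuous_intros contX)
  have "(\<delta> / 8) / 6 \<le> J"
    unfolding J_def
  proof (rule integral_ge_on_initial_segment[OF contJ])
    fix t :: real assume "0 \<le> t" "t \<le> 1 / 6"
    then show "\<delta> / 8 \<le> max 0 (?X t - \<delta> / 8)" using log_shift_ge_pos[OF \<delta>(1,2), of t] by (auto simp: max_def)
  qed simp
  then have J: "(m' - m) * (\<delta> / 48) \<le> (m' - m) * J" using mm by (intro mult_left_mono) auto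
  have const: "((\<lambda>t. x) has_integral x) {0..1::real}" for x :: real
    using has_integral_const_real[of x 0 1] by simp
  have int: "((\<lambda>t. \<phi> s + m * ?X t + (m' - m) * max 0 (?X t - \<delta> / 8)) has_integral \<phi> s + m * 0 + (m' - m) * J) {0..1}"
    unfolding J_def
    by (intro has_integral_add has_integral_mult_right const has_integral_log_shift[OF \<delta>(1,2)]
        integrable_integral integrable_continuous_interval contJ)
  have pt: "\<phi> s + m * x + (m' - m) * max 0 (x - \<delta> / 8) \<le> \<phi> (s + x)" if "s + x < 0" for x
  proof (cases "x \<le> \<delta> / 8")
    case True
    then show ?thesis using m[OF that] by (simp add: max_def)
  next
    case False
    have "\<phi> s + m * (\<delta> / 8) \<le> \<phi> (s + \<delta> / 8)" using m[OF neg(2)] by simp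
    moreover have "\<phi> (s + \<delta> / 8) + m' * (x - \<delta> / 8) \<le> \<phi> (s + x)" using m'[OF that] by simp
    moreover have "m * x + (m' - m) * (x - \<delta> / 8) = m * (\<delta> / 8) + m' * (x - \<delta> / 8)"
      by (simp add: field_simps)
    moreover have "max 0 (x - \<delta> / 8) = x - \<delta> / 8" using False by simp
    ultimately show ?thesis by simp
  qed
  have "\<phi> s + m * 0 + (m' - m) * J \<le> integral {0..1} (\<lambda>t. \<phi> (s + ?X t))"
    using pt X by (intro has_integral_le[OF int integrable_integral[OF integrable_continuous_interval[OF cont1]]]) auto
  then show "(m' - m) * \<delta> \<le> 48 * E" using E J by simp
qed

text \<open>For a fixed endpoint \<open>S = ln r\<close> the slopes are followed along
  points \<open>s j\<close> whose distance \<open>\<tau> j\<close> to \<open>S\<close>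
  decreases geometrically, with circles of radius \<open>\<tau> j / 2\<close>, so that
  the bound enters at radii \<open>\<rho> j\<close> well inside of \<open>r\<close>. The
  value at \<open>S\<close> of the support line at \<open>s j\<close> grows in step
  \<open>j\<close> by at most the increase of slope times \<open>\<tau> j\<close>, that
  is by a multiple of \<open>(\<delta> j * \<eta> (\<rho> j))^q\<close>. As
  \<open>\<eta>\<close> is monotone, this is bounded by the integral over the next
  interval \<open>{\<rho> j..\<rho> (Suc j)}\<close>. The sum of these integrals is at
  most the integral over \<open>{0..r}\<close>.\<close>

lemma convex_mean_growth:
  fixes \<phi> \<eta> :: "real \<Rightarrow> real" and q C :: real
  assumes conv: "convex_on {..<0} \<phi>" and cont: "continuous_on {..<0} \<phi>" and q: "q \<ge> 1" and C: "C \<ge> 0"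
    and \<eta>: "continuous_on {0..<1} \<eta>" "mono_on {0..<1} \<eta>" "\<And>\<rho>. \<rho> \<in> {0..<1} \<Longrightarrow> 0 \<le> \<eta> \<rho>"
    and E: "\<And>s \<delta>. 0 < \<delta> \<Longrightarrow> \<delta> < 1 \<Longrightarrow> s + \<delta> < 0 \<Longrightarrow>
      integral {0..1} (\<lambda>t. \<phi> (s + log_shift \<delta> t)) \<le> \<phi> s + C * (\<delta> * \<eta> (exp (s + \<delta>))) powr q"
  shows "\<exists>D. \<forall>r. 1 / 2 < r \<longrightarrow> r < 1 \<longrightarrow>
    \<phi> (ln r) \<le> D + 96 * C * 64 powr q * integral {0..r} (\<lambda>\<rho>. (1 - \<rho>) powr (q - 1) * \<eta> \<rho> powr q)"
proof -
  define m where "m s = Inf ((\<lambda>t. (\<phi> s - \<phi> t) / (s - t)) ` ({s<..} \<inter> {..<0}))" for s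
  have m: "\<phi> s + m s * (y - s) \<le> \<phi> y" if "s < 0" "y < 0" for s y
    unfolding m_def using that convex_le_Inf_differential[OF conv, of s y] by (simp add: interior_open)
  \<comment> \<open>The starting point is independent of \<open>r\<close>, so that value
    and slope there enter only into the constant.\<close>
  define s0 :: real where "s0 = ln (1 / 2)"
  define w where "w \<rho> = (1 - \<rho>) powr (q - 1) * \<eta> \<rho> powr q" for \<rho>
  have w0: "0 \<le> w \<rho>" for \<rho> by (simp add: w_def)
  have contw: "w integrable_on {a..b}" if "0 \<le> a" "b < 1" for a b
  proof -
    have "continuous_on {a..b} (\<lambda>\<rho>. (1 - \<rho>) powr (q - 1))"
      using that by (intro continuous_on_powr continuous_intros) auto
    moreover have "continuous_on {a..b} (\<lambda>\<rho>. \<eta> \<rho> powr q)"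
      using that q \<eta>(3) by (intro continuous_on_powr' continuous_on_subset[OF \<eta>(1)] continuous_intros) auto
    ultimately show ?thesis unfolding w_def by (intro integrable_continuous_interval continuous_on_mult)
  qed
  show ?thesis
  proof (intro exI allI impI)
    fix r :: real assume r: "1 / 2 < r" "r < 1"
    define S where "S = ln r"
    define \<tau>0 where "\<tau>0 = S - s0"
    have S: "S < 0" using r by (simp add: S_def)
    have \<tau>0: "0 < \<tau>0" "\<tau>0 < 1"
    proof -
      show "0 < \<tau>0" using r by (simp add: \<tau>0_def S_def s0_def)
      have "ln r < 0" using r by simp
      then show "\<tau>0 < 1" using ln2_le_25_over_36 by (simp add: \<tau>0_def S_def s0_def ln_div)
    qed
    \<comment> \<open>With circles of radius \<open>\<tau> j / 2\<close> the slope is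
      compared at distance \<open>\<tau> j / 16\<close>, whence the ratio 15/16.\<close>
    define \<tau> where "\<tau> j = \<tau>0 * (15/16) ^ j" for j :: nat
    define s where "s j = S - \<tau> j" for j
    define \<delta> where "\<delta> j = \<tau> j / 2" for j
    define \<rho> where "\<rho> j = r * exp (- \<delta> j)" for j
    have \<tau>: "0 < \<tau> j" "\<tau> j \<le> \<tau>0" "\<tau> (Suc j) = 15 / 16 * \<tau> j" for j
      using \<tau>0 mult_left_mono[OF power_le_one[of "15/16::real" j], of \<tau>0] by (auto simp: \<tau>_def)
    have \<delta>: "0 < \<delta> j" "\<delta> j < 1" "s j + \<delta> j < 0" "\<delta> (Suc j) = 15 / 16 * \<delta> j" "\<delta> j < 1 / 2" "s j < 0" for j
      using \<tau>[of j] \<tau>[of "Suc j"] \<tau>0 S by (auto simp: \<delta>_def s_def)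
    have sS: "s (Suc j) = s j + \<delta> j / 8" for j by (simp add: s_def \<delta>_def \<tau>)
    have exp_s: "exp (s j + \<delta> j) = \<rho> j" for j
    proof -
      have "s j + \<delta> j = S + - \<delta> j" by (simp add: s_def \<delta>_def)
      then show ?thesis using r by (simp only: exp_add \<rho>_def S_def exp_ln)
    qed
    have \<rho>_half: "1 / 2 \<le> \<rho> j" for j
    proof -
      have "exp s0 \<le> exp (s j + \<delta> j)" using \<tau>[of j] by (simp add: s_def \<tau>0_def \<delta>_def)
      then show ?thesis unfolding exp_s by (simp add: s0_def)
    qed
    have \<rho>_less: "\<rho> j < 1" for j
      using \<delta>(3)[of j] exp_s[of j] by (metis exp_less_one_iff)
    have \<rho>_step: "\<delta> j / 32 / 2 \<le> \<rho> (Suc j) - \<rho> j" for j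
    proof -
      have eq: "\<rho> (Suc j) = \<rho> j * exp (\<delta> j / 16)"
        unfolding \<rho>_def mult.assoc exp_add[symmetric] using \<delta>(4)[of j] by simp
      have "\<delta> j / 16 \<le> exp (\<delta> j / 16) - 1" using exp_ge_add_one_self[of "\<delta> j / 16"] by linarith
      then have "1 / 2 * (\<delta> j / 16) \<le> \<rho> j * (exp (\<delta> j / 16) - 1)"
        using \<rho>_half[of j] \<delta>(1)[of j] by (intro mult_mono) auto
      then show ?thesis unfolding eq using \<delta>(1)[of j] by (simp add: right_diff_distrib)
    qed
    have one_minus: "\<delta> j / 8 \<le> 1 - \<rho> (Suc j)" for j
    proof -
      have "exp (- \<delta> (Suc j)) \<le> 1 - \<delta> (Suc j) / 2"
      proof -
        have "exp (- \<delta> (Suc j)) = 1 / exp (\<delta> (Suc j))" by (simp add: exp_minus inverse_eq_divide)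
        also have "\<dots> \<le> 1 / (1 + \<delta> (Suc j))"
          using exp_ge_add_one_self[of "\<delta> (Suc j)"] \<delta>(1)[of "Suc j"] by (intro divide_left_mono mult_pos_pos) auto
        also have "\<dots> \<le> 1 - \<delta> (Suc j) / 2"
        proof -
          have "\<delta> (Suc j) * \<delta> (Suc j) \<le> \<delta> (Suc j) * 1" using \<delta>(1,2)[of "Suc j"] by (intro mult_left_mono) auto
          then have "1 \<le> (1 - \<delta> (Suc j) / 2) * (1 + \<delta> (Suc j))" by (simp add: algebra_simps)
          then show ?thesis using \<delta>(1)[of "Suc j"] by (simp add: divide_le_eq)
        qed
        finally show ?thesis .
      qed
      then have "\<rho> (Suc j) \<le> 1 - \<delta> (Suc j) / 2"
        unfolding \<rho>_def using r mult_right_mono[OF less_imp_le[OF r(2)] exp_ge_zero, of "- \<delta> (Suc j)"] by linarith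
      then show ?thesis using \<delta>(4)[of j] \<delta>(1)[of j] by simp
    qed
    have int_ge: "(\<delta> j * \<eta> (\<rho> j)) powr q \<le> 64 powr q * integral {\<rho> j..\<rho> (Suc j)} w" for j
    proof -
      have \<rho>01: "\<rho> j \<in> {0..<1}" using \<rho>_half[of j] \<rho>_less[of j] by auto
      have "(\<delta> j / 64) powr q * \<eta> (\<rho> j) powr q = (\<delta> j / 64) * ((\<delta> j / 64) powr (q - 1) * \<eta> (\<rho> j) powr q)"
        using \<delta>(1)[of j] by (simp add: powr_diff)
      also have "\<dots> \<le> (\<rho> (Suc j) - \<rho> j) * ((\<delta> j / 8) powr (q - 1) * \<eta> (\<rho> j) powr q)"
        using \<rho>_step[of j] \<delta>(1)[of j] q by (intro mult_mono mult_right_mono powr_mono2) auto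
      also have "\<dots> = integral {\<rho> j..\<rho> (Suc j)} (\<lambda>x. (\<delta> j / 8) powr (q - 1) * \<eta> (\<rho> j) powr q)"
        using \<rho>_step[of j] \<delta>(1)[of j] by simp
      also have "\<dots> \<le> integral {\<rho> j..\<rho> (Suc j)} w"
      proof (intro integral_le contw)
        fix x assume x: "x \<in> {\<rho> j..\<rho> (Suc j)}"
        have "\<eta> (\<rho> j) \<le> \<eta> x"
          using x \<rho>01 \<rho>_less[of "Suc j"] by (intro mono_onD[OF \<eta>(2)]) auto
        then show "(\<delta> j / 8) powr (q - 1) * \<eta> (\<rho> j) powr q \<le> w x"
          unfolding w_def using x one_minus[of j] \<delta>(1)[of j] q \<eta>(3)[OF \<rho>01]
          by (intro mult_mono powr_mono2) auto
      qed (use \<rho>01 \<rho>_less in auto)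
      finally have "64 powr q * ((\<delta> j / 64) powr q * \<eta> (\<rho> j) powr q) \<le> 64 powr q * integral {\<rho> j..\<rho> (Suc j)} w"
        by (intro mult_left_mono) auto
      then show ?thesis using \<delta>(1)[of j] \<eta>(3)[OF \<rho>01] by (simp add: powr_divide powr_mult)
    qed
    define K where "K = 96 * C * 64 powr q"
    have K: "K \<ge> 0" using C by (simp add: K_def)
    have slope: "m (s j) \<le> m (s (Suc j)) \<and> (m (s (Suc j)) - m (s j)) * \<tau> j \<le> K * integral {\<rho> j..\<rho> (Suc j)} w" for j
    proof -
      have "m (s j) \<le> m (s (Suc j))" "(m (s (Suc j)) - m (s j)) * \<delta> j \<le> 48 * (C * (\<delta> j * \<eta> (exp (s j + \<delta> j))) powr q)"
        using subgradient_increment[OF cont \<delta>(1-3)[of j] m[OF \<delta>(6)[of j]] _ E[OF \<delta>(1-3)[of j]], of "m (s (Suc j))"]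
          m[OF \<delta>(6)[of "Suc j"]] unfolding sS by auto
      moreover have "C * (\<delta> j * \<eta> (\<rho> j)) powr q \<le> C * (64 powr q * integral {\<rho> j..\<rho> (Suc j)} w)"
        using int_ge C by (intro mult_left_mono)
      ultimately show ?thesis unfolding exp_s by (simp add: \<delta>_def K_def)
    qed
    have m_mono: "m (s 0) \<le> m (s j)" for j
      by (induction j) (use slope in \<open>auto intro: order_trans\<close>)
    have ind: "\<rho> 0 \<le> \<rho> j \<and> \<phi> (s j) + m (s j) * \<tau> j \<le> \<phi> (s 0) + m (s 0) * \<tau> 0 + K * integral {\<rho> 0..\<rho> j} w" for j
    proof (induction j)
      case (Suc j)
      have "\<phi> (s (Suc j)) + m (s (Suc j)) * (s j - s (Suc j)) \<le> \<phi> (s j)"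
        by (rule m[OF \<delta>(6) \<delta>(6)])
      then have "\<phi> (s (Suc j)) + m (s (Suc j)) * \<tau> (Suc j) \<le> \<phi> (s j) + m (s j) * \<tau> j + (m (s (Suc j)) - m (s j)) * \<tau> j"
        by (simp add: s_def algebra_simps)
      also have "\<dots> \<le> \<phi> (s 0) + m (s 0) * \<tau> 0 + K * integral {\<rho> 0..\<rho> j} w + K * integral {\<rho> j..\<rho> (Suc j)} w"
        using Suc slope[of j] by linarith
      also have "\<dots> = \<phi> (s 0) + m (s 0) * \<tau> 0 + K * (integral {\<rho> 0..\<rho> j} w + integral {\<rho> j..\<rho> (Suc j)} w)"
        by (simp add: distrib_left)
      also have "integral {\<rho> 0..\<rho> j} w + integral {\<rho> j..\<rho> (Suc j)} w = integral {\<rho> 0..\<rho> (Suc j)} w"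
        using Suc \<rho>_step[of j] \<delta>(1)[of j] \<rho>_half[of 0] \<rho>_less[of "Suc j"]
        by (intro Henstock_Kurzweil_Integration.integral_combine contw) auto
      finally show ?case using Suc \<rho>_step[of j] \<delta>(1)[of j] by auto
    qed simp
    have s0: "s 0 = s0" by (simp add: s_def \<tau>_def \<tau>0_def)
    have le: "\<phi> (s j) \<le> \<phi> s0 + \<bar>m s0\<bar> + K * integral {0..r} w" for j
    proof -
      have "integral {\<rho> 0..\<rho> j} w \<le> integral {0..r} w"
      proof (intro integral_subset_le contw w0)
        have "\<rho> j \<le> r" using r \<delta>(1)[of j] mult_left_mono[of "exp (- \<delta> j)" 1 r] by (simp add: \<rho>_def)
        then show "{\<rho> 0..\<rho> j} \<subseteq> {0..r}" using \<rho>_half[of 0] by auto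
      qed (use r \<rho>_half[of 0] \<rho>_less w0 in auto)
      then have "K * integral {\<rho> 0..\<rho> j} w \<le> K * integral {0..r} w" using K by (intro mult_left_mono)
      moreover have "m s0 * \<tau> j \<le> m (s j) * \<tau> j"
        using m_mono[of j] \<tau>(1)[of j] unfolding s0 by (intro mult_right_mono) auto
      moreover have "m s0 * \<tau> 0 - m s0 * \<tau> j \<le> \<bar>m s0\<bar>"
      proof -
        have "m s0 * (\<tau> 0 - \<tau> j) \<le> \<bar>m s0\<bar> * 1"
        proof (intro mult_mono)
          have "\<tau> 0 = \<tau>0" by (simp add: \<tau>_def)
          then show "\<tau> 0 - \<tau> j \<le> 1" "0 \<le> \<tau> 0 - \<tau> j" using \<tau>(1,2)[of j] \<tau>0 by linarith+
        qed auto
        then show ?thesis by (simp add: right_diff_distrib)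
      qed
      ultimately show ?thesis using ind[of j] unfolding s0 by linarith
    qed
    have "s \<longlonglongrightarrow> S - \<tau>0 * 0"
      unfolding s_def \<tau>_def by (intro tendsto_intros LIMSEQ_power_zero) auto
    then have "s \<longlonglongrightarrow> S" by simp
    moreover have "isCont \<phi> S" using cont S by (simp add: continuous_on_eq_continuous_at)
    ultimately have "(\<lambda>j. \<phi> (s j)) \<longlonglongrightarrow> \<phi> S" by (rule isCont_tendsto_compose[rotated])
    then have "\<phi> S \<le> \<phi> s0 + \<bar>m s0\<bar> + K * integral {0..r} w"
      using le by (intro LIMSEQ_le_const2) auto
    then show "\<phi> (ln r) \<le> (\<phi> s0 + \<bar>m s0\<bar>) + 96 * C * 64 powr q * integral {0..r} (\<lambda>\<rho>. (1 - \<rho>) powr (q - 1) * \<eta> \<rho> powr q)"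
      by (simp add: S_def K_def w_def[abs_def])
  qed
qed

text \<open>The growth estimate for \<open>p > 1\<close>, applied to
  \<open>\<phi> s = M^q\<close>, where \<open>M\<close> is the mean of \<open>F\<close>
  of order \<open>p\<close> at radius \<open>exp s\<close>: the lower half of
  \<open>pmean_two_sided\<close> makes \<open>\<phi>\<close> convex, the upper half bounds
  its circle averages.\<close>

lemma pmean_growth:
  fixes p N :: real and \<eta> :: "real \<Rightarrow> real"
  assumes p: "p > 1" and hol: "F holomorphic_on ball 0 1" and N: "N \<ge> 0"
    and \<eta>: "continuous_on {0..<1} \<eta>" "mono_on {0..<1} \<eta>" "\<And>\<rho>. \<rho> \<in> {0..<1} \<Longrightarrow> 0 \<le> \<eta> \<rho>"
    and bound: "\<And>w. cmod w < 1 \<Longrightarrow> pmean p (deriv F) w \<le> (N * \<eta> (cmod w)) powr p"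
  defines "q \<equiv> min p 2"
  shows "\<exists>D K. 0 \<le> K \<and> (\<forall>r. 1 / 2 < r \<longrightarrow> r < 1 \<longrightarrow>
    pmean p F (of_real r) powr (q / p) \<le> D + K * integral {0..r} (\<lambda>\<rho>. (1 - \<rho>) powr (q - 1) * \<eta> \<rho> powr q))"
proof -
  obtain C where C: "C \<ge> 0" and two: "\<And>F (r::real) (\<delta>::real). F holomorphic_on ball 0 1 \<Longrightarrow> 0 \<le> \<delta> \<Longrightarrow> 0 \<le> r \<Longrightarrow> r * (1 + \<delta>) < 1 \<Longrightarrow>
    pmean p F (of_real r) powr (q / p) \<le> integral {0..1} (\<lambda>t. pmean p F (of_real r * (1 + of_real \<delta> * circ t)) powr (q / p)) \<and>
    (\<forall>N\<ge>0. (\<forall>w. cmod w \<le> r * (1 + \<delta>) \<longrightarrow> pmean p (deriv F) w \<le> N powr p) \<longrightarrow>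
      integral {0..1} (\<lambda>t. pmean p F (of_real r * (1 + of_real \<delta> * circ t)) powr (q / p)) \<le>
      pmean p F (of_real r) powr (q / p) + C * (\<delta> * N) powr q)"
    using pmean_two_sided[OF p] unfolding q_def by blast
  have q: "q \<ge> 1" "q / p > 0" using p by (auto simp: q_def)
  note contF = holomorphic_on_imp_continuous_on[OF hol]
  define \<phi> where "\<phi> s = pmean p F (of_real (exp s)) powr (q / p)" for s
  have cont: "continuous_on {..<0} \<phi>"
    unfolding \<phi>_def using q p pmean_nonneg
    by (intro continuous_on_powr' continuous_on_pmean[OF contF] continuous_intros) auto
  have prep: "exp s * (1 + \<delta>) \<le> exp (s + \<delta>)" "exp s * (1 + \<delta>) < 1" "exp (s + \<delta>) < 1"
     "integral {0..1} (\<lambda>t. pmean p F (of_real (exp s) * (1 + of_real \<delta> * circ t)) powr (q / p)) =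
      integral {0..1} (\<lambda>t. \<phi> (s + log_shift \<delta> t))"
    if "0 < \<delta>" "\<delta> < 1" "s + \<delta> < 0" for s \<delta>
  proof -
    show 1: "exp s * (1 + \<delta>) \<le> exp (s + \<delta>)" unfolding exp_add by (intro mult_left_mono exp_ge_add_one_self) auto
    show 2: "exp (s + \<delta>) < 1" using that by simp
    show 3: "exp s * (1 + \<delta>) < 1" using 1 2 by linarith
    show "integral {0..1} (\<lambda>t. pmean p F (of_real (exp s) * (1 + of_real \<delta> * circ t)) powr (q / p)) =
      integral {0..1} (\<lambda>t. \<phi> (s + log_shift \<delta> t))"
    proof (rule integral_cong)
      fix t :: real
      have n: "cmod (of_real (exp s) * (1 + of_real \<delta> * circ t)) = exp (s + log_shift \<delta> t)"
        using that by (simp add: norm_mult exp_add exp_log_shift)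
      moreover have "exp (s + log_shift \<delta> t) < 1" using log_shift_le[of \<delta> t] that by simp
      ultimately show "pmean p F (of_real (exp s) * (1 + of_real \<delta> * circ t)) powr (q / p) = \<phi> (s + log_shift \<delta> t)"
        unfolding \<phi>_def using p by (subst pmean_norm[OF contF]) auto
    qed
  qed
  have "convex_on {..<0} \<phi>"
  proof (rule convex_on_if_log_shift_submean[OF cont])
    fix s \<delta> :: real assume d: "0 < \<delta>" "\<delta> < 1" "s + \<delta> < 0"
    show "\<phi> s \<le> integral {0..1} (\<lambda>t. \<phi> (s + log_shift \<delta> t))"
      using two[OF hol, of \<delta> "exp s"] prep[OF d] d by (simp add: \<phi>_def)
  qed
  moreover have "integral {0..1} (\<lambda>t. \<phi> (s + log_shift \<delta> t)) \<le> \<phi> s + (C * N powr q) * (\<delta> * \<eta> (exp (s + \<delta>))) powr q"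
    if d: "0 < \<delta>" "\<delta> < 1" "s + \<delta> < 0" for s \<delta>
  proof -
    define M where "M = N * \<eta> (exp (s + \<delta>))"
    have e01: "exp (s + \<delta>) \<in> {0..<1}" using prep(3)[OF d] by simp
    have M: "M \<ge> 0" using N \<eta>(3)[OF e01] by (simp add: M_def)
    have "pmean p (deriv F) w \<le> M powr p" if w: "cmod w \<le> exp s * (1 + \<delta>)" for w
    proof -
      have w': "cmod w \<le> exp (s + \<delta>)" using w prep(1)[OF d] by linarith
      have w01: "cmod w \<in> {0..<1}" using w prep(2)[OF d] by simp
      have "pmean p (deriv F) w \<le> (N * \<eta> (cmod w)) powr p"
        using w prep(2)[OF d] by (intro bound) auto
      also have "\<dots> \<le> M powr p"
        unfolding M_def using w' e01 N p \<eta>(3) w01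
        by (intro powr_mono2 mult_left_mono mono_onD[OF \<eta>(2)] mult_nonneg_nonneg) auto
      finally show ?thesis .
    qed
    then have "integral {0..1} (\<lambda>t. \<phi> (s + log_shift \<delta> t)) \<le> \<phi> s + C * (\<delta> * M) powr q"
      using two[OF hol, of \<delta> "exp s"] prep[OF d] d M by (simp add: \<phi>_def)
    also have "(\<delta> * M) powr q = N powr q * (\<delta> * \<eta> (exp (s + \<delta>))) powr q"
      unfolding M_def by (subst powr_mult[symmetric]) (simp add: mult_ac)
    finally show ?thesis by (simp add: mult.assoc)
  qed
  ultimately obtain D where D: "\<And>r. 1 / 2 < r \<Longrightarrow> r < 1 \<Longrightarrow>
    \<phi> (ln r) \<le> D + 96 * (C * N powr q) * 64 powr q * integral {0..r} (\<lambda>\<rho>. (1 - \<rho>) powr (q - 1) * \<eta> \<rho> powr q)"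
    using convex_mean_growth[OF _ cont q(1) _ \<eta>, of "C * N powr q"] C by auto
  show ?thesis
  proof (rule exI[of _ D], rule exI[of _ "96 * (C * N powr q) * 64 powr q"], intro conjI allI impI)
    fix r :: real assume "1 / 2 < r" "r < 1"
    then show "pmean p F (of_real r) powr (q / p) \<le>
        D + 96 * (C * N powr q) * 64 powr q * integral {0..r} (\<lambda>\<rho>. (1 - \<rho>) powr (q - 1) * \<eta> \<rho> powr q)"
      using D[of r] by (simp add: \<phi>_def)
  qed (use C in auto)
qed

section \<open>Bounding the derivative by the real part\<close>

text \<open>Cauchy's formula for the derivative is unchanged when \<open>F\<close> is
  replaced by \<open>F + cnj F\<close>, because \<open>F * circ\<close> has integral
  0 over the circle and so does its conjugate.\<close>

lemma deriv_eq_integral_Re: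
  assumes hol: "F holomorphic_on ball z R" and \<delta>: "0 < \<delta>" "\<delta> < R"
  shows "((\<lambda>t. of_real (Re (F (z + of_real \<delta> * circ t))) * cnj (circ t)) has_integral of_real (\<delta> / 2) * deriv F z) {0..1}"
proof -
  define h where "h t = F (z + of_real \<delta> * circ t)" for t
  have hol': "F holomorphic_on cball z \<delta>" using \<delta> by (intro holomorphic_on_subset[OF hol]) auto
  have cnj_circ: "cnj (circ t) = inverse (circ t)" for t by (simp add: circ_def cis_cnj)
  have 1: "((\<lambda>t. h t * cnj (circ t)) has_integral of_real \<delta> * deriv F z) {0..1}"
  proof -
    note D = Cauchy_derivative_integral_circlepath[of z \<delta> F z,
      OF holomorphic_on_imp_continuous_on[OF hol'] holomorphic_on_subset[OF hol' ball_subset_cball]]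
    define I where "I = contour_integral (circlepath z \<delta>) (\<lambda>u. F u / (u - z)\<^sup>2)"
    have "deriv F z = 1 / (2 * of_real pi * \<i>) * I"
      using D(2) \<delta> by (simp add: DERIV_imp_deriv I_def)
    moreover have "((\<lambda>u. F u / (u - z)\<^sup>2) has_contour_integral I) (circlepath z \<delta>)"
      unfolding I_def using D(1) \<delta> by (intro has_contour_integral_integral) simp
    ultimately have "((\<lambda>u. F u / (u - z)\<^sup>2) has_contour_integral 2 * of_real pi * \<i> * deriv F z) (circlepath z \<delta>)"
      by simp
    then have int: "((\<lambda>t. F (circlepath z \<delta> t) / (circlepath z \<delta> t - z)\<^sup>2 * vector_derivative (circlepath z \<delta>) (at t))
        has_integral 2 * of_real pi * \<i> * deriv F z) {0..1}"
      unfolding has_contour_integral .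
    have "F (circlepath z \<delta> t) / (circlepath z \<delta> t - z)\<^sup>2 * vector_derivative (circlepath z \<delta>) (at t)
        = (2 * of_real pi * \<i> / of_real \<delta>) * (h t * cnj (circ t))" for t
      using \<delta> unfolding cnj_circ h_def
      by (subst vector_derivative_circlepath) (simp add: circ_eq_exp circlepath power2_eq_square field_simps)
    from has_integral_mult_right[OF int[unfolded this], of "of_real \<delta> / (2 * of_real pi * \<i>)"] \<delta>
    show ?thesis by (simp add: field_simps)
  qed
  have 2: "((\<lambda>t. h t * circ t) has_integral 0) {0..1}"
  proof -
    have "(\<lambda>w. (w - z) * F w) holomorphic_on ball z R" by (intro holomorphic_intros hol)
    from mean_value_circ[OF this, of \<delta>] \<delta> have "((\<lambda>t. of_real \<delta> * (h t * circ t)) has_integral 0) {0..1}"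
      by (simp add: h_def mult_ac)
    from has_integral_mult_right[OF this, of "1 / of_real \<delta>"] \<delta> show ?thesis by simp
  qed
  have "((\<lambda>t. cnj (h t * circ t)) has_integral cnj 0) {0..1}"
    using has_integral_linear[OF 2 bounded_linear_cnj] by (simp add: o_def)
  with 1 have "((\<lambda>t. h t * cnj (circ t) + cnj (h t * circ t)) has_integral of_real \<delta> * deriv F z + cnj 0) {0..1}"
    by (rule has_integral_add)
  from has_integral_mult_right[OF this, of "1 / 2"]
  have "((\<lambda>t. 1 / 2 * (h t * cnj (circ t) + cnj (h t * circ t))) has_integral of_real (\<delta> / 2) * deriv F z) {0..1}"
    by simp
  moreover have "1 / 2 * (h t * cnj (circ t) + cnj (h t * circ t)) = of_real (Re (h t)) * cnj (circ t)" for t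
  proof -
    have "h t * cnj (circ t) + cnj (h t * circ t) = (h t + cnj (h t)) * cnj (circ t)" by (simp add: distrib_right)
    then show ?thesis by (simp only: complex_add_cnj) simp
  qed
  ultimately show ?thesis by (simp add: h_def)
qed

text \<open>The pointwise bound by an average over a circle of radius
  \<open>\<delta>\<close> survives Jensen's inequality and rotation. Only the moduli
  between \<open>r - \<delta>\<close> and \<open>r + \<delta>\<close> occur, so a
  bound on means close to the unit circle suffices.\<close>

lemma pmean_deriv_le:
  fixes p r \<delta> M :: real
  assumes p: "p \<ge> 1" and hol: "F holomorphic_on ball 0 1" and contf: "continuous_on (ball 0 1) f"
    and le: "\<And>z. cmod z < 1 \<Longrightarrow> \<bar>Re (F z)\<bar> \<le> cmod (f z)"
    and r: "0 \<le> r" and \<delta>: "0 < \<delta>" "r + \<delta> < 1"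
    and bound: "\<And>w. r - \<delta> \<le> cmod w \<Longrightarrow> cmod w \<le> r + \<delta> \<Longrightarrow> pmean p f w \<le> M"
  shows "pmean p (deriv F) (of_real r) \<le> (2 / \<delta>) powr p * M"
proof -
  have hol': "deriv F holomorphic_on ball 0 1" by (intro holomorphic_deriv hol) auto
  note contF' = holomorphic_on_imp_continuous_on[OF hol']
  define h where "h t = of_real r + of_real \<delta> * circ t" for t
  have h: "cmod (h t) \<le> r + \<delta>" "r - \<delta> \<le> cmod (h t)" for t
    unfolding h_def using norm_triangle_ineq[of "of_real r" "of_real \<delta> * circ t"]
      norm_triangle_ineq2[of "of_real r" "- (of_real \<delta> * circ t)"] r \<delta> by (simp_all add: norm_mult)
  have h1: "cmod (h t) < 1" for t using h(1)[of t] \<delta> by linarith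
  have conth: "continuous_on A h" for A unfolding h_def by (intro continuous_intros)
  define S where "S \<theta> = integral {0..1} (\<lambda>t. cmod (f (h t * circ \<theta>)) powr p)" for \<theta>
  have pt: "cmod (deriv F (of_real r * circ \<theta>)) powr p \<le> (2 / \<delta>) powr p * S \<theta>" for \<theta>
  proof -
    define H where "H w = F (w * circ \<theta>)" for w
    have holH: "H holomorphic_on ball (of_real r) (1 - r)"
      unfolding H_def using r by (intro holomorphic_on_rotate hol)
    have "(F has_field_derivative deriv F (of_real r * circ \<theta>)) (at (of_real r * circ \<theta>))"
      using r \<delta> by (intro holomorphic_derivI[OF hol]) (auto simp: norm_mult)
    then have "(H has_field_derivative deriv F (of_real r * circ \<theta>) * circ \<theta>) (at (of_real r))"
      unfolding H_def by (intro DERIV_chain'[where g = F]) (auto intro!: derivative_eq_intros)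
    then have dH: "deriv H (of_real r) = deriv F (of_real r * circ \<theta>) * circ \<theta>" by (rule DERIV_imp_deriv)
    have cf: "continuous_on {0..1} (\<lambda>t. f (h t * circ \<theta>))"
      using h1 by (intro continuous_on_disc_compose[OF contf] continuous_intros conth) (auto simp: norm_mult)
    note int = deriv_eq_integral_Re[OF holH, of \<delta>]
    have "cmod (of_real (\<delta> / 2) * deriv H (of_real r)) =
        cmod (integral {0..1} (\<lambda>t. of_real (Re (H (of_real r + of_real \<delta> * circ t))) * cnj (circ t)))"
      using int \<delta> by (simp add: integral_unique)
    also have "\<dots> \<le> integral {0..1} (\<lambda>t. cmod (f (h t * circ \<theta>)))"
    proof (rule integral_norm_bound_integral)
      show "(\<lambda>t. of_real (Re (H (of_real r + of_real \<delta> * circ t))) * cnj (circ t)) integrable_on {0..1}"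
        using int \<delta> by (auto simp: integrable_on_def)
      show "(\<lambda>t. cmod (f (h t * circ \<theta>))) integrable_on {0..1}"
        by (intro integrable_continuous_interval continuous_on_norm cf)
      fix t :: real
      show "cmod (of_real (Re (H (of_real r + of_real \<delta> * circ t))) * cnj (circ t)) \<le> cmod (f (h t * circ \<theta>))"
        using le[of "h t * circ \<theta>"] h1[of t] by (simp add: H_def h_def norm_mult)
    qed
    finally have "cmod (deriv F (of_real r * circ \<theta>)) \<le> 2 / \<delta> * integral {0..1} (\<lambda>t. cmod (f (h t * circ \<theta>)))"
      using \<delta> by (simp add: dH norm_mult field_simps)
    then have "cmod (deriv F (of_real r * circ \<theta>)) powr p \<le> (2 / \<delta> * integral {0..1} (\<lambda>t. cmod (f (h t * circ \<theta>)))) powr p"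
      using p by (intro powr_mono2) auto
    also have "\<dots> = (2 / \<delta>) powr p * integral {0..1} (\<lambda>t. cmod (f (h t * circ \<theta>))) powr p" by (rule powr_mult)
    also have "\<dots> \<le> (2 / \<delta>) powr p * S \<theta>"
      unfolding S_def using p by (intro mult_left_mono integral_powr_Jensen continuous_on_norm cf) auto
    finally show ?thesis .
  qed
  have contS: "continuous_on {0..1} S"
    unfolding S_def
  proof (rule continuous_on_integral_Icc)
    show "continuous_on ({0..1} \<times> {0..1}) (\<lambda>x. cmod (f (h (snd x) * circ (fst x))) powr p)"
      using p h1 by (intro continuous_on_norm_powr continuous_on_disc_compose[OF contf] continuous_intros
          continuous_on_compose2[OF conth[of UNIV]]) (auto simp: norm_mult)
  qed
  have contd: "continuous_on {0..1} (\<lambda>\<theta>. cmod (deriv F (of_real r * circ \<theta>)) powr p)"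
    using p r \<delta> by (intro pmean_integrand_continuous contF') auto
  have "pmean p (deriv F) (of_real r) \<le> integral {0..1} (\<lambda>\<theta>. (2 / \<delta>) powr p * S \<theta>)"
    unfolding pmean_def by (intro integral_le integrable_continuous_interval contd continuous_on_mult continuous_on_const contS pt)
  also have "\<dots> = (2 / \<delta>) powr p * integral {0..1} S" by (rule integral_mult_right)
  also have "integral {0..1} S = integral {0..1} (\<lambda>t. pmean p f (h t))"
    unfolding S_def using p h1 by (intro integral_pmean_swap contf conth) auto
  also have "\<dots> \<le> integral {0..1} (\<lambda>t::real. M)"
  proof (rule integral_le)
    show "(\<lambda>t. pmean p f (h t)) integrable_on {0..1}"
      using h1 p by (intro integrable_continuous_interval continuous_on_pmean[OF contf] conth) auto
  qed (use bound h in auto)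
  finally show ?thesis by (simp add: mult_left_mono)
qed

section \<open>Partial derivatives\<close>

lemma has_partials_atD:
  assumes "has_partials_at f z"
  shows "((\<lambda>t. f (z + of_real t)) has_vector_derivative partial_x f z) (at 0)"
    "((\<lambda>t. f (z + \<i> * of_real t)) has_vector_derivative partial_y f z) (at 0)"
  using assms by (auto simp: has_partials_at_def partial_x_def partial_y_def vector_derivative_works)

lemma has_partials_atI:
  assumes "((\<lambda>t. f (z + of_real t)) has_vector_derivative a) (at 0)"
    "((\<lambda>t. f (z + \<i> * of_real t)) has_vector_derivative b) (at 0)"
  shows "has_partials_at f z" "partial_x f z = a" "partial_y f z = b"
  using assms by (auto simp: has_partials_at_def partial_x_def partial_y_def vector_derivative_at
      intro: differentiableI_vector)

lemma has_partials_at_bounded_linear: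
  assumes L: "bounded_linear L" and f: "has_partials_at f z"
  shows "has_partials_at (\<lambda>w. L (f w)) z" "partial_x (\<lambda>w. L (f w)) z = L (partial_x f z)"
    "partial_y (\<lambda>w. L (f w)) z = L (partial_y f z)"
  using has_partials_atI[OF bounded_linear.has_vector_derivative[OF L has_partials_atD(1)[OF f]]
      bounded_linear.has_vector_derivative[OF L has_partials_atD(2)[OF f]]] by auto

lemma has_partials_at_cong:
  assumes S: "open S" "z \<in> S" and eq: "\<And>w. w \<in> S \<Longrightarrow> f w = g w" and f: "has_partials_at f z"
  shows "has_partials_at g z" "partial_x g z = partial_x f z" "partial_y g z = partial_y f z"
proof -
  have x: "open ((\<lambda>t. z + of_real t) -` S)" "open ((\<lambda>t. z + \<i> * of_real t) -` S)"
    using S(1) by (intro continuous_open_vimage continuous_intros; simp)+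
  have "((\<lambda>t. g (z + of_real t)) has_vector_derivative partial_x f z) (at 0)"
    using S eq by (intro has_vector_derivative_transform_within_open[OF has_partials_atD(1)[OF f] x(1)]) auto
  moreover have "((\<lambda>t. g (z + \<i> * of_real t)) has_vector_derivative partial_y f z) (at 0)"
    using S eq by (intro has_vector_derivative_transform_within_open[OF has_partials_atD(2)[OF f] x(2)]) auto
  ultimately show "has_partials_at g z" "partial_x g z = partial_x f z" "partial_y g z = partial_y f z"
    by (auto dest: has_partials_atI)
qed

lemma Ck_on_cong:
  assumes "open S" "Ck_on k S f" "\<And>w. w \<in> S \<Longrightarrow> f w = g w"
  shows "Ck_on k S g"
  using assms(2,3)
proof (induction k arbitrary: f g)
  case 0
  then show ?case using continuous_on_cong[of S S f g] by simp
next
  case (Suc k)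
  have "Ck_on k S (partial_x g)" "Ck_on k S (partial_y g)"
    using Suc.prems has_partials_at_cong[OF assms(1) _ Suc.prems(2)]
    by (auto intro: Suc.IH[of "partial_x f"] Suc.IH[of "partial_y f"])
  then show ?case using Suc.prems continuous_on_cong[of S S f g] has_partials_at_cong(1)[OF assms(1) _ Suc.prems(2)]
    by simp
qed

lemma Ck_on_bounded_linear:
  assumes "open S" "bounded_linear L" "Ck_on k S f"
  shows "Ck_on k S (\<lambda>z. L (f z))"
  using assms(3)
proof (induction k arbitrary: f)
  case 0
  then show ?case using assms(2) by (auto intro: bounded_linear.continuous_on)
next
  case (Suc k)
  note P = has_partials_at_bounded_linear[OF assms(2)]
  have "Ck_on k S (\<lambda>z. L (partial_x f z))" "Ck_on k S (\<lambda>z. L (partial_y f z))"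
    using Suc by auto
  then have "Ck_on k S (partial_x (\<lambda>z. L (f z)))" "Ck_on k S (partial_y (\<lambda>z. L (f z)))"
    using Suc.prems P(2,3)[of f] by (auto intro: Ck_on_cong[OF assms(1)])
  then show ?case using Suc.prems assms(2) P(1)[of f] by (auto intro: bounded_linear.continuous_on)
qed

lemma has_partials_at_Complex:
  assumes "has_partials_at f (Complex x y)"
  shows "((\<lambda>x. f (Complex x y)) has_vector_derivative partial_x f (Complex x y)) (at x)"
    and "((\<lambda>y. f (Complex x y)) has_vector_derivative partial_y f (Complex x y)) (at y)"
proof -
  have s: "((\<lambda>x'. x' - c) has_vector_derivative 1) (at c)" for c :: real
    by (auto intro!: derivative_eq_intros)
  have "Complex x y + of_real (x' - x) = Complex x' y" "Complex x y + \<i> * of_real (y' - y) = Complex x y'" for x' y'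
    by (simp_all add: complex_eq_iff)
  then show "((\<lambda>x. f (Complex x y)) has_vector_derivative partial_x f (Complex x y)) (at x)"
    "((\<lambda>y. f (Complex x y)) has_vector_derivative partial_y f (Complex x y)) (at y)"
    using vector_diff_chain_at[OF s[of x], of "\<lambda>t. f (Complex x y + of_real t)" "partial_x f (Complex x y)"]
      vector_diff_chain_at[OF s[of y], of "\<lambda>t. f (Complex x y + \<i> * of_real t)" "partial_y f (Complex x y)"]
      has_partials_atD[OF assms]
    by (simp_all add: o_def)
qed

text \<open>Continuity of one of the two partial derivatives, together with existence of
  the other, yields differentiability.\<close>

lemma C1_has_derivative:
  fixes f :: "complex \<Rightarrow> 'a::real_normed_vector"
  assumes S: "open S" "z \<in> S" and f: "Ck_on 1 S f"
  shows "(f has_derivative (\<lambda>h. Re h *\<^sub>R partial_x f z + Im h *\<^sub>R partial_y f z)) (at z)"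
proof -
  obtain e where e: "e > 0" "ball z e \<subseteq> S" using S openE by blast
  define X where "X = ball (Re z) (e / 2)"
  define Y where "Y = ball (Im z) (e / 2)"
  have XY: "Complex x y \<in> S" if "x \<in> X" "y \<in> Y" for x y
  proof -
    have "dist z (Complex x y) \<le> \<bar>Re z - x\<bar> + \<bar>Im z - y\<bar>"
      using cmod_le[of "z - Complex x y"] by (simp add: dist_norm)
    also have "\<dots> < e" using that by (auto simp: X_def Y_def dist_real_def)
    finally show ?thesis using e by auto
  qed
  have z: "Re z \<in> X" "Im z \<in> Y" using e by (auto simp: X_def Y_def)
  have part: "has_partials_at f w" if "w \<in> S" for w using f that by simp
  note dx = has_partials_at_Complex(1)[OF part] and dy = has_partials_at_Complex(2)[OF part]
  have conty: "continuous_on S (partial_y f)" using f by simp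
  have "((\<lambda>(x, y). f (Complex x y)) has_derivative
      (\<lambda>(tx, ty). tx *\<^sub>R partial_x f z + blinfun_scaleR_left (partial_y f (Complex (Re z) (Im z))) ty))
      (at (Re z, Im z) within X \<times> Y)"
  proof (rule has_derivative_partialsI)
    show "((\<lambda>x. f (Complex x (Im z))) has_derivative (\<lambda>h. h *\<^sub>R partial_x f z)) (at (Re z) within X)"
      using dx[of "Re z" "Im z"] S by (auto simp: has_vector_derivative_def intro: has_derivative_at_withinI)
    show "((\<lambda>y. f (Complex x y)) has_derivative blinfun_apply (blinfun_scaleR_left (partial_y f (Complex x y)))) (at y within Y)"
      if "x \<in> X" "y \<in> Y" for x y
      using dy[OF XY[OF that]] by (auto simp: has_vector_derivative_def intro: has_derivative_at_withinI)
    have "continuous_on (X \<times> Y) (\<lambda>p. blinfun_scaleR_left (partial_y f (Complex (fst p) (snd p))))"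
      using XY by (intro bounded_linear.continuous_on[OF bounded_linear_blinfun_scaleR_left]
          continuous_on_compose2[OF conty] continuous_intros) auto
    then show "continuous (at (Re z, Im z) within X \<times> Y) (\<lambda>(x, y). blinfun_scaleR_left (partial_y f (Complex x y)))"
      using z by (simp add: continuous_on_eq_continuous_within case_prod_unfold)
    show "convex Y" by (simp add: Y_def)
  qed (use z in auto)
  then have D: "((\<lambda>p. f (Complex (fst p) (snd p))) has_derivative (\<lambda>p. fst p *\<^sub>R partial_x f z + snd p *\<^sub>R partial_y f z))
      (at (Re z, Im z))"
    using z at_within_open[of "(Re z, Im z)" "X \<times> Y"]
    by (simp add: X_def Y_def open_Times case_prod_unfold)
  have R: "((\<lambda>w. (Re w, Im w)) has_derivative (\<lambda>w. (Re w, Im w))) (at z)"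
    by (auto intro!: derivative_eq_intros)
  from has_derivative_compose[OF R D] show ?thesis by simp
qed

section \<open>Harmonic functions as real parts\<close>

text \<open>The second difference over a square can be evaluated by two applications of
  the mean value theorem, in either order of the variables; comparing both results for
  small \<open>h\<close> gives the symmetry of mixed partial derivatives.\<close>

lemma mixed_difference_eq:
  fixes u :: "real \<Rightarrow> real \<Rightarrow> real"
  assumes h: "h > 0"
    and ux: "\<And>x y. x \<in> {a..a + h} \<Longrightarrow> y \<in> {b..b + h} \<Longrightarrow> ((\<lambda>x. u x y) has_real_derivative ux x y) (at x)"
    and uxy: "\<And>x y. x \<in> {a..a + h} \<Longrightarrow> y \<in> {b..b + h} \<Longrightarrow> ((\<lambda>y. ux x y) has_real_derivative uxy x y) (at y)"
  shows "\<exists>x\<in>{a..a + h}. \<exists>y\<in>{b..b + h}. u (a + h) (b + h) - u (a + h) b - u a (b + h) + u a b = h * h * uxy x y"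
proof -
  have "\<exists>x. a < x \<and> x < a + h \<and> (u (a + h) (b + h) - u (a + h) b) - (u a (b + h) - u a b) = (a + h - a) * (ux x (b + h) - ux x b)"
    using h by (intro MVT2[where f = "\<lambda>x. u x (b + h) - u x b"] DERIV_diff ux) auto
  then obtain x where x: "a < x" "x < a + h"
    "(u (a + h) (b + h) - u (a + h) b) - (u a (b + h) - u a b) = h * (ux x (b + h) - ux x b)" by auto
  have "\<exists>y. b < y \<and> y < b + h \<and> ux x (b + h) - ux x b = (b + h - b) * uxy x y"
    using h x by (intro MVT2 uxy) auto
  then obtain y where y: "b < y" "y < b + h" "ux x (b + h) - ux x b = h * uxy x y" by auto
  have "u (a + h) (b + h) - u (a + h) b - u a (b + h) + u a b = h * h * uxy x y"
    using x(3) y(3) by (simp add: mult.assoc)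
  then show ?thesis using x(1,2) y(1,2) by (intro bexI[of _ x] bexI[of _ y]) auto
qed

lemma mixed_partials_commute:
  fixes u :: "complex \<Rightarrow> real"
  assumes S: "open S" "z \<in> S" and u: "Ck_on 2 S u"
  shows "partial_y (partial_x u) z = partial_x (partial_y u) z"
proof (rule ccontr)
  assume neq: "partial_y (partial_x u) z \<noteq> partial_x (partial_y u) z"
  define \<epsilon> where "\<epsilon> = \<bar>partial_y (partial_x u) z - partial_x (partial_y u) z\<bar> / 2"
  have \<epsilon>: "\<epsilon> > 0" using neq by (simp add: \<epsilon>_def)
  have C: "\<And>w. w \<in> S \<Longrightarrow> has_partials_at u w" "\<And>w. w \<in> S \<Longrightarrow> has_partials_at (partial_x u) w"
    "\<And>w. w \<in> S \<Longrightarrow> has_partials_at (partial_y u) w"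
    "continuous_on S (partial_y (partial_x u))" "continuous_on S (partial_x (partial_y u))"
    using u by (simp_all add: numeral_2_eq_2)
  have "isCont (partial_y (partial_x u)) z" "isCont (partial_x (partial_y u)) z"
    using C(4,5) S by (auto simp: continuous_on_eq_continuous_at)
  then have "\<exists>d>0. \<forall>w. dist w z < d \<longrightarrow> dist (partial_y (partial_x u) w) (partial_y (partial_x u) z) < \<epsilon>"
    "\<exists>d>0. \<forall>w. dist w z < d \<longrightarrow> dist (partial_x (partial_y u) w) (partial_x (partial_y u) z) < \<epsilon>"
    using \<epsilon> unfolding continuous_at_eps_delta by simp_all
  then obtain d1 d2 where d1: "d1 > 0" "\<And>w. dist w z < d1 \<Longrightarrow> dist (partial_y (partial_x u) w) (partial_y (partial_x u) z) < \<epsilon>"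
    and d2: "d2 > 0" "\<And>w. dist w z < d2 \<Longrightarrow> dist (partial_x (partial_y u) w) (partial_x (partial_y u) z) < \<epsilon>"
    by blast
  obtain e where e: "e > 0" "ball z e \<subseteq> S" using S openE by blast
  define h where "h = min e (min d1 d2) / 3"
  have h: "h > 0" "2 * h < e" "2 * h < d1" "2 * h < d2" using e d1 d2 by (auto simp: h_def)
  define a where "a = Re z"
  define b where "b = Im z"
  have near: "dist (Complex x y) z \<le> 2 * h" if "x \<in> {a..a + h}" "y \<in> {b..b + h}" for x y
    using cmod_le[of "Complex x y - z"] that by (simp add: dist_norm a_def b_def)
  have inS: "Complex x y \<in> S" if "x \<in> {a..a + h}" "y \<in> {b..b + h}" for x y
  proof -
    have "dist z (Complex x y) < e" using near[OF that] h by (simp add: dist_commute)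
    then show ?thesis using e by auto
  qed
  have P: "((\<lambda>x. g (Complex x y)) has_real_derivative partial_x g (Complex x y)) (at x)"
    "((\<lambda>y. g (Complex x y)) has_real_derivative partial_y g (Complex x y)) (at y)"
    if "has_partials_at g (Complex x y)" for g :: "complex \<Rightarrow> real" and x y
    using has_partials_at_Complex[OF that] by (simp_all add: has_real_derivative_iff_has_vector_derivative)
  have "\<exists>x\<in>{a..a + h}. \<exists>y\<in>{b..b + h}.
      u (Complex (a + h) (b + h)) - u (Complex (a + h) b) - u (Complex a (b + h)) + u (Complex a b)
      = h * h * partial_y (partial_x u) (Complex x y)"
    by (rule mixed_difference_eq[OF h(1), where u = "\<lambda>x y. u (Complex x y)"
          and ux = "\<lambda>x y. partial_x u (Complex x y)" and uxy = "\<lambda>x y. partial_y (partial_x u) (Complex x y)"])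
      (intro P C(1,2) inS; assumption)+
  then obtain x y where xy: "x \<in> {a..a + h}" "y \<in> {b..b + h}"
    "u (Complex (a + h) (b + h)) - u (Complex (a + h) b) - u (Complex a (b + h)) + u (Complex a b)
      = h * h * partial_y (partial_x u) (Complex x y)" by blast
  have "\<exists>y\<in>{b..b + h}. \<exists>x\<in>{a..a + h}.
      u (Complex (a + h) (b + h)) - u (Complex a (b + h)) - u (Complex (a + h) b) + u (Complex a b)
      = h * h * partial_x (partial_y u) (Complex x y)"
    by (rule mixed_difference_eq[OF h(1), where u = "\<lambda>y x. u (Complex x y)"
          and ux = "\<lambda>y x. partial_y u (Complex x y)" and uxy = "\<lambda>y x. partial_x (partial_y u) (Complex x y)"])
      (intro P C(1,3) inS; assumption)+
  then obtain x' y' where xy': "x' \<in> {a..a + h}" "y' \<in> {b..b + h}"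
    "u (Complex (a + h) (b + h)) - u (Complex a (b + h)) - u (Complex (a + h) b) + u (Complex a b)
      = h * h * partial_x (partial_y u) (Complex x' y')" by blast
  have "h * h * partial_y (partial_x u) (Complex x y) = h * h * partial_x (partial_y u) (Complex x' y')"
    using xy(3) xy'(3) by linarith
  then have "partial_y (partial_x u) (Complex x y) = partial_x (partial_y u) (Complex x' y')" using h by simp
  moreover have "dist (partial_y (partial_x u) (Complex x y)) (partial_y (partial_x u) z) < \<epsilon>"
    using near[OF xy(1,2)] h by (intro d1) auto
  moreover have "dist (partial_x (partial_y u) (Complex x' y')) (partial_x (partial_y u) z) < \<epsilon>"
    using near[OF xy'(1,2)] h by (intro d2) auto
  ultimately show False unfolding \<epsilon>_def dist_real_def by (smt (verit) field_sum_of_halves)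
qed

text \<open>The function \<open>u_x - \<i> * u_y\<close> satisfies the Cauchy-Riemann
  equations, one of them because \<open>u\<close> is harmonic, the other by symmetry of
  the mixed derivatives. Its primitive has real part \<open>u\<close>, up to a constant.\<close>

lemma harmonic_eq_Re_holomorphic:
  fixes u :: "complex \<Rightarrow> real"
  assumes S: "open S" "convex S" "S \<noteq> {}" and u: "Ck_on 2 S u" and lap: "\<And>z. z \<in> S \<Longrightarrow> laplacian u z = 0"
  shows "\<exists>F. F holomorphic_on S \<and> (\<forall>z\<in>S. u z = Re (F z) \<and> deriv F z = cnj (gradient u z))"
proof -
  have C: "Ck_on 1 S u" "Ck_on 1 S (partial_x u)" "Ck_on 1 S (partial_y u)"
    using u by (simp_all add: numeral_2_eq_2)
  define \<phi> where "\<phi> z = of_real (partial_x u z) - \<i> * of_real (partial_y u z)" for z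
  have "(\<phi> has_field_derivative of_real (partial_x (partial_x u) z) - \<i> * of_real (partial_y (partial_x u) z)) (at z)"
    if z: "z \<in> S" for z
  proof -
    have yy: "partial_y (partial_y u) z = - partial_x (partial_x u) z"
      using lap[OF z] by (simp add: laplacian_def)
    have yx: "partial_x (partial_y u) z = partial_y (partial_x u) z"
      using mixed_partials_commute[OF S(1) z u] by simp
    have "(\<phi> has_derivative (\<lambda>h. of_real (Re h *\<^sub>R partial_x (partial_x u) z + Im h *\<^sub>R partial_y (partial_x u) z)
        - \<i> * of_real (Re h *\<^sub>R partial_x (partial_y u) z + Im h *\<^sub>R partial_y (partial_y u) z))) (at z)"
      unfolding \<phi>_def
      by (intro has_derivative_diff has_derivative_mult_right has_derivative_of_real
        C1_has_derivative[OF S(1) z C(2)] C1_has_derivative[OF S(1) z C(3)])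
    moreover have "of_real (Re h *\<^sub>R partial_x (partial_x u) z + Im h *\<^sub>R partial_y (partial_x u) z)
        - \<i> * of_real (Re h *\<^sub>R partial_x (partial_y u) z + Im h *\<^sub>R partial_y (partial_y u) z) =
        (of_real (partial_x (partial_x u) z) - \<i> * of_real (partial_y (partial_x u) z)) * h" for h
      by (simp add: complex_eq_iff yy yx algebra_simps)
    ultimately show ?thesis by (simp add: has_field_derivative_def)
  qed
  then have "\<phi> holomorphic_on S" by (intro holomorphic_onI) (meson field_differentiable_at_within field_differentiable_def)
  from holomorphic_convex_primitive'[OF S(2,1) this]
  obtain F where F: "\<And>z. z \<in> S \<Longrightarrow> (F has_field_derivative \<phi> z) (at z within S)" by blast
  have F': "(F has_field_derivative \<phi> z) (at z)" if "z \<in> S" for z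
    using F[OF that] at_within_open[OF that S(1)] by simp
  have "\<exists>c. \<forall>z\<in>S. u z - Re (F z) = c"
  proof (rule has_derivative_zero_constant[OF S(2)])
    fix z assume z: "z \<in> S"
    have "((\<lambda>z. u z - Re (F z)) has_derivative
        (\<lambda>h. (Re h *\<^sub>R partial_x u z + Im h *\<^sub>R partial_y u z) - Re (\<phi> z * h))) (at z)"
      using F'[OF z] unfolding has_field_derivative_def
      by (intro has_derivative_diff has_derivative_Re C1_has_derivative[OF S(1) z C(1)])
    moreover have "(Re h *\<^sub>R partial_x u z + Im h *\<^sub>R partial_y u z) - Re (\<phi> z * h) = 0" for h
      by (simp add: \<phi>_def algebra_simps)
    ultimately show "((\<lambda>z. u z - Re (F z)) has_derivative (\<lambda>h. 0)) (at z within S)"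
      by (simp add: has_derivative_at_withinI)
  qed
  then obtain c where c: "\<And>z. z \<in> S \<Longrightarrow> u z - Re (F z) = c" by blast
  show ?thesis
  proof (intro exI[of _ "\<lambda>z. F z + of_real c"] conjI ballI)
    show "(\<lambda>z. F z + of_real c) holomorphic_on S"
      using F by (intro holomorphic_intros) (auto simp: holomorphic_on_def field_differentiable_def)
    fix z assume z: "z \<in> S"
    show "u z = Re (F z + of_real c)" using c[OF z] by simp
    have "((\<lambda>z. F z + of_real c) has_field_derivative \<phi> z) (at z)"
      using F'[OF z] by (auto intro!: derivative_eq_intros)
    then show "deriv (\<lambda>z. F z + of_real c) z = cnj (gradient u z)"
      by (simp add: DERIV_imp_deriv \<phi>_def gradient_def complex_eq_iff)
  qed
qed

section \<open>The gradient bound for quasiregular mappings\<close>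

text \<open>The two partial derivatives are continuous, so an inequality between them that
  holds almost everywhere holds everywhere. Pointwise, the gradient of the imaginary part
  is bounded by \<open>\<Lambda> = |f_z| + |f_zbar|\<close>, and the gradient of the
  real part is bounded below by \<open>|f_z| - |f_zbar|\<close>. The Jacobian is the
  product of these two numbers, so
  \<open>\<Lambda>^2 \<le> K * g * \<Lambda> + K0\<close> with \<open>g\<close>
  the norm of the gradient of the real part, and this forces
  \<open>\<Lambda> \<le> K * g + sqrt K0\<close>.\<close>

lemma quasiregular_gradient_bound:
  assumes S: "open S" and K0: "K0 \<ge> 0" and K: "K \<ge> 0" and f: "Ck_on 1 S f" and qr: "quasiregular_on K K0 S f" and z: "z \<in> S"
  shows "cmod (gradient (\<lambda>z. Im (f z)) z) \<le> K * cmod (gradient (\<lambda>z. Re (f z)) z) + sqrt K0"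
proof -
  have cx: "continuous_on S (partial_x f)" "continuous_on S (partial_y f)" and part: "has_partials_at f z"
    using f z by simp_all
  define b where "b w = (Lambda f w)\<^sup>2 - K * Jacobian f w - K0" for w
  have contb: "continuous_on S b"
    unfolding b_def Lambda_def Jacobian_def d_z_def d_zbar_def by (intro continuous_intros cx) auto
  define U where "U = {w\<in>S. 0 < b w}"
  have openU: "open U"
    unfolding U_def using continuous_open_preimage[OF contb S open_greaterThan[of 0]]
    by (simp add: vimage_def Int_def)
  have "AE w in lebesgue. w \<notin> U"
    using qr unfolding quasiregular_on_def U_def b_def by auto
  then have "negligible U"
    using openU AE_iff_null_sets[of U lebesgue] by (simp add: negligible_iff_null_sets sets_completionI_sets)
  then have "U = {}" using open_not_negligible[OF openU] by blast
  then have ineq: "(Lambda f z)\<^sup>2 \<le> K * Jacobian f z + K0" using z by (auto simp: U_def b_def not_less)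
  define lam where "lam = cmod (d_z f z) - cmod (d_zbar f z)"
  have J: "Jacobian f z = lam * Lambda f z" by (simp add: Jacobian_def lam_def Lambda_def power2_eq_square algebra_simps)
  have P: "partial_x (\<lambda>z. Re (f z)) z = Re (partial_x f z)" "partial_y (\<lambda>z. Re (f z)) z = Re (partial_y f z)"
    "partial_x (\<lambda>z. Im (f z)) z = Im (partial_x f z)" "partial_y (\<lambda>z. Im (f z)) z = Im (partial_y f z)"
    using has_partials_at_bounded_linear[OF bounded_linear_Re part] has_partials_at_bounded_linear[OF bounded_linear_Im part] by auto
  have gu: "gradient (\<lambda>z. Re (f z)) z = cnj (d_z f z + cnj (d_zbar f z))"
    unfolding gradient_def P d_z_def d_zbar_def by (simp add: complex_eq_iff field_simps)
  have gv: "gradient (\<lambda>z. Im (f z)) z = \<i> * cnj (d_z f z - cnj (d_zbar f z))"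
    unfolding gradient_def P d_z_def d_zbar_def by (simp add: complex_eq_iff field_simps)
  define L where "L = Lambda f z"
  define g where "g = cmod (gradient (\<lambda>z. Re (f z)) z)"
  have L0: "L \<ge> 0" by (simp add: L_def Lambda_def)
  have "lam \<le> g"
    unfolding lam_def g_def gu complex_mod_cnj using norm_diff_ineq[of "d_z f z" "cnj (d_zbar f z)"] by simp
  then have "K * (lam * L) \<le> K * (g * L)" using K L0 by (intro mult_left_mono mult_right_mono)
  with ineq J have "L * L \<le> K * g * L + K0" by (simp add: L_def power2_eq_square mult_ac)
  have "L \<le> K * g + sqrt K0"
  proof (rule ccontr)
    assume "\<not> L \<le> K * g + sqrt K0"
    then have gt: "L - K * g > sqrt K0" by simp
    have Kg: "K * g \<ge> 0" using K by (simp add: g_def)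
    have "sqrt K0 * sqrt K0 < L * (L - K * g)"
      using gt Kg K0 by (intro mult_strict_mono') auto
    then have "K0 < L * (L - K * g)" using K0 by simp
    with \<open>L * L \<le> K * g * L + K0\<close> show False by (simp add: algebra_simps)
  qed
  moreover have "cmod (gradient (\<lambda>z. Im (f z)) z) \<le> L"
    unfolding gv L_def Lambda_def norm_mult complex_mod_cnj using norm_triangle_ineq4[of "d_z f z" "cnj (d_zbar f z)"]
    by simp
  ultimately show ?thesis by (simp add: g_def)
qed

section \<open>Holomorphic functions are harmonic quasiregular\<close>

lemma holomorphic_has_partials:
  assumes "open S" "z \<in> S" "g holomorphic_on S"
  shows "has_partials_at g z" "partial_x g z = deriv g z" "partial_y g z = \<i> * deriv g z"
proof -
  have D: "(g has_field_derivative deriv g z) (at z)" using assms holomorphic_derivI by blast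
  have "((\<lambda>t. z + of_real t) has_vector_derivative 1) (at 0)"
    "((\<lambda>t. z + \<i> * of_real t) has_vector_derivative \<i>) (at 0)"
    by (auto intro!: derivative_eq_intros)
  from this[THEN field_vector_diff_chain_at, of g "deriv g z"] D
  have "((\<lambda>t. g (z + of_real t)) has_vector_derivative 1 * deriv g z) (at 0)"
    "((\<lambda>t. g (z + \<i> * of_real t)) has_vector_derivative \<i> * deriv g z) (at 0)"
    by (simp_all add: o_def)
  then show "has_partials_at g z" "partial_x g z = deriv g z" "partial_y g z = \<i> * deriv g z"
    by (auto dest: has_partials_atI)
qed

lemma holomorphic_imp_Ck_on:
  assumes S: "open S" and g: "g holomorphic_on S"
  shows "Ck_on k S g"
  using g
proof (induction k arbitrary: g)
  case 0
  then show ?case by (simp add: holomorphic_on_imp_continuous_on)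
next
  case (Suc k)
  have "Ck_on k S (deriv g)" "Ck_on k S (\<lambda>z. \<i> * deriv g z)"
    using Suc S by (auto intro!: Suc.IH holomorphic_intros holomorphic_deriv)
  then have "Ck_on k S (partial_x g)" "Ck_on k S (partial_y g)"
    using holomorphic_has_partials[OF S _ Suc.prems] by (auto intro: Ck_on_cong[OF S])
  then show ?case
    using Suc.prems holomorphic_has_partials[OF S _ Suc.prems] by (simp add: holomorphic_on_imp_continuous_on)
qed

lemma laplacian_linear_holomorphic:
  assumes S: "open S" "z \<in> S" and g: "g holomorphic_on S" and L: "bounded_linear L"
  shows "laplacian (\<lambda>w. L (g w)) z = 0"
proof -
  have g': "deriv g holomorphic_on S" and ig': "(\<lambda>w. \<i> * deriv g w) holomorphic_on S"
    using g S by (auto intro!: holomorphic_intros holomorphic_deriv)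
  note P = holomorphic_has_partials[OF S(1)]
  note B = has_partials_at_bounded_linear[OF L]
  have eq: "partial_x (\<lambda>w. L (g w)) w = L (deriv g w)" "partial_y (\<lambda>w. L (g w)) w = L (\<i> * deriv g w)" if "w \<in> S" for w
    using B[OF P(1)[OF that g]] P[OF that g] by auto
  have "partial_x (partial_x (\<lambda>w. L (g w))) z = partial_x (\<lambda>w. L (deriv g w)) z"
    using B(1)[OF P(1)[OF S(2) g']] eq by (intro has_partials_at_cong(2)[OF S]) auto
  also have "\<dots> = L (deriv (deriv g) z)"
    using B(2)[OF P(1)[OF S(2) g']] P(2)[OF S(2) g'] by simp
  finally have xx: "partial_x (partial_x (\<lambda>w. L (g w))) z = L (deriv (deriv g) z)" .
  have "partial_y (partial_y (\<lambda>w. L (g w))) z = partial_y (\<lambda>w. L (\<i> * deriv g w)) z"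
    using B(1)[OF P(1)[OF S(2) ig']] eq by (intro has_partials_at_cong(3)[OF S]) auto
  also have "\<dots> = L (\<i> * deriv (\<lambda>w. \<i> * deriv g w) z)"
    using B(3)[OF P(1)[OF S(2) ig']] P(3)[OF S(2) ig'] by simp
  also have "deriv (\<lambda>w. \<i> * deriv g w) z = \<i> * deriv (deriv g) z"
    using S g' by (intro deriv_cmult) (auto simp: holomorphic_on_open field_differentiable_def)
  also have "L (\<i> * (\<i> * deriv (deriv g) z)) = - L (deriv (deriv g) z)"
    using bounded_linear.linear[OF L] by (simp add: linear_neg flip: mult.assoc)
  finally show ?thesis unfolding laplacian_def xx by simp
qed

lemma abs_continuous_on_Lipschitz:
  fixes g :: "real \<Rightarrow> 'a::real_normed_vector"
  assumes "\<And>x y. x \<in> I \<Longrightarrow> y \<in> I \<Longrightarrow> x \<le> y \<Longrightarrow> norm (g y - g x) \<le> B * (y - x)"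
  shows "abs_continuous_on I g"
  unfolding abs_continuous_on_def
proof (intro allI impI)
  fix \<epsilon> :: real assume \<epsilon>: "\<epsilon> > 0"
  define C where "C = max B 0 + 1"
  have C: "C > 0" "B \<le> C" by (auto simp: C_def)
  show "\<exists>\<delta>>0. \<forall>(n::nat) a b. (\<forall>i<n. a i \<in> I \<and> b i \<in> I \<and> a i \<le> b i) \<and>
        disjoint_family_on (\<lambda>i. {a i<..<b i}) {..<n} \<and> (\<Sum>i<n. b i - a i) < \<delta> \<longrightarrow>
        (\<Sum>i<n. norm (g (b i) - g (a i))) < \<epsilon>"
  proof (intro exI[of _ "\<epsilon> / C"] conjI allI impI)
    show "\<epsilon> / C > 0" using \<epsilon> C by simp
    fix n :: nat and a b assume H: "(\<forall>i<n. a i \<in> I \<and> b i \<in> I \<and> a i \<le> b i) \<and>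
        disjoint_family_on (\<lambda>i. {a i<..<b i}) {..<n} \<and> (\<Sum>i<n. b i - a i) < \<epsilon> / C"
    have "(\<Sum>i<n. norm (g (b i) - g (a i))) \<le> (\<Sum>i<n. C * (b i - a i))"
    proof (rule sum_mono)
      fix i assume "i \<in> {..<n}"
      then have i: "a i \<in> I" "b i \<in> I" "a i \<le> b i" using H by auto
      have "norm (g (b i) - g (a i)) \<le> B * (b i - a i)" by (rule assms[OF i])
      also have "\<dots> \<le> C * (b i - a i)" using C i by (intro mult_right_mono) auto
      finally show "norm (g (b i) - g (a i)) \<le> C * (b i - a i)" .
    qed
    also have "\<dots> = C * (\<Sum>i<n. b i - a i)" by (simp add: sum_distrib_left)
    also have "\<dots> < C * (\<epsilon> / C)" using H C by (intro mult_strict_left_mono) auto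
    finally show "(\<Sum>i<n. norm (g (b i) - g (a i))) < \<epsilon>" using C by simp
  qed
qed

lemma continuous_imp_locally_L2_on:
  assumes "continuous_on S h" shows "locally_L2_on S h"
  unfolding locally_L2_on_def
proof (intro allI impI conjI; elim conjE)
  fix C assume C: "compact C" "C \<subseteq> S"
  have cont: "continuous_on C h" using assms C by (blast intro: continuous_on_subset)
  have borel: "C \<in> sets borel" using C by (simp add: borel_compact)
  show "set_borel_measurable lebesgue C h"
    unfolding set_borel_measurable_def
    using borel_measurable_continuous_on_indicator[OF borel cont] by (intro measurable_completion) simp
  have "integrable lborel (\<lambda>x. indicator C x *\<^sub>R (cmod (h x))\<^sup>2)"
    using C by (intro borel_integrable_compact continuous_intros cont)
  then show "set_integrable lebesgue C (\<lambda>z. (cmod (h z))\<^sup>2)"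
    unfolding set_integrable_def by (subst integrable_completion) auto
qed

lemma holomorphic_imp_ACL_on:
  assumes S: "open S" and g: "g holomorphic_on S"
  shows "ACL_on S g"
  unfolding ACL_on_def
proof (intro conjI allI impI)
  show "continuous_on S g" by (rule holomorphic_on_imp_continuous_on[OF g])
  fix w z :: complex assume box: "cbox w z \<subseteq> S"
  have "continuous_on (cbox w z) (deriv g)"
    using holomorphic_on_imp_continuous_on[OF holomorphic_deriv[OF g S]] box by (blast intro: continuous_on_subset)
  from compact_imp_bounded[OF compact_continuous_image[OF this compact_cbox]]
  have "\<exists>B. \<forall>x\<in>cbox w z. cmod (deriv g x) \<le> B" by (simp add: bounded_iff)
  then obtain B where B: "\<And>x. x \<in> cbox w z \<Longrightarrow> cmod (deriv g x) \<le> B" by auto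
  have lip: "cmod (g b - g a) \<le> B * cmod (b - a)" if "a \<in> cbox w z" "b \<in> cbox w z" for a b
  proof (rule field_differentiable_bound[where S = "cbox w z"])
    show "(g has_field_derivative deriv g x) (at x within cbox w z)" if "x \<in> cbox w z" for x
      using box that by (rule has_field_derivative_at_within[OF holomorphic_derivI[OF g S subsetD]])
    show "cmod (deriv g x) \<le> B" if "x \<in> cbox w z" for x by (rule B[OF that])
  qed (use that in \<open>simp_all add: convex_box\<close>)
  have eq: "Complex b y - Complex a y = of_real (b - a)" "Complex x b - Complex x a = \<i> * of_real (b - a)" for a b x y
    by (simp_all add: complex_eq_iff)
  have box_iff: "Complex x y \<in> cbox w z \<longleftrightarrow> x \<in> {Re w..Re z} \<and> y \<in> {Im w..Im z}" for x y
    by (simp add: in_cbox_complex_iff)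
  have "abs_continuous_on {Re w..Re z} (\<lambda>x. g (Complex x y))" if y: "y \<in> {Im w..Im z}" for y
  proof (rule abs_continuous_on_Lipschitz)
    fix a b :: real assume ab: "a \<in> {Re w..Re z}" "b \<in> {Re w..Re z}" "a \<le> b"
    have "cmod (g (Complex b y) - g (Complex a y)) \<le> B * cmod (Complex b y - Complex a y)"
      using ab y by (intro lip) (simp_all only: box_iff)
    then show "cmod (g (Complex b y) - g (Complex a y)) \<le> B * (b - a)"
      unfolding eq norm_of_real using ab by simp
  qed
  then show "AE y\<in>{Im w..Im z} in lebesgue. abs_continuous_on {Re w..Re z} (\<lambda>x. g (Complex x y))"
    by (intro AE_I2 impI)
  have "abs_continuous_on {Im w..Im z} (\<lambda>y. g (Complex x y))" if x: "x \<in> {Re w..Re z}" for x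
  proof (rule abs_continuous_on_Lipschitz)
    fix a b :: real assume ab: "a \<in> {Im w..Im z}" "b \<in> {Im w..Im z}" "a \<le> b"
    have "cmod (g (Complex x b) - g (Complex x a)) \<le> B * cmod (Complex x b - Complex x a)"
      using ab x by (intro lip) (simp_all only: box_iff)
    then show "cmod (g (Complex x b) - g (Complex x a)) \<le> B * (b - a)"
      unfolding eq norm_mult norm_of_real using ab by simp
  qed
  then show "AE x\<in>{Re w..Re z} in lebesgue. abs_continuous_on {Im w..Im z} (\<lambda>y. g (Complex x y))"
    by (intro AE_I2 impI)
qed

lemma holomorphic_imp_harmonic_quasiregular_on:
  assumes S: "open S" and g: "g holomorphic_on S" and K: "K \<ge> 1" "K0 \<ge> 0"
  shows "harmonic_quasiregular_on K K0 S g"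
proof -
  note C = holomorphic_imp_Ck_on[OF S g]
  have "continuous_on S (partial_x g)" "continuous_on S (partial_y g)" using C[of 1] by simp_all
  then have L2: "locally_L2_on S (partial_x g)" "locally_L2_on S (partial_y g)"
    using continuous_imp_locally_L2_on by blast+
  have dz: "d_z g z = deriv g z" "d_zbar g z = 0" if "z \<in> S" for z
    using holomorphic_has_partials[OF S that g] by (simp_all add: d_z_def d_zbar_def flip: mult.assoc)
  have J: "Jacobian g z \<ge> 0" "(Lambda g z)\<^sup>2 \<le> K * Jacobian g z + K0" if "z \<in> S" for z
    using K mult_right_mono[of 1 K "(cmod (deriv g z))\<^sup>2"] by (simp_all add: Jacobian_def Lambda_def dz[OF that])
  show ?thesis
    unfolding harmonic_quasiregular_on_def harmonic_on_def quasiregular_on_def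
    using C[of 2] L2 J holomorphic_imp_ACL_on[OF S g]
      laplacian_linear_holomorphic[OF S _ g bounded_linear_Re] laplacian_linear_holomorphic[OF S _ g bounded_linear_Im]
    by auto
qed

section \<open>An extremal function\<close>

lemma norm_complex_powr_real:
  assumes "z \<noteq> 0" shows "cmod (z powr of_real a) = cmod z powr a"
  using assms by (simp add: powr_def)

lemma norm_one_minus_circ_le: "cmod (1 - of_real r * circ t) \<le> (1 - r) + 7 * t" if "0 \<le> r" "r \<le> 1" "0 \<le> t" for r t
proof -
  have "(cmod (1 - circ t))\<^sup>2 = 2 - 2 * cos (2 * (pi * t))"
    unfolding cmod_power2 circ_def using sin_cos_squared_add[of "2 * pi * t"]
    by (simp add: power2_eq_square algebra_simps)
  also have "\<dots> = (2 * sin (pi * t))\<^sup>2" by (simp add: cos_double_sin power2_eq_square)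
  finally have "cmod (1 - circ t) = \<bar>2 * sin (pi * t)\<bar>"
    by (metis abs_norm_cancel power2_eq_iff abs_of_nonneg real_sqrt_abs)
  also have "\<dots> \<le> 2 * (pi * t)" using abs_sin_x_le_abs_x[of "pi * t"] that by (simp add: abs_mult)
  also have "\<dots> \<le> 7 * t" using pi_less_4 that pi_approx mult_right_mono[of "2 * pi" 7 t] by simp
  finally have *: "cmod (1 - circ t) \<le> 7 * t" .
  have "1 - of_real r * circ t = of_real (1 - r) + of_real r * (1 - circ t)" by (simp add: algebra_simps)
  then have "cmod (1 - of_real r * circ t) \<le> cmod (of_real (1 - r)) + cmod (of_real r * (1 - circ t))"
    by (metis norm_triangle_ineq)
  also have "\<dots> = (1 - r) + r * cmod (1 - circ t)" using that by (simp add: norm_mult del: of_real_diff)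
  also have "r * cmod (1 - circ t) \<le> 1 * (7 * t)" using * that by (intro mult_mono) auto
  finally show ?thesis by simp
qed

lemma sin_ge_half: "x / 2 \<le> sin x" if "0 \<le> x" "x \<le> pi / 3" for x :: real
proof -
  have "(\<lambda>x. sin x - x / 2) 0 \<le> (\<lambda>x. sin x - x / 2) x"
  proof (rule DERIV_nonneg_imp_nondecreasing[OF that(1)])
    fix y assume y: "0 \<le> y" "y \<le> x"
    have "cos (pi / 3) \<le> cos y" using y that by (intro cos_monotone_0_pi_le) auto
    then have "((\<lambda>x. sin x - x / 2) has_real_derivative cos y - 1 / 2) (at y) \<and> 0 \<le> cos y - 1 / 2"
      by (auto intro!: derivative_eq_intros simp: cos_60)
    then show "\<exists>d. ((\<lambda>x. sin x - x / 2) has_real_derivative d) (at y) \<and> 0 \<le> d" by blast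
  qed
  then show ?thesis by simp
qed

text \<open>Together with \<open>norm_one_minus_circ_le\<close> this says that the
  distance between 1 and \<open>r * circ t\<close> is comparable to
  \<open>(1 - r) + t\<close>. For small \<open>t\<close> the imaginary part provides
  the summand \<open>t\<close>; for larger \<open>t\<close> the real part is bounded
  below.\<close>

lemma norm_one_minus_circ_ge_left:
  assumes r: "1 / 2 \<le> r" "r < 1" and t: "0 \<le> t" "t \<le> 1 / 2"
  shows "((1 - r) + t) / 4 \<le> cmod (1 - of_real r * circ t)"
proof (cases "t \<le> 1 / 6")
  case True
  have "t \<le> r * (pi * t)"
    using mult_mono[of "1/2" r "2 * t" "pi * t"] r t pi_ge_two mult_right_mono[of 2 pi t] by simp
  also have "\<dots> \<le> r * sin (2 * pi * t)"
    using sin_ge_half[of "2 * pi * t"] True t r by (intro mult_left_mono) auto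
  also have "\<dots> \<le> cmod (1 - of_real r * circ t)"
    using abs_Im_le_cmod[of "1 - of_real r * circ t"] by (simp add: circ_def)
  finally have "t \<le> cmod (1 - of_real r * circ t)" .
  moreover have "1 - r \<le> cmod (1 - of_real r * circ t)"
    using norm_triangle_ineq2[of 1 "of_real r * circ t"] r by (simp add: norm_mult)
  ultimately show ?thesis using r t by simp
next
  case False
  have "cos (2 * pi * t) \<le> cos (pi / 3)"
    using False t by (intro cos_monotone_0_pi_le) (auto simp: field_simps)
  then have "cos (2 * pi * t) \<le> 1 / 2" by (simp add: cos_60)
  then have "r * cos (2 * pi * t) \<le> 1 * (1 / 2)"
  proof (cases "cos (2 * pi * t) \<ge> 0")
    case True
    then show ?thesis using \<open>cos (2 * pi * t) \<le> 1 / 2\<close> r by (intro mult_mono) auto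
  next
    case False
    then have "r * cos (2 * pi * t) \<le> 0" using r by (intro mult_nonneg_nonpos) auto
    then show ?thesis by simp
  qed
  then have "1 / 2 \<le> Re (1 - of_real r * circ t)" by (simp add: circ_def)
  then have "1 / 2 \<le> cmod (1 - of_real r * circ t)" using complex_Re_le_cmod order_trans by blast
  then show ?thesis using r t by simp
qed

lemma norm_one_minus_circ_powr_le:
  assumes r: "1 / 2 \<le> r" "r < 1" and t: "t \<in> {0..1}" and q: "q > 0"
  shows "cmod (1 - of_real r * circ t) powr (- q) \<le>
    4 powr q * (((1 - r) + t) powr (- q) + ((1 - r) + (1 - t)) powr (- q))"
proof -
  have *: "cmod (1 - of_real r * circ t) powr (- q) \<le> 4 powr q * ((1 - r) + t) powr (- q)"
    if "0 \<le> t" "t \<le> 1 / 2" for t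
  proof -
    have "cmod (1 - of_real r * circ t) powr (- q) \<le> (((1 - r) + t) / 4) powr (- q)"
      using norm_one_minus_circ_ge_left[OF r that] that r q by (intro powr_mono2') auto
    also have "\<dots> = 4 powr q * ((1 - r) + t) powr (- q)"
      by (simp add: powr_divide powr_minus field_simps)
    finally show ?thesis .
  qed
  show ?thesis
  proof (cases "t \<le> 1 / 2")
    case True
    have le: "4 powr q * ((1 - r) + t) powr (- q) \<le> 4 powr q * (((1 - r) + t) powr (- q) + ((1 - r) + (1 - t)) powr (- q))"
      by (intro mult_left_mono) auto
    show ?thesis by (rule order_trans[OF * le]) (use True t in auto)
  next
    case False
    have "1 - of_real r * circ t = cnj (1 - of_real r * circ (1 - t))"
      using circ_add[of 1 "- t"] by (simp add: circ_def cis_cnj)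
    then have eq: "cmod (1 - of_real r * circ t) = cmod (1 - of_real r * circ (1 - t))"
      by (metis complex_mod_cnj)
    have le: "4 powr q * ((1 - r) + (1 - t)) powr (- q) \<le> 4 powr q * (((1 - r) + t) powr (- q) + ((1 - r) + (1 - t)) powr (- q))"
      by (intro mult_left_mono) auto
    show ?thesis unfolding eq by (rule order_trans[OF * le]) (use False t in auto)
  qed
qed

lemma integral_shifted_powr_le:
  fixes a p :: real
  assumes a: "a > 0" and p: "p > 0"
  shows "integral {0..1} (\<lambda>t. (a + t) powr (- (1 + p))) \<le> a powr (- p) / p"
    "integral {0..1} (\<lambda>t. (a + (1 - t)) powr (- (1 + p))) \<le> a powr (- p) / p"
proof -
  have D: "((\<lambda>x. x powr (- p) / p) has_real_derivative - (x powr (- (1 + p)))) (at x)" if "x > 0" for x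
  proof -
    have "((\<lambda>x. x powr (- p) / p) has_real_derivative - p * x powr (- p - 1) / p) (at x)"
      by (intro DERIV_cdivide has_real_derivative_powr that)
    moreover have "- p - 1 = - (1 + p)" by simp
    ultimately show ?thesis using p by simp
  qed
  have "((\<lambda>t. (a + t) powr (- (1 + p))) has_integral - ((a + 1) powr (- p) / p) - (- ((a + 0) powr (- p) / p))) {0..1}"
  proof (rule fundamental_theorem_of_calculus)
    fix t :: real assume "t \<in> {0..1}"
    then have "((\<lambda>t. (a + t) powr (- p) / p) has_real_derivative - ((a + t) powr (- (1 + p))) * 1) (at t)"
      using a by (intro DERIV_chain2[OF D]) (auto intro!: derivative_eq_intros)
    from DERIV_minus[OF this]
    show "((\<lambda>t. - ((a + t) powr (- p) / p)) has_vector_derivative (a + t) powr (- (1 + p))) (at t within {0..1})"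
      by (simp add: has_real_derivative_iff_has_vector_derivative has_vector_derivative_at_within)
  qed simp
  from integral_unique[OF this] show "integral {0..1} (\<lambda>t. (a + t) powr (- (1 + p))) \<le> a powr (- p) / p"
    using p by simp
  have "((\<lambda>t. (a + (1 - t)) powr (- (1 + p))) has_integral (a + (1 - 1)) powr (- p) / p - (a + (1 - 0)) powr (- p) / p) {0..1}"
  proof (rule fundamental_theorem_of_calculus)
    fix t :: real assume "t \<in> {0..1}"
    then have "((\<lambda>t. (a + (1 - t)) powr (- p) / p) has_real_derivative - ((a + (1 - t)) powr (- (1 + p))) * (- 1)) (at t)"
      using a by (intro DERIV_chain2[OF D]) (auto intro!: derivative_eq_intros)
    then show "((\<lambda>t. (a + (1 - t)) powr (- p) / p) has_vector_derivative (a + (1 - t)) powr (- (1 + p))) (at t within {0..1})"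
      by (simp add: has_real_derivative_iff_has_vector_derivative has_vector_derivative_at_within)
  qed simp
  from integral_unique[OF this] show "integral {0..1} (\<lambda>t. (a + (1 - t)) powr (- (1 + p))) \<le> a powr (- p) / p"
    using p by simp
qed

lemma pmean_one_minus_powr:
  assumes "cmod w < 1"
  shows "pmean p (\<lambda>z. of_real c * (1 - z) powr of_real b) w = \<bar>c\<bar> powr p * integral {0..1} (\<lambda>t. cmod (1 - w * circ t) powr (b * p))"
proof -
  have "cmod (of_real c * (1 - w * circ t) powr of_real b) powr p = \<bar>c\<bar> powr p * cmod (1 - w * circ t) powr (b * p)" for t
  proof -
    have "1 - w * circ t \<noteq> 0"
    proof
      assume "1 - w * circ t = 0"
      then have "cmod (w * circ t) = 1" by simp
      then show False using assms by (simp add: norm_mult)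
    qed
    then show ?thesis by (simp add: norm_mult norm_complex_powr_real powr_mult powr_powr)
  qed
  then show ?thesis by (simp add: pmean_def)
qed

text \<open>For \<open>g = (1 - z)^(-1/p)\<close> one has
  \<open>|g|^p = 1 / |1 - z|\<close>, whose means grow like the logarithm, whereas
  \<open>|g'|^p\<close> is a multiple of \<open>|1 - z|^(-(1 + p))\<close>, whose
  means grow like \<open>(1 - r)^(-p)\<close>.\<close>

lemma one_minus_powr_example:
  fixes p :: real
  assumes p: "p > 0"
  defines "g \<equiv> \<lambda>z. (1 - z) powr of_real (- 1 / p)"
  shows "g holomorphic_on ball 0 1"
    and "\<And>r. 1 / 2 \<le> r \<Longrightarrow> r < 1 \<Longrightarrow> pmean p (deriv g) (of_real r) \<le> (1 / p) powr p * (2 * 4 powr (1 + p) / p) * (1 - r) powr (- p)"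
    and "\<And>r. 1 / 2 \<le> r \<Longrightarrow> r < 1 \<Longrightarrow> ln (1 / (1 - r)) / 7 \<le> pmean p g (of_real r)"
proof -
  have nonneg: "1 - z \<notin> \<real>\<^sub>\<le>\<^sub>0" if "cmod z < 1" for z
    using that complex_Re_le_cmod[of z] by (auto simp: complex_nonpos_Reals_iff)
  show hol: "g holomorphic_on ball 0 1"
    unfolding g_def using nonneg by (intro holomorphic_intros) auto
  have dg: "deriv g z = of_real (1 / p) * (1 - z) powr of_real (- 1 / p - 1)" if "cmod z < 1" for z
  proof -
    have "(g has_field_derivative of_real (1 / p) * (1 - z) powr of_real (- 1 / p - 1)) (at z)"
      unfolding g_def using nonneg[OF that] by (auto intro!: derivative_eq_intros)
    then show ?thesis by (rule DERIV_imp_deriv)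
  qed
  show "pmean p (deriv g) (of_real r) \<le> (1 / p) powr p * (2 * 4 powr (1 + p) / p) * (1 - r) powr (- p)"
    if r: "1 / 2 \<le> r" "r < 1" for r
  proof -
    have r': "cmod (of_real r) < 1" using r by simp
    have "pmean p (deriv g) (of_real r) = pmean p (\<lambda>z. of_real (1 / p) * (1 - z) powr of_real (- 1 / p - 1)) (of_real r)"
      unfolding pmean_def using r by (intro integral_cong) (subst dg, auto simp: norm_mult)
    also have "\<dots> = (1 / p) powr p * integral {0..1} (\<lambda>t. cmod (1 - of_real r * circ t) powr (- (1 + p)))"
    proof -
      have "(- 1 / p - 1) * p = - (1 + p)" using p by (simp add: field_simps)
      then show ?thesis unfolding pmean_one_minus_powr[OF r'] using p by simp
    qed
    also have "\<dots> \<le> (1 / p) powr p * (2 * 4 powr (1 + p) / p * (1 - r) powr (- p))"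
    proof (rule mult_left_mono)
      have c1: "continuous_on {0..1} (\<lambda>t. ((1 - r) + t) powr (- (1 + p)))"
        "continuous_on {0..1} (\<lambda>t. ((1 - r) + (1 - t)) powr (- (1 + p)))"
        using r by (auto intro!: continuous_on_powr continuous_intros)
      have nz: "cmod (1 - of_real r * circ t) \<noteq> 0" if "t \<in> {0..1}" for t
      proof -
        have "1 - r \<le> cmod (1 - of_real r * circ t)"
          using norm_triangle_ineq2[of 1 "of_real r * circ t"] r by (simp add: norm_mult)
        then show ?thesis using r by linarith
      qed
      have "integral {0..1} (\<lambda>t. cmod (1 - of_real r * circ t) powr (- (1 + p))) \<le>
        integral {0..1} (\<lambda>t. 4 powr (1 + p) * (((1 - r) + t) powr (- (1 + p)) + ((1 - r) + (1 - t)) powr (- (1 + p))))"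
        using r p nz by (intro integral_le integrable_continuous_interval continuous_on_mult continuous_on_add continuous_on_const c1
            norm_one_minus_circ_powr_le) (auto intro!: continuous_on_powr continuous_intros)
      also have "\<dots> = 4 powr (1 + p) * (integral {0..1} (\<lambda>t. ((1 - r) + t) powr (- (1 + p))) + integral {0..1} (\<lambda>t. ((1 - r) + (1 - t)) powr (- (1 + p))))"
        by (intro integral_unique has_integral_mult_right has_integral_add integrable_integral integrable_continuous_interval c1)
      also have "\<dots> \<le> 4 powr (1 + p) * ((1 - r) powr (- p) / p + (1 - r) powr (- p) / p)"
        using integral_shifted_powr_le[of "1 - r" p] r p by (intro mult_left_mono add_mono) auto
      finally show "integral {0..1} (\<lambda>t. cmod (1 - of_real r * circ t) powr (- (1 + p))) \<le> 2 * 4 powr (1 + p) / p * (1 - r) powr (- p)"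
        by (simp add: field_simps)
    qed auto
    finally show ?thesis by (simp add: mult.assoc)
  qed
  show "ln (1 / (1 - r)) / 7 \<le> pmean p g (of_real r)" if r: "1 / 2 \<le> r" "r < 1" for r
  proof -
    have r': "cmod (of_real r) < 1" using r by simp
    have D: "((\<lambda>t. 1 / ((1 - r) + 7 * t)) has_integral ln ((1 - r) + 7 * 1) / 7 - ln ((1 - r) + 7 * 0) / 7) {0..1}"
    proof (rule fundamental_theorem_of_calculus)
      fix t :: real assume "t \<in> {0..1}"
      then have "((\<lambda>t. ln ((1 - r) + 7 * t) / 7) has_real_derivative 1 / ((1 - r) + 7 * t)) (at t)"
        using r by (auto intro!: derivative_eq_intros simp: field_simps)
      then show "((\<lambda>t. ln ((1 - r) + 7 * t) / 7) has_vector_derivative 1 / ((1 - r) + 7 * t)) (at t within {0..1})"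
        by (simp add: has_real_derivative_iff_has_vector_derivative has_vector_derivative_at_within)
    qed simp
    have "ln (1 / (1 - r)) / 7 \<le> ln ((1 - r) + 7 * 1) / 7 - ln ((1 - r) + 7 * 0) / 7"
      using r ln_ge_zero[of "1 - r + 7"] by (simp add: ln_div)
    also have "\<dots> = integral {0..1} (\<lambda>t. 1 / ((1 - r) + 7 * t))" using integral_unique[OF D] by simp
    also have "\<dots> \<le> integral {0..1} (\<lambda>t. cmod (1 - of_real r * circ t) powr (- 1))"
    proof (rule integral_le)
      show "(\<lambda>t. 1 / ((1 - r) + 7 * t)) integrable_on {0..1}" using D by blast
      have nz: "cmod (1 - of_real r * circ t) > 0" for t
      proof -
        have "1 - r \<le> cmod (1 - of_real r * circ t)"
          using norm_triangle_ineq2[of 1 "of_real r * circ t"] r by (simp add: norm_mult)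
        then show ?thesis using r by linarith
      qed
      then show "(\<lambda>t. cmod (1 - of_real r * circ t) powr (- 1)) integrable_on {0..1}"
        by (intro integrable_continuous_interval continuous_on_powr continuous_intros) (metis less_irrefl)
      fix t :: real assume "t \<in> {0..1}"
      then show "1 / ((1 - r) + 7 * t) \<le> cmod (1 - of_real r * circ t) powr (- 1)"
        using norm_one_minus_circ_le[of r t] nz[of t] r
        by (simp add: powr_minus_divide divide_left_mono)
    qed
    also have "\<dots> = pmean p g (of_real r)"
      using pmean_one_minus_powr[OF r', of p 1 "- 1 / p"] p by (simp add: g_def)
    finally show ?thesis .
  qed
qed

section \<open>Passing between means and orders of growth\<close>

lemma pmean_cong:
  assumes "\<And>z. cmod z < 1 \<Longrightarrow> cmod (g z) = cmod (h z)" "cmod w < 1"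
  shows "pmean p g w = pmean p h w"
  unfolding pmean_def using assms by (intro integral_cong) (simp add: norm_mult)

lemma pmean_le_add:
  assumes p: "p > 0" and cont: "continuous_on (ball 0 1) f" "continuous_on (ball 0 1) g" "continuous_on (ball 0 1) h"
    and le: "\<And>z. cmod z < 1 \<Longrightarrow> cmod (f z) \<le> cmod (g z) + cmod (h z)" and w: "cmod w < 1"
  shows "pmean p f w \<le> 2 powr p * (pmean p g w + pmean p h w)"
proof -
  have int: "(\<lambda>t. cmod (k (w * circ t)) powr p) integrable_on {0..1}" if "continuous_on (ball 0 1) k" for k
    using that p w by (intro integrable_continuous_interval pmean_integrand_continuous)
  have "pmean p f w \<le> integral {0..1} (\<lambda>t. 2 powr p * (cmod (g (w * circ t)) powr p + cmod (h (w * circ t)) powr p))"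
    unfolding pmean_def
  proof (intro integral_le int cont integrable_on_mult_right Henstock_Kurzweil_Integration.integrable_add)
    fix t
    have "cmod (f (w * circ t)) powr p \<le> (cmod (of_real (cmod (g (w * circ t))) + of_real (cmod (h (w * circ t))))) powr p"
      using le[of "w * circ t"] w p by (intro powr_mono2) (auto simp: norm_mult simp flip: of_real_add)
    also have "\<dots> \<le> 2 powr p * (cmod (g (w * circ t)) powr p + cmod (h (w * circ t)) powr p)"
      using norm_powr_add_le[of p "of_real (cmod (g (w * circ t)))" "of_real (cmod (h (w * circ t)))"] p by simp
    finally show "cmod (f (w * circ t)) powr p \<le> 2 powr p * (cmod (g (w * circ t)) powr p + cmod (h (w * circ t)) powr p)" .
  qed
  also have "\<dots> = 2 powr p * (pmean p g w + pmean p h w)"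
    unfolding pmean_def by (intro integral_unique has_integral_mult_right has_integral_add integrable_integral int cont)
  finally show ?thesis .
qed

lemma integral_mean_bigo:
  fixes \<omega> :: "real \<Rightarrow> real"
  assumes p: "p > 0" and b: "b < 1" and \<omega>: "\<And>r. b < r \<Longrightarrow> r < 1 \<Longrightarrow> 0 \<le> \<omega> r"
    and le: "\<And>r. b < r \<Longrightarrow> r < 1 \<Longrightarrow> pmean p g (of_real r) \<le> C * \<omega> r powr p"
  shows "(\<lambda>r. integral_mean p r g) \<in> O[at_left 1](\<omega>)"
proof (rule bigoI[of _ "\<bar>C\<bar> powr (1 / p)"])
  have "norm (integral_mean p r g) \<le> \<bar>C\<bar> powr (1 / p) * norm (\<omega> r)" if r: "b < r" "r < 1" for r
  proof -
    have "C * \<omega> r powr p \<le> \<bar>C\<bar> * \<omega> r powr p" by (intro mult_right_mono) auto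
    then have "pmean p g (of_real r) powr (1 / p) \<le> (\<bar>C\<bar> * \<omega> r powr p) powr (1 / p)"
      using le[OF r] p pmean_nonneg by (intro powr_mono2) auto
    also have "\<dots> = \<bar>C\<bar> powr (1 / p) * (\<omega> r powr p) powr (1 / p)" by (rule powr_mult)
    also have "(\<omega> r powr p) powr (1 / p) = \<omega> r" using p \<omega>[OF r] by (simp add: powr_powr)
    finally show ?thesis using \<omega>[OF r] by (simp add: integral_mean_eq_pmean)
  qed
  then show "\<forall>\<^sub>F r in at_left 1. norm (integral_mean p r g) \<le> \<bar>C\<bar> powr (1 / p) * norm (\<omega> r)"
    unfolding eventually_at_left_field using b by blast
qed

lemma bigo_integral_meanD:
  fixes \<omega> :: "real \<Rightarrow> real"
  assumes p: "p > 0" and \<omega>: "\<And>r. 0 \<le> r \<Longrightarrow> r < 1 \<Longrightarrow> 0 \<le> \<omega> r"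
    and O: "(\<lambda>r. integral_mean p r g) \<in> O[at_left 1](\<omega>)"
  shows "\<exists>C b. 0 \<le> C \<and> 0 \<le> b \<and> b < 1 \<and> (\<forall>r. b < r \<longrightarrow> r < 1 \<longrightarrow> pmean p g (of_real r) \<le> (C * \<omega> r) powr p)"
proof -
  obtain C where C: "C > 0" "\<forall>\<^sub>F r in at_left 1. norm (integral_mean p r g) \<le> C * norm (\<omega> r)"
    using O unfolding bigo_def by blast
  then obtain b where b: "b < 1" "\<And>r. b < r \<Longrightarrow> r < 1 \<Longrightarrow> norm (integral_mean p r g) \<le> C * norm (\<omega> r)"
    unfolding eventually_at_left_field by blast
  have "pmean p g (of_real r) \<le> (C * \<omega> r) powr p" if "max b 0 < r" "r < 1" for r
  proof -
    have "pmean p g (of_real r) powr (1 / p) \<le> C * \<omega> r"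
      using b(2)[of r] \<omega>[of r] that by (simp add: integral_mean_eq_pmean)
    then have "(pmean p g (of_real r) powr (1 / p)) powr p \<le> (C * \<omega> r) powr p"
      using p by (intro powr_mono2) auto
    then show ?thesis using p pmean_nonneg[of p g "of_real r"] by (simp add: powr_powr)
  qed
  then show ?thesis using C b by (intro exI[of _ C] exI[of _ "max b 0"]) auto
qed

text \<open>A Landau bound concerns radii near 1 only. On the remaining compact set of
  radii the means are bounded and \<open>\<eta>\<close> is bounded below, so a larger
  constant gives a bound on the whole disc, as required by estimates that integrate from
  the origin.\<close>

lemma pmean_global_bound:
  fixes \<eta> :: "real \<Rightarrow> real"
  assumes p: "p > 0" and cont: "continuous_on (ball 0 1) H" and c: "c > 0" and \<eta>: "\<And>r. 0 \<le> r \<Longrightarrow> r < 1 \<Longrightarrow> c \<le> \<eta> r"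
    and O: "(\<lambda>r. integral_mean p r H) \<in> O[at_left 1](\<eta>)"
  shows "\<exists>N\<ge>0. \<forall>w. cmod w < 1 \<longrightarrow> pmean p H w \<le> (N * \<eta> (cmod w)) powr p"
proof -
  have \<eta>0: "0 \<le> \<eta> r" if "0 \<le> r" "r < 1" for r using \<eta>[OF that] c by linarith
  obtain C b where C: "0 \<le> C" "0 \<le> b" "b < 1" "\<And>r. b < r \<Longrightarrow> r < 1 \<Longrightarrow> pmean p H (of_real r) \<le> (C * \<eta> r) powr p"
    using bigo_integral_meanD[OF p \<eta>0 O] by blast
  have "continuous_on {0..b} (\<lambda>r. pmean p H (of_real r))"
    using C p by (intro continuous_on_pmean[OF cont] continuous_intros) auto
  then have "bounded ((\<lambda>r. pmean p H (of_real r)) ` {0..b})"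
    by (intro compact_imp_bounded compact_continuous_image) auto
  then have "\<exists>M. \<forall>r\<in>{0..b}. \<bar>pmean p H (of_real r)\<bar> \<le> M" by (simp add: bounded_iff)
  then obtain M where "\<forall>r\<in>{0..b}. \<bar>pmean p H (of_real r)\<bar> \<le> M" by blast
  then have M: "pmean p H (of_real r) \<le> M" if "r \<in> {0..b}" for r
    using that pmean_nonneg[of p H "of_real r"] by fastforce
  define M' where "M' = max M 0"
  define N where "N = max C (M' powr (1 / p) / c)"
  have "pmean p H w \<le> (N * \<eta> (cmod w)) powr p" if w: "cmod w < 1" for w
  proof (cases "b < cmod w")
    case True
    have "pmean p H w \<le> (C * \<eta> (cmod w)) powr p"
      using C(4)[OF True w] pmean_norm[OF cont p w] by simp
    also have "\<dots> \<le> (N * \<eta> (cmod w)) powr p"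
      using p C \<eta>0[OF _ w] by (intro powr_mono2 mult_right_mono) (auto simp: N_def)
    finally show ?thesis .
  next
    case False
    have "M' = (M' powr (1 / p)) powr p" using p by (simp add: powr_powr M'_def)
    have "pmean p H w \<le> M'"
      using M[of "cmod w"] False pmean_norm[OF cont p w] by (simp add: M'_def)
    also have "M' = (M' powr (1 / p)) powr p" using p by (simp add: powr_powr M'_def)
    also have "\<dots> \<le> (N * \<eta> (cmod w)) powr p"
    proof (intro powr_mono2)
      have "M' powr (1 / p) = M' powr (1 / p) / c * c" using c by simp
      also have "\<dots> \<le> N * \<eta> (cmod w)"
      proof (rule mult_mono)
        show "M' powr (1 / p) / c \<le> N" by (simp add: N_def)
        show "0 \<le> N" using C by (simp add: N_def)
        show "c \<le> \<eta> (cmod w)" using \<eta>[OF _ w] by simp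
      qed (use c in simp)
      finally show "M' powr (1 / p) \<le> N * \<eta> (cmod w)" .
    qed (use p in auto)
    finally show ?thesis .
  qed
  then show ?thesis using C by (intro exI[of _ N]) (auto simp: N_def)
qed

section \<open>Growth of harmonic quasiregular mappings\<close>

text \<open>Real and imaginary part are real parts of two holomorphic functions, and the
  derivative of the second is controlled by that of the first. All growth questions for
  the mapping are thereby questions on holomorphic functions.\<close>

lemma harmonic_quasiregular_decomposition:
  assumes K: "K \<ge> 1" and K0: "K0 \<ge> 0" and f: "\<And>z. f z = Complex (u z) (v z)"
    and qr: "harmonic_quasiregular_on K K0 unit_disc f"
  obtains F G where "F holomorphic_on ball 0 1" "G holomorphic_on ball 0 1"
    "\<And>z. cmod z < 1 \<Longrightarrow> u z = Re (F z)" "\<And>z. cmod z < 1 \<Longrightarrow> v z = Re (G z)"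
    "\<And>z. cmod z < 1 \<Longrightarrow> gradient u z = cnj (deriv F z)"
    "\<And>z. cmod z < 1 \<Longrightarrow> cmod (deriv G z) \<le> K * cmod (deriv F z) + sqrt K0"
proof -
  have u: "u = (\<lambda>z. Re (f z))" and v: "v = (\<lambda>z. Im (f z))" by (auto simp: f)
  have C2: "Ck_on 2 (ball 0 1) f" and lap: "\<And>z. z \<in> ball 0 1 \<Longrightarrow> laplacian u z = 0" "\<And>z. z \<in> ball 0 1 \<Longrightarrow> laplacian v z = 0"
    and qr': "quasiregular_on K K0 (ball 0 1) f"
    using qr by (auto simp: harmonic_quasiregular_on_def harmonic_on_def u v)
  have Cu: "Ck_on 2 (ball 0 1) u" "Ck_on 2 (ball 0 1) v"
    unfolding u v using Ck_on_bounded_linear[OF open_ball bounded_linear_Re C2] Ck_on_bounded_linear[OF open_ball bounded_linear_Im C2]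
    by simp_all
  have ball_ne: "ball 0 1 \<noteq> ({} :: complex set)" by simp
  obtain F where F: "F holomorphic_on ball 0 1" "\<And>z. z \<in> ball 0 1 \<Longrightarrow> u z = Re (F z) \<and> deriv F z = cnj (gradient u z)"
    using harmonic_eq_Re_holomorphic[OF open_ball convex_ball ball_ne Cu(1) lap(1)] by blast
  obtain G where G: "G holomorphic_on ball 0 1" "\<And>z. z \<in> ball 0 1 \<Longrightarrow> v z = Re (G z) \<and> deriv G z = cnj (gradient v z)"
    using harmonic_eq_Re_holomorphic[OF open_ball convex_ball ball_ne Cu(2) lap(2)] by blast
  have C1: "Ck_on 1 (ball 0 1) f" using C2 by (simp add: numeral_2_eq_2)
  show thesis
  proof (rule that[OF F(1) G(1)])
    fix z assume "cmod z < 1"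
    then have z: "z \<in> ball 0 1" by simp
    show "u z = Re (F z)" "v z = Re (G z)" using F(2)[OF z] G(2)[OF z] by auto
    show "gradient u z = cnj (deriv F z)" using F(2)[OF z] by simp
    show "cmod (deriv G z) \<le> K * cmod (deriv F z) + sqrt K0"
      using quasiregular_gradient_bound[OF open_ball K0 _ C1 qr' z] K F(2)[OF z] G(2)[OF z] by (simp add: u v)
  qed
qed

text \<open>The additive constant \<open>sqrt K0\<close> is absorbed into a multiple of
  \<open>\<eta>\<close>, which is bounded below.\<close>

lemma pmean_deriv_transfer:
  fixes \<eta> :: "real \<Rightarrow> real"
  assumes p: "p > 0" and hol: "F holomorphic_on ball 0 1" "G holomorphic_on ball 0 1" and K: "K \<ge> 0" "K0 \<ge> 0"
    and le: "\<And>z. cmod z < 1 \<Longrightarrow> cmod (deriv G z) \<le> K * cmod (deriv F z) + sqrt K0"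
    and c: "c > 0" and \<eta>: "\<And>r. 0 \<le> r \<Longrightarrow> r < 1 \<Longrightarrow> c \<le> \<eta> r" and N: "N \<ge> 0"
    and bound: "\<And>w. cmod w < 1 \<Longrightarrow> pmean p (deriv F) w \<le> (N * \<eta> (cmod w)) powr p"
  shows "\<exists>N'\<ge>0. \<forall>w. cmod w < 1 \<longrightarrow> pmean p (deriv G) w \<le> (N' * \<eta> (cmod w)) powr p"
proof -
  define D where "D = 2 powr p * ((K * N) powr p + (sqrt K0 / c) powr p)"
  have D: "D \<ge> 0" by (simp add: D_def)
  have cont: "continuous_on (ball 0 1) (deriv F)" "continuous_on (ball 0 1) (deriv G)"
    using hol by (auto intro!: holomorphic_on_imp_continuous_on holomorphic_deriv)
  have "pmean p (deriv G) w \<le> (D powr (1 / p) * \<eta> (cmod w)) powr p" if w: "cmod w < 1" for w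
  proof -
    have \<eta>w: "c \<le> \<eta> (cmod w)" using \<eta>[OF _ w] by simp
    have "pmean p (deriv G) w \<le> 2 powr p * (pmean p (\<lambda>z. of_real K * deriv F z) w + pmean p (\<lambda>z. of_real (sqrt K0)) w)"
      using p K le w by (intro pmean_le_add cont continuous_intros) (auto simp: norm_mult)
    also have "pmean p (\<lambda>z. of_real K * deriv F z) w = K powr p * pmean p (deriv F) w"
      using K by (simp add: pmean_def norm_mult powr_mult)
    also have "pmean p (\<lambda>z. of_real (sqrt K0)) w = sqrt K0 powr p"
      using K by (simp add: pmean_def)
    also have "2 powr p * (K powr p * pmean p (deriv F) w + sqrt K0 powr p) \<le>
        2 powr p * (K powr p * (N * \<eta> (cmod w)) powr p + (sqrt K0 / c * \<eta> (cmod w)) powr p)"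
    proof (intro mult_left_mono add_mono bound w)
      have "sqrt K0 = sqrt K0 / c * c" using c by simp
      also have "\<dots> \<le> sqrt K0 / c * \<eta> (cmod w)" using \<eta>w c K by (intro mult_left_mono) auto
      finally show "sqrt K0 powr p \<le> (sqrt K0 / c * \<eta> (cmod w)) powr p" using p K by (intro powr_mono2) auto
    qed auto
    also have "\<dots> = D * \<eta> (cmod w) powr p"
      by (simp only: D_def powr_mult) (simp add: algebra_simps)
    also have "\<dots> = (D powr (1 / p)) powr p * \<eta> (cmod w) powr p" using p D by (simp add: powr_powr)
    finally show ?thesis by (simp only: powr_mult)
  qed
  then show ?thesis by (intro exI[of _ "D powr (1 / p)"]) auto
qed

lemma weight_lower_bound:
  assumes "weight \<eta>" "0 \<le> r" "r < 1"
  shows "0 < \<eta> 0" "\<eta> 0 \<le> \<eta> r"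
proof -
  show "0 < \<eta> 0" using assms by (simp add: weight_def)
  show "\<eta> 0 \<le> \<eta> r" using assms by (intro mono_onD[of "{0..<1}" \<eta>]) (auto simp: weight_def)
qed

text \<open>For \<open>q = 2\<close> this is the square of
  \<open>Phi_of \<eta>\<close>, and for \<open>q = p\<close> it is bounded by the
  \<open>p\<close>-th power of \<open>Psi_of p \<eta>\<close>.\<close>

definition weighted_integral :: "real \<Rightarrow> (real \<Rightarrow> real) \<Rightarrow> real \<Rightarrow> real" where
  "weighted_integral q \<eta> r = integral {0..r} (\<lambda>\<rho>. (1 - \<rho>) powr (q - 1) * \<eta> \<rho> powr q)"

lemma weighted_integrable:
  assumes "weight \<eta>" "q \<ge> 1" "r < 1"
  shows "(\<lambda>\<rho>. (1 - \<rho>) powr (q - 1) * \<eta> \<rho> powr q) integrable_on {0..r}"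
proof -
  have "continuous_on {0..r} \<eta>"
    by (rule continuous_on_subset[of "{0..<1}" \<eta>]) (use assms in \<open>auto simp: weight_def\<close>)
  moreover have "0 \<le> \<eta> x" if "x \<in> {0..r}" for x
  proof -
    have "0 \<le> x" "x < 1" using that assms by auto
    then show ?thesis using weight_lower_bound[OF assms(1), of x] by linarith
  qed
  ultimately have "continuous_on {0..r} (\<lambda>\<rho>. \<eta> \<rho> powr q)"
    using assms(2) by (intro continuous_on_powr' continuous_on_const) auto
  moreover have "continuous_on {0..r} (\<lambda>\<rho>. (1 - \<rho>) powr (q - 1))"
    using assms by (intro continuous_on_powr continuous_on_diff continuous_on_const continuous_on_id) auto
  ultimately show ?thesis
    by (intro integrable_continuous_interval continuous_on_mult)
qed

text \<open>A positive lower bound, independent of \<open>r\<close>, by which additive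
  constants are absorbed into multiples of the integral.\<close>

lemma weighted_integral_ge:
  assumes \<eta>: "weight \<eta>" and q: "q \<ge> 1" and r: "1 / 2 \<le> r" "r < 1"
  shows "(1 / 2) powr q * \<eta> 0 powr q \<le> weighted_integral q \<eta> r"
proof -
  have "(1 / 2) powr q * \<eta> 0 powr q = integral {0..1/2} (\<lambda>\<rho>::real. (1 / 2) powr (q - 1) * \<eta> 0 powr q)"
    by (simp add: powr_diff)
  also have "\<dots> \<le> integral {0..1/2} (\<lambda>\<rho>. (1 - \<rho>) powr (q - 1) * \<eta> \<rho> powr q)"
  proof (rule integral_le)
    show "(\<lambda>\<rho>. (1 - \<rho>) powr (q - 1) * \<eta> \<rho> powr q) integrable_on {0..1/2}"
      by (rule weighted_integrable[OF \<eta> q]) simp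
    fix \<rho> :: real assume "\<rho> \<in> {0..1/2}"
    then show "(1 / 2) powr (q - 1) * \<eta> 0 powr q \<le> (1 - \<rho>) powr (q - 1) * \<eta> \<rho> powr q"
      using weight_lower_bound[OF \<eta>, of \<rho>] q by (intro mult_mono powr_mono2) auto
  qed auto
  also have "\<dots> \<le> weighted_integral q \<eta> r"
    unfolding weighted_integral_def using r by (intro integral_subset_le weighted_integrable[OF \<eta> q]) auto
  finally show ?thesis .
qed

lemma pmean_growth_weighted:
  fixes p :: real
  assumes p: "p > 1" and hol: "F holomorphic_on ball 0 1" and \<eta>: "weight \<eta>" and N: "N \<ge> 0"
    and bound: "\<And>w. cmod w < 1 \<Longrightarrow> pmean p (deriv F) w \<le> (N * \<eta> (cmod w)) powr p"
  defines "q \<equiv> min p 2"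
  shows "\<exists>C\<ge>0. \<forall>r. 1 / 2 < r \<longrightarrow> r < 1 \<longrightarrow> pmean p F (of_real r) \<le> C * weighted_integral q \<eta> r powr (p / q)"
proof -
  have q: "q \<ge> 1" "q > 0" using p by (auto simp: q_def)
  have \<eta>': "continuous_on {0..<1} \<eta>" "mono_on {0..<1} \<eta>" "\<And>\<rho>. \<rho> \<in> {0..<1} \<Longrightarrow> 0 \<le> \<eta> \<rho>"
    using \<eta> by (auto simp: weight_def intro: less_imp_le)
  obtain D K where K: "0 \<le> K" and D: "\<And>r. 1 / 2 < r \<Longrightarrow> r < 1 \<Longrightarrow>
      pmean p F (of_real r) powr (q / p) \<le> D + K * weighted_integral q \<eta> r"
    using pmean_growth[OF p hol N \<eta>' bound] unfolding q_def[symmetric] weighted_integral_def[symmetric] by auto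
  define c where "c = (1 / 2) powr q * \<eta> 0 powr q"
  have c: "c > 0" using weight_lower_bound[OF \<eta>, of 0] by (simp add: c_def)
  define C where "C = (\<bar>D\<bar> / c + K) powr (p / q)"
  have "pmean p F (of_real r) \<le> C * weighted_integral q \<eta> r powr (p / q)" if r: "1 / 2 < r" "r < 1" for r
  proof -
    have cI: "c \<le> weighted_integral q \<eta> r" unfolding c_def using r by (intro weighted_integral_ge[OF \<eta> q(1)]) auto
    have "D \<le> \<bar>D\<bar> / c * c" using c by simp
    also have "\<dots> \<le> \<bar>D\<bar> / c * weighted_integral q \<eta> r" using cI c by (intro mult_left_mono) auto
    finally have "pmean p F (of_real r) powr (q / p) \<le> (\<bar>D\<bar> / c + K) * weighted_integral q \<eta> r"
      using D[OF r] by (simp add: distrib_right)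
    then have "(pmean p F (of_real r) powr (q / p)) powr (p / q) \<le> ((\<bar>D\<bar> / c + K) * weighted_integral q \<eta> r) powr (p / q)"
      using p q by (intro powr_mono2) auto
    also have "\<dots> = C * weighted_integral q \<eta> r powr (p / q)" unfolding C_def by (rule powr_mult)
    also have "(pmean p F (of_real r) powr (q / p)) powr (p / q) = pmean p F (of_real r)"
      using p q pmean_nonneg[of p F "of_real r"] by (simp add: powr_powr)
    finally show ?thesis .
  qed
  then show ?thesis by (intro exI[of _ C]) (auto simp: C_def)
qed

context
  fixes K K0 :: real and f F G :: "complex \<Rightarrow> complex" and u v :: "complex \<Rightarrow> real"
  assumes K: "K \<ge> 1" "K0 \<ge> 0" and f: "\<And>z. f z = Complex (u z) (v z)"
    and hol: "F holomorphic_on ball 0 1" "G holomorphic_on ball 0 1"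
    and u: "\<And>z. cmod z < 1 \<Longrightarrow> u z = Re (F z)" and v: "\<And>z. cmod z < 1 \<Longrightarrow> v z = Re (G z)"
    and grad: "\<And>z. cmod z < 1 \<Longrightarrow> gradient u z = cnj (deriv F z)"
    and derivG: "\<And>z. cmod z < 1 \<Longrightarrow> cmod (deriv G z) \<le> K * cmod (deriv F z) + sqrt K0"
begin

lemma continuous_mapping: "continuous_on (ball 0 1) f"
proof -
  have "continuous_on (ball 0 1) (\<lambda>z. Complex (Re (F z)) (Re (G z)))"
    using hol by (intro continuous_intros holomorphic_on_imp_continuous_on)
  then show ?thesis by (rule continuous_on_eq) (simp add: f u v)
qed

lemma continuous_gradient: "continuous_on (ball 0 1) (gradient u)"
proof -
  have "continuous_on (ball 0 1) (\<lambda>z. cnj (deriv F z))"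
    using hol by (intro continuous_intros holomorphic_on_imp_continuous_on holomorphic_deriv) auto
  then show ?thesis by (rule continuous_on_eq) (simp add: grad)
qed

lemma pmean_gradient: "cmod w < 1 \<Longrightarrow> pmean p (gradient u) w = pmean p (deriv F) w"
  by (rule pmean_cong) (auto simp: grad)

lemma pmean_mapping_le:
  assumes "p > 0" "0 \<le> r" "r < 1"
  shows "pmean p f (of_real r) \<le> 2 powr p * (pmean p F (of_real r) + pmean p G (of_real r))"
proof (rule pmean_le_add[OF assms(1) continuous_mapping])
  fix z :: complex assume "cmod z < 1"
  then have "cmod (f z) \<le> \<bar>Re (F z)\<bar> + \<bar>Re (G z)\<bar>" using cmod_le[of "f z"] by (simp add: f u v)
  also have "\<dots> \<le> cmod (F z) + cmod (G z)" by (intro add_mono abs_Re_le_cmod)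
  finally show "cmod (f z) \<le> cmod (F z) + cmod (G z)" .
qed (use assms hol in \<open>auto intro: holomorphic_on_imp_continuous_on\<close>)

lemma derivative_bounds:
  fixes \<eta> :: "real \<Rightarrow> real"
  assumes p: "p > 0" and c: "c > 0" and \<eta>: "\<And>r. 0 \<le> r \<Longrightarrow> r < 1 \<Longrightarrow> c \<le> \<eta> r"
    and O: "(\<lambda>r. integral_mean p r (gradient u)) \<in> O[at_left 1](\<eta>)"
  obtains M N where "0 \<le> M" "\<And>w. cmod w < 1 \<Longrightarrow> pmean p (deriv F) w \<le> (M * \<eta> (cmod w)) powr p"
    "0 \<le> N" "\<And>w. cmod w < 1 \<Longrightarrow> pmean p (deriv G) w \<le> (N * \<eta> (cmod w)) powr p"
proof -
  obtain M where M: "M \<ge> 0" "\<And>w. cmod w < 1 \<Longrightarrow> pmean p (deriv F) w \<le> (M * \<eta> (cmod w)) powr p"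
    using pmean_global_bound[OF p continuous_gradient c \<eta> O] pmean_gradient[of _ p] by auto
  obtain N where "N \<ge> 0" "\<And>w. cmod w < 1 \<Longrightarrow> pmean p (deriv G) w \<le> (N * \<eta> (cmod w)) powr p"
    using pmean_deriv_transfer[OF p hol _ K(2) derivG c \<eta> M] K(1) by auto
  with M show thesis by (rule that)
qed

lemma growth_p_le_1:
  assumes p: "0 < p" "p \<le> 1" and O: "(\<lambda>r. integral_mean p r (gradient u)) \<in> O[at_left 1](\<lambda>r. 1 / (1 - r))"
  shows "(\<lambda>r. integral_mean p r f) \<in> O[at_left 1](\<lambda>r. ln (1 / (1 - r)) powr (1 / p))"
proof -
  have \<eta>: "1 \<le> 1 / (1 - r)" if "0 \<le> r" "r < 1" for r :: real using that by simp
  obtain M N where MN: "0 \<le> M" "\<And>w. cmod w < 1 \<Longrightarrow> pmean p (deriv F) w \<le> (M * (1 / (1 - cmod w))) powr p"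
    "0 \<le> N" "\<And>w. cmod w < 1 \<Longrightarrow> pmean p (deriv G) w \<le> (N * (1 / (1 - cmod w))) powr p"
    using derivative_bounds[OF p(1) zero_less_one \<eta> O] by blast
  obtain A where A: "\<forall>r\<in>{1/2..<1}. pmean p F (of_real r) \<le> A * ln (1 / (1 - r))"
    using pmean_log_growth[OF p hol(1), of M] MN by auto
  obtain B where B: "\<forall>r\<in>{1/2..<1}. pmean p G (of_real r) \<le> B * ln (1 / (1 - r))"
    using pmean_log_growth[OF p hol(2), of N] MN by auto
  show ?thesis
  proof (rule integral_mean_bigo[OF p(1), of "1/2"])
    fix r :: real assume r: "1 / 2 < r" "r < 1"
    have "pmean p f (of_real r) \<le> 2 powr p * (pmean p F (of_real r) + pmean p G (of_real r))"
      using r p by (intro pmean_mapping_le) auto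
    also have "\<dots> \<le> 2 powr p * (A * ln (1 / (1 - r)) + B * ln (1 / (1 - r)))"
      using A B r by (intro mult_left_mono add_mono) auto
    also have "\<dots> = 2 powr p * (A + B) * ln (1 / (1 - r))" by (simp add: algebra_simps)
    also have "ln (1 / (1 - r)) = (ln (1 / (1 - r)) powr (1 / p)) powr p"
      using r p ln_ge_zero[of "1 / (1 - r)"] by (simp add: powr_powr)
    finally show "pmean p f (of_real r) \<le> 2 powr p * (A + B) * (ln (1 / (1 - r)) powr (1 / p)) powr p" .
  qed auto
qed

lemma growth_p_gt_1:
  assumes p: "p > 1" and \<eta>: "weight \<eta>" and O: "(\<lambda>r. integral_mean p r (gradient u)) \<in> O[at_left 1](\<eta>)"
    and \<omega>: "\<And>r. 1 / 2 < r \<Longrightarrow> r < 1 \<Longrightarrow> 0 \<le> \<omega> r"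
      "\<And>r. 1 / 2 < r \<Longrightarrow> r < 1 \<Longrightarrow> weighted_integral (min p 2) \<eta> r powr (p / min p 2) \<le> \<omega> r powr p"
  shows "(\<lambda>r. integral_mean p r f) \<in> O[at_left 1](\<omega>)"
proof -
  have p0: "p > 0" using p by simp
  obtain M N where MN: "0 \<le> M" "\<And>w. cmod w < 1 \<Longrightarrow> pmean p (deriv F) w \<le> (M * \<eta> (cmod w)) powr p"
    "0 \<le> N" "\<And>w. cmod w < 1 \<Longrightarrow> pmean p (deriv G) w \<le> (N * \<eta> (cmod w)) powr p"
    using derivative_bounds[OF p0 weight_lower_bound(1)[OF \<eta> order_refl zero_less_one] weight_lower_bound(2)[OF \<eta>] O]
    by blast
  obtain A where A: "A \<ge> 0" "\<And>r. 1 / 2 < r \<Longrightarrow> r < 1 \<Longrightarrow>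
      pmean p F (of_real r) \<le> A * weighted_integral (min p 2) \<eta> r powr (p / min p 2)"
    using pmean_growth_weighted[OF p hol(1) \<eta> MN(1,2)] by blast
  obtain B where B: "B \<ge> 0" "\<And>r. 1 / 2 < r \<Longrightarrow> r < 1 \<Longrightarrow>
      pmean p G (of_real r) \<le> B * weighted_integral (min p 2) \<eta> r powr (p / min p 2)"
    using pmean_growth_weighted[OF p hol(2) \<eta> MN(3,4)] by blast
  show ?thesis
  proof (rule integral_mean_bigo[OF p0, of "1/2"])
    fix r :: real assume r: "1 / 2 < r" "r < 1"
    have "pmean p f (of_real r) \<le> 2 powr p * (pmean p F (of_real r) + pmean p G (of_real r))"
      using r p by (intro pmean_mapping_le) auto
    also have "\<dots> \<le> 2 powr p * (A * weighted_integral (min p 2) \<eta> r powr (p / min p 2) + B * weighted_integral (min p 2) \<eta> r powr (p / min p 2))"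
      using A(2)[OF r] B(2)[OF r] by (intro mult_left_mono add_mono) auto
    also have "\<dots> = 2 powr p * (A + B) * weighted_integral (min p 2) \<eta> r powr (p / min p 2)" by (simp add: algebra_simps)
    also have "\<dots> \<le> 2 powr p * (A + B) * \<omega> r powr p"
      using \<omega>(2)[OF r] A(1) B(1) by (intro mult_left_mono) auto
    finally show "pmean p f (of_real r) \<le> 2 powr p * (A + B) * \<omega> r powr p" .
  qed (use \<omega> in auto)
qed

text \<open>The choice \<open>\<delta> = (1 - r) / 2\<close> turns
  \<open>pmean_deriv_le\<close> into the factor \<open>4 / (1 - r)\<close>, and the
  outer radius \<open>r + \<delta>\<close> is the one at which the doubling condition
  compares the weight with its value at \<open>r\<close>.\<close>

lemma gradient_growth:
  assumes p: "p > 1" and \<Psi>: "doubling_weight \<Psi>" and O: "(\<lambda>r. integral_mean p r f) \<in> O[at_left 1](\<Psi>)"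
  shows "(\<lambda>r. integral_mean p r (gradient u)) \<in> O[at_left 1](\<lambda>r. \<Psi> r / (1 - r))"
proof -
  have p0: "p > 0" using p by simp
  have w: "weight \<Psi>" using \<Psi> by (simp add: doubling_weight_def)
  have \<Psi>0: "0 \<le> \<Psi> r" if "0 \<le> r" "r < 1" for r
    using weight_lower_bound[OF w that] by linarith
  obtain C' where C': "C' > 1" "\<And>s. s \<in> {0<..1} \<Longrightarrow> \<Psi> (1 - s / 2) < C' * \<Psi> (1 - s)"
    using \<Psi> by (auto simp: doubling_weight_def)
  obtain C b where C: "0 \<le> C" "0 \<le> b" "b < 1" "\<And>r. b < r \<Longrightarrow> r < 1 \<Longrightarrow> pmean p f (of_real r) \<le> (C * \<Psi> r) powr p"
    using bigo_integral_meanD[OF p0 \<Psi>0 O] by blast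
  show ?thesis
  proof (rule integral_mean_bigo[OF p0, of "(2 * b + 1) / 3"])
    fix r :: real assume r: "(2 * b + 1) / 3 < r" "r < 1"
    define \<delta> where "\<delta> = (1 - r) / 2"
    have r0: "0 \<le> r" and \<delta>: "0 < \<delta>" "r + \<delta> < 1" "b < r - \<delta>" using r C by (auto simp: \<delta>_def field_simps)
    show "0 \<le> \<Psi> r / (1 - r)" using \<Psi>0[of r] r0 r by simp
    have "pmean p (deriv F) (of_real r) \<le> (2 / \<delta>) powr p * (C * \<Psi> (r + \<delta>)) powr p"
    proof (rule pmean_deriv_le[OF _ hol(1) continuous_mapping])
      fix z :: complex assume "cmod z < 1"
      then show "\<bar>Re (F z)\<bar> \<le> cmod (f z)" using abs_Re_le_cmod[of "f z"] by (simp add: f u)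
    next
      fix w :: complex assume w': "r - \<delta> \<le> cmod w" "cmod w \<le> r + \<delta>"
      have "pmean p f w = pmean p f (of_real (cmod w))"
        using w' \<delta> by (intro pmean_norm continuous_mapping p0) auto
      also have "\<dots> \<le> (C * \<Psi> (cmod w)) powr p" using w' \<delta> by (intro C) auto
      also have "\<dots> \<le> (C * \<Psi> (r + \<delta>)) powr p"
        using w' \<delta> C p0 w r0 \<Psi>0
        by (intro powr_mono2 mult_left_mono mono_onD[of "{0..<1}" \<Psi>] mult_nonneg_nonneg) (auto simp: weight_def)
      finally show "pmean p f w \<le> (C * \<Psi> (r + \<delta>)) powr p" .
    qed (use p r0 \<delta> in auto)
    also have "\<dots> = (2 / \<delta> * (C * \<Psi> (r + \<delta>))) powr p" by (simp only: powr_mult)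
    also have "\<dots> \<le> (4 * C * C' * (\<Psi> r / (1 - r))) powr p"
    proof (intro powr_mono2)
      have "\<Psi> (r + \<delta>) \<le> C' * \<Psi> r"
        using C'(2)[of "1 - r"] r r0 by (simp add: \<delta>_def field_simps)
      then have "2 / \<delta> * (C * \<Psi> (r + \<delta>)) \<le> 2 / \<delta> * (C * (C' * \<Psi> r))"
        using C \<delta> by (intro mult_left_mono) auto
      also have "\<dots> = 4 * C * C' * (\<Psi> r / (1 - r))" by (simp add: \<delta>_def)
      finally show "2 / \<delta> * (C * \<Psi> (r + \<delta>)) \<le> 4 * C * C' * (\<Psi> r / (1 - r))" .
      show "0 \<le> 2 / \<delta> * (C * \<Psi> (r + \<delta>))" using \<delta> C r0 \<Psi>0[of "r + \<delta>"] by simp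
    qed (use p in auto)
    also have "\<dots> = (4 * C * C') powr p * (\<Psi> r / (1 - r)) powr p" by (rule powr_mult)
    finally show "pmean p (gradient u) (of_real r) \<le> (4 * C * C') powr p * (\<Psi> r / (1 - r)) powr p"
      using pmean_gradient[of "of_real r" p] r r0 by simp
  qed (use C in auto)
qed

end

lemma weighted_integral_nonneg:
  assumes "weight \<eta>" "q \<ge> 1" "r < 1"
  shows "0 \<le> weighted_integral q \<eta> r"
  unfolding weighted_integral_def
  by (intro Henstock_Kurzweil_Integration.integral_nonneg weighted_integrable assms) auto

lemma Psi_of_powr_ge:
  assumes p: "1 < p" and \<eta>: "weight \<eta>" and r: "0 \<le> r" "r < 1"
  shows "weighted_integral p \<eta> r \<le> Psi_of p \<eta> r powr p"
proof -
  define A where "A = integral {0..r} (\<lambda>\<rho>. (1 - \<rho>\<^sup>2) powr (p - 1) * \<eta> \<rho> powr p)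
        + 2 powr (p - 1) / p * \<eta> r powr p * (1 - r) powr p"
  have sq: "\<rho>\<^sup>2 \<le> \<rho>" "\<rho>\<^sup>2 < 1" if "\<rho> \<in> {0..r}" for \<rho>
    using that r mult_right_mono[of \<rho> 1 \<rho>] by (auto simp: power2_eq_square)
  have "weighted_integral p \<eta> r \<le> integral {0..r} (\<lambda>\<rho>. (1 - \<rho>\<^sup>2) powr (p - 1) * \<eta> \<rho> powr p)"
    unfolding weighted_integral_def
  proof (rule integral_le)
    show "(\<lambda>\<rho>. (1 - \<rho>) powr (p - 1) * \<eta> \<rho> powr p) integrable_on {0..r}"
      using p r by (intro weighted_integrable \<eta>) auto
    have "continuous_on {0..r} \<eta>"
      by (rule continuous_on_subset[of "{0..<1}" \<eta>]) (use \<eta> r in \<open>auto simp: weight_def\<close>)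
    moreover have "\<eta> x \<noteq> 0" if "x \<in> {0..r}" for x
      using weight_lower_bound[OF \<eta>, of x] that r by auto
    moreover have "1 - x\<^sup>2 \<noteq> 0" if "x \<in> {0..r}" for x using sq(2)[OF that] by simp
    ultimately show "(\<lambda>\<rho>. (1 - \<rho>\<^sup>2) powr (p - 1) * \<eta> \<rho> powr p) integrable_on {0..r}"
      by (intro integrable_continuous_interval continuous_intros) auto
    fix \<rho> assume \<rho>: "\<rho> \<in> {0..r}"
    then show "(1 - \<rho>) powr (p - 1) * \<eta> \<rho> powr p \<le> (1 - \<rho>\<^sup>2) powr (p - 1) * \<eta> \<rho> powr p"
      using sq[OF \<rho>] r p by (intro mult_right_mono powr_mono2) auto
  qed
  also have "\<dots> \<le> A" using p by (simp add: A_def)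
  finally have A: "weighted_integral p \<eta> r \<le> A" .
  have "0 \<le> weighted_integral p \<eta> r" using p r by (intro weighted_integral_nonneg \<eta>) auto
  then have "A = (A powr (1 / p)) powr p" using A p by (simp add: powr_powr)
  then show ?thesis using A by (simp add: Psi_of_def A_def)
qed

lemma weighted_integral_2_eq:
  assumes \<eta>: "weight \<eta>" and r: "0 \<le> r" "r < 1"
  shows "weighted_integral 2 \<eta> r = integral {0..r} (\<lambda>\<rho>. (1 - \<rho>) * (\<eta> \<rho>)\<^sup>2)"
  unfolding weighted_integral_def
proof (rule integral_cong)
  fix \<rho> assume "\<rho> \<in> {0..r}"
  then have "1 - \<rho> > 0" "\<eta> \<rho> > 0" using weight_lower_bound[OF \<eta>, of \<rho>] r by auto
  then show "(1 - \<rho>) powr (2 - 1) * \<eta> \<rho> powr 2 = (1 - \<rho>) * (\<eta> \<rho>)\<^sup>2" by simp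
qed

lemma Phi_of_powr:
  assumes \<eta>: "weight \<eta>" and r: "0 \<le> r" "r < 1"
  shows "weighted_integral 2 \<eta> r powr (p / 2) = Phi_of \<eta> r powr p"
  using weighted_integral_nonneg[OF \<eta>, of 2 r] r
  by (simp add: Phi_of_def weighted_integral_2_eq[OF \<eta> r, symmetric] powr_powr flip: powr_half_sqrt)

lemma gradient_Re_holomorphic:
  assumes "g holomorphic_on ball 0 1" "cmod z < 1"
  shows "gradient (\<lambda>z. Re (g z)) z = cnj (deriv g z)"
proof -
  have P: "has_partials_at g z" "partial_x g z = deriv g z" "partial_y g z = \<i> * deriv g z"
    using holomorphic_has_partials[of "ball 0 1" z g] assms by auto
  show ?thesis
    using has_partials_at_bounded_linear(2,3)[OF bounded_linear_Re P(1)] P(2,3)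
    by (simp add: gradient_def complex_eq_iff)
qed

text \<open>The upper bound for the means of the extremal function is an instance of the
  general estimate, as the function is itself quasiregular with any constants.\<close>

lemma sharp_example:
  assumes p: "0 < p" "p \<le> 1" and K: "K \<ge> 1" "K0 \<ge> 0"
  shows "\<exists>g. harmonic_quasiregular_on K K0 unit_disc g \<and>
    (\<lambda>r. integral_mean p r (gradient (\<lambda>z. Re (g z)))) \<in> O[at_left 1](\<lambda>r. 1 / (1 - r)) \<and>
    (\<lambda>r. integral_mean p r g) \<in> \<Theta>[at_left 1](\<lambda>r. ln (1 / (1 - r)) powr (1 / p))"
proof -
  define g :: "complex \<Rightarrow> complex" where "g z = (1 - z) powr of_real (- 1 / p)" for z
  define C where "C = (1 / p) powr p * (2 * 4 powr (1 + p) / p)"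
  note E = one_minus_powr_example[OF p(1), folded g_def[abs_def] C_def]
  have hol: "g holomorphic_on ball 0 1" by (rule E(1))
  have qr: "harmonic_quasiregular_on K K0 unit_disc g"
    using hol K by (intro holomorphic_imp_harmonic_quasiregular_on) auto
  have grad: "(\<lambda>r. integral_mean p r (gradient (\<lambda>z. Re (g z)))) \<in> O[at_left 1](\<lambda>r. 1 / (1 - r))"
  proof (rule integral_mean_bigo[OF p(1), of "1 / 2"])
    fix r :: real assume r: "1 / 2 < r" "r < 1"
    have "pmean p (gradient (\<lambda>z. Re (g z))) (of_real r) = pmean p (deriv g) (of_real r)"
      using r by (intro pmean_cong) (auto simp: gradient_Re_holomorphic[OF hol])
    also have "\<dots> \<le> C * (1 - r) powr (- p)" using E(2)[of r] r by simp
    also have "(1 - r) powr (- p) = (1 / (1 - r)) powr p"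
      using r by (simp add: powr_minus powr_divide inverse_eq_divide)
    finally show "pmean p (gradient (\<lambda>z. Re (g z))) (of_real r) \<le> C * (1 / (1 - r)) powr p" .
  qed auto
  obtain F G where FG: "F holomorphic_on ball 0 1" "G holomorphic_on ball 0 1"
    "\<And>z. cmod z < 1 \<Longrightarrow> Re (g z) = Re (F z)" "\<And>z. cmod z < 1 \<Longrightarrow> Im (g z) = Re (G z)"
    "\<And>z. cmod z < 1 \<Longrightarrow> gradient (\<lambda>z. Re (g z)) z = cnj (deriv F z)"
    "\<And>z. cmod z < 1 \<Longrightarrow> cmod (deriv G z) \<le> K * cmod (deriv F z) + sqrt K0"
    using harmonic_quasiregular_decomposition[OF K _ qr, of "\<lambda>z. Re (g z)" "\<lambda>z. Im (g z)"] by auto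
  have upper: "(\<lambda>r. integral_mean p r g) \<in> O[at_left 1](\<lambda>r. ln (1 / (1 - r)) powr (1 / p))"
    by (rule growth_p_le_1[OF K _ FG p grad]) simp
  have lower: "(\<lambda>r. ln (1 / (1 - r)) powr (1 / p)) \<in> O[at_left 1](\<lambda>r. integral_mean p r g)"
  proof (rule bigoI[of _ "7 powr (1 / p)"])
    have "norm (ln (1 / (1 - r)) powr (1 / p)) \<le> 7 powr (1 / p) * norm (integral_mean p r g)" if r: "1 / 2 < r" "r < 1" for r
    proof -
      have "ln (1 / (1 - r)) powr (1 / p) \<le> (7 * pmean p g (of_real r)) powr (1 / p)"
        using E(3)[of r] r p ln_ge_zero[of "1 / (1 - r)"] by (intro powr_mono2) auto
      also have "\<dots> = 7 powr (1 / p) * pmean p g (of_real r) powr (1 / p)" by (rule powr_mult)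
      finally show ?thesis by (simp add: integral_mean_eq_pmean)
    qed
    then show "\<forall>\<^sub>F r in at_left 1. norm (ln (1 / (1 - r)) powr (1 / p)) \<le> 7 powr (1 / p) * norm (integral_mean p r g)"
      unfolding eventually_at_left_field by (intro exI[of _ "1 / 2"]) auto
  qed
  show ?thesis using qr grad upper lower by (auto simp: bigomega_iff_bigo intro!: exI[of _ g])
qed

section \<open>Growth of means and of gradients\<close>

theorem theorem2p1:
  fixes K K0 :: real and f :: "complex \<Rightarrow> complex" and u v :: "complex \<Rightarrow> real"
  assumes "K \<ge> 1" and "K0 \<ge> 0"
    and "\<And>z. f z = Complex (u z) (v z)"
    and "harmonic_quasiregular_on K K0 unit_disc f"
  shows
   "(\<forall>p. 0 < p \<and> p \<le> 1 \<longrightarrow>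
       (\<lambda>r. integral_mean p r (gradient u)) \<in> O[at_left 1](\<lambda>r. 1 / (1 - r)) \<longrightarrow>
       (\<lambda>r. integral_mean p r f) \<in> O[at_left 1](\<lambda>r. ln (1 / (1 - r)) powr (1 / p)))
    \<and>
    (\<forall>p L L0. 1 / 2 \<le> p \<and> p < 1 \<and> L \<ge> 1 \<and> L0 \<ge> 0 \<longrightarrow>
       (\<exists>g. harmonic_quasiregular_on L L0 unit_disc g \<and>
          (\<lambda>r. integral_mean p r (gradient (\<lambda>z. Re (g z)))) \<in> O[at_left 1](\<lambda>r. 1 / (1 - r)) \<and>
          (\<lambda>r. integral_mean p r g) \<in> \<Theta>[at_left 1](\<lambda>r. ln (1 / (1 - r)) powr (1 / p))))
    \<and>
    (\<forall>p. 1 < p \<and> p < 2 \<longrightarrow>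
       (\<forall>\<eta>. weight \<eta> \<longrightarrow>
          (\<lambda>r. integral_mean p r (gradient u)) \<in> O[at_left 1](\<eta>) \<longrightarrow>
          (\<lambda>r. integral_mean p r f) \<in> O[at_left 1](Psi_of p \<eta>)) \<and>
       (\<forall>\<Psi>. doubling_weight \<Psi> \<longrightarrow>
          (\<lambda>r. integral_mean p r f) \<in> O[at_left 1](\<Psi>) \<longrightarrow>
          (\<lambda>r. integral_mean p r (gradient u)) \<in> O[at_left 1](\<lambda>r. \<Psi> r / (1 - r))))
    \<and>
    (\<forall>p. 2 \<le> p \<longrightarrow>
       (\<forall>\<eta>. weight \<eta> \<longrightarrow>
          (\<lambda>r. integral_mean p r (gradient u)) \<in> O[at_left 1](\<eta>) \<longrightarrow>
          (\<lambda>r. integral_mean p r f) \<in> O[at_left 1](Phi_of \<eta>)) \<and>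
       (\<forall>\<Phi>. doubling_weight \<Phi> \<longrightarrow>
          (\<lambda>r. integral_mean p r f) \<in> O[at_left 1](\<Phi>) \<longrightarrow>
          (\<lambda>r. integral_mean p r (gradient u)) \<in> O[at_left 1](\<lambda>r. \<Phi> r / (1 - r))))"
proof (intro conjI)
  obtain F G where FG: "F holomorphic_on ball 0 1" "G holomorphic_on ball 0 1"
    "\<And>z. cmod z < 1 \<Longrightarrow> u z = Re (F z)" "\<And>z. cmod z < 1 \<Longrightarrow> v z = Re (G z)"
    "\<And>z. cmod z < 1 \<Longrightarrow> gradient u z = cnj (deriv F z)"
    "\<And>z. cmod z < 1 \<Longrightarrow> cmod (deriv G z) \<le> K * cmod (deriv F z) + sqrt K0"
    using harmonic_quasiregular_decomposition[OF assms] by blast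
  note D = assms(1-3) FG
  show "\<forall>p. 0 < p \<and> p \<le> 1 \<longrightarrow>
       (\<lambda>r. integral_mean p r (gradient u)) \<in> O[at_left 1](\<lambda>r. 1 / (1 - r)) \<longrightarrow>
       (\<lambda>r. integral_mean p r f) \<in> O[at_left 1](\<lambda>r. ln (1 / (1 - r)) powr (1 / p))"
    using growth_p_le_1[OF D] by blast
  show "\<forall>p L L0. 1 / 2 \<le> p \<and> p < 1 \<and> L \<ge> 1 \<and> L0 \<ge> 0 \<longrightarrow>
       (\<exists>g. harmonic_quasiregular_on L L0 unit_disc g \<and>
          (\<lambda>r. integral_mean p r (gradient (\<lambda>z. Re (g z)))) \<in> O[at_left 1](\<lambda>r. 1 / (1 - r)) \<and>
          (\<lambda>r. integral_mean p r g) \<in> \<Theta>[at_left 1](\<lambda>r. ln (1 / (1 - r)) powr (1 / p)))"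
    using sharp_example by simp
  show "\<forall>p. 1 < p \<and> p < 2 \<longrightarrow>
       (\<forall>\<eta>. weight \<eta> \<longrightarrow>
          (\<lambda>r. integral_mean p r (gradient u)) \<in> O[at_left 1](\<eta>) \<longrightarrow>
          (\<lambda>r. integral_mean p r f) \<in> O[at_left 1](Psi_of p \<eta>)) \<and>
       (\<forall>\<Psi>. doubling_weight \<Psi> \<longrightarrow>
          (\<lambda>r. integral_mean p r f) \<in> O[at_left 1](\<Psi>) \<longrightarrow>
          (\<lambda>r. integral_mean p r (gradient u)) \<in> O[at_left 1](\<lambda>r. \<Psi> r / (1 - r)))"
  proof (intro allI impI conjI; elim conjE)
    fix p :: real and \<eta> assume p: "1 < p" "p < 2" and \<eta>: "weight \<eta>"
      and O: "(\<lambda>r. integral_mean p r (gradient u)) \<in> O[at_left 1](\<eta>)"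
    show "(\<lambda>r. integral_mean p r f) \<in> O[at_left 1](Psi_of p \<eta>)"
    proof (rule growth_p_gt_1[OF D p(1) \<eta> O])
      fix r :: real assume "1 / 2 < r" "r < 1"
      then show "weighted_integral (min p 2) \<eta> r powr (p / min p 2) \<le> Psi_of p \<eta> r powr p"
        using Psi_of_powr_ge[OF p(1) \<eta>, of r] weighted_integral_nonneg[OF \<eta>, of p r] p by simp
      show "0 \<le> Psi_of p \<eta> r" unfolding Psi_of_def by (rule powr_ge_zero)
    qed
  qed (rule gradient_growth[OF D])
  show "\<forall>p. 2 \<le> p \<longrightarrow>
       (\<forall>\<eta>. weight \<eta> \<longrightarrow>
          (\<lambda>r. integral_mean p r (gradient u)) \<in> O[at_left 1](\<eta>) \<longrightarrow>
          (\<lambda>r. integral_mean p r f) \<in> O[at_left 1](Phi_of \<eta>)) \<and>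
       (\<forall>\<Phi>. doubling_weight \<Phi> \<longrightarrow>
          (\<lambda>r. integral_mean p r f) \<in> O[at_left 1](\<Phi>) \<longrightarrow>
          (\<lambda>r. integral_mean p r (gradient u)) \<in> O[at_left 1](\<lambda>r. \<Phi> r / (1 - r)))"
  proof (intro allI impI conjI)
    fix p :: real assume p: "2 \<le> p"
    then have p1: "1 < p" by simp
    fix \<eta> :: "real \<Rightarrow> real" assume \<eta>: "weight \<eta>"
      and O: "(\<lambda>r. integral_mean p r (gradient u)) \<in> O[at_left 1](\<eta>)"
    show "(\<lambda>r. integral_mean p r f) \<in> O[at_left 1](Phi_of \<eta>)"
    proof (rule growth_p_gt_1[OF D p1 \<eta> O])
      fix r :: real assume r: "1 / 2 < r" "r < 1"
      have "0 \<le> weighted_integral 2 \<eta> r" using r by (intro weighted_integral_nonneg \<eta>) auto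
      then show "0 \<le> Phi_of \<eta> r" using r by (simp add: Phi_of_def weighted_integral_2_eq[OF \<eta>, of r])
      show "weighted_integral (min p 2) \<eta> r powr (p / min p 2) \<le> Phi_of \<eta> r powr p"
        using r p Phi_of_powr[OF \<eta>, of r p] by simp
    qed
  next
    fix p :: real and \<Phi> assume p: "2 \<le> p" and \<Phi>: "doubling_weight \<Phi>"
      and O: "(\<lambda>r. integral_mean p r f) \<in> O[at_left 1](\<Phi>)"
    then show "(\<lambda>r. integral_mean p r (gradient u)) \<in> O[at_left 1](\<lambda>r. \<Phi> r / (1 - r))"
      by (intro gradient_growth[OF D]) auto
  qed
qed

end
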